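(* Let $H\in(0,1)$, let $(A(s))_{s\in\mathbb{R}}$ be a centered fractional Brownian motion with Hurst parameter $H$, and let $M:=\sup_{s>0}(A(s)-s)$ and $M(t):=\sup_{s\in[0,t]}(A(s)-s)$. For $x>0$ and $t\ge 0$ put $$\gamma(x,t):=\mathbb{P}(M>x)-\mathbb{P}(M(t)>x),$$ and let $$\mathbb{D}_1(t):=\sup_{x>0}\gamma(x,t),\qquad \mathbb{D}_2(t):=\int_{0}^{\infty}\gamma(x,t)\,dx .$$ Let $\mathscr{B}:=\{f\in\mathscr{R}\mid \forall r\in[0,1]: f(r)\ge r\}$ and $\vartheta:=\inf_{f\in\mathscr{B}}\mathbb{I}(f)$, where $\mathscr{R}$ is the reproducing kernel Hilbert space of $A$ and $\mathbb{I}(f)=\frac12\|f\|^2$ for $f\in\mathscr{R}$. Then: (i) (Kolmogorov--Smirnov distance) $$\lim_{t\to\infty}\frac{1}{t^{2-2H}}\log\mathbb{D}_1(t)=-\inf_{f\in\mathscr{B}}\mathbb{I}(f)=-\vartheta .$$ (ii) (Integral distance) $$\lim_{t\to\infty}\frac{1}{t^{2-2H}}\log\mathbb{D}_2(t)=-\inf_{f\in\mathscr{B}}\mathbb{I}(f)=-\vartheta .$$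
   Context: A centered fractional Brownian motion with Hurst parameter $H\in(0,1)$ is a centered Gaussian process $(A(s))_{s\in\mathbb{R}}$ with stationary increments, continuous sample paths, $A(0)=0$ and $\mathrm{Var}(A(s))=|s|^{2H}$; its covariance is $\Gamma(s,t)=\frac12(|s|^{2H}+|t|^{2H}-|s-t|^{2H})$. The space $\mathscr{R}$ is the reproducing kernel Hilbert space of $A$, i.e. the Hilbert space of functions $f:\mathbb{R}\to\mathbb{R}$ obtained by completing the linear span of $\{\Gamma(s,\cdot):s\in\mathbb{R}\}$ with respect to the inner product determined by $\langle\Gamma(s,\cdot),\Gamma(t,\cdot)\rangle=\Gamma(s,t)$; $\|f\|=\sqrt{\langle f,f\rangle}$. The rate functional is $\mathbb{I}(f)=\frac12\|f\|^2$ if $f\in\mathscr{R}$ and $\mathbb{I}(f)=\infty$ otherwise. *)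

theory Defs
  imports "HOL-Probability.Probability"
begin

section \<open>The reproducing kernel Hilbert space of a kernel\<close>

definition kernel_comb :: "('i \<Rightarrow> 'i \<Rightarrow> real) \<Rightarrow> 'i set \<Rightarrow> ('i \<Rightarrow> real) \<Rightarrow> 'i \<Rightarrow> real" where
  "kernel_comb K S c = (\<lambda>t. \<Sum>s\<in>S. c s * K s t)"

definition kernel_span :: "('i \<Rightarrow> 'i \<Rightarrow> real) \<Rightarrow> ('i \<Rightarrow> real) set" where
  "kernel_span K = {kernel_comb K S c | S c. finite S}"

definition psd_kernel :: "('i \<Rightarrow> 'i \<Rightarrow> real) \<Rightarrow> bool" where
  "psd_kernel K \<longleftrightarrow> (\<forall>s t. K s t = K t s) \<and>
     (\<forall>S c. finite S \<longrightarrow> 0 \<le> (\<Sum>s\<in>S. \<Sum>t\<in>S. c s * c t * K s t))"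

text \<open>The inner product on the span: bilinear, with \<open>\<langle>K s, K t\<rangle> = K s t\<close>. For symmetric
  \<open>K\<close> it depends only on the two functions, not on their representations; see
  \<open>span_inner_comb\<close>.\<close>

definition span_inner :: "('i \<Rightarrow> 'i \<Rightarrow> real) \<Rightarrow> ('i \<Rightarrow> real) \<Rightarrow> ('i \<Rightarrow> real) \<Rightarrow> real" where
  "span_inner K f g = (THE v. \<exists>S c T d. finite S \<and> finite T \<and>
     f = kernel_comb K S c \<and> g = kernel_comb K T d \<and>
     v = (\<Sum>s\<in>S. \<Sum>t\<in>T. c s * d t * K s t))"

definition span_norm :: "('i \<Rightarrow> 'i \<Rightarrow> real) \<Rightarrow> ('i \<Rightarrow> real) \<Rightarrow> real" where
  "span_norm K f = sqrt (span_inner K f f)"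

text \<open>The completion of the span is realized as a space of functions: its elements are the
  pointwise limits of Cauchy sequences of the span (norm-Cauchy sequences converge pointwise,
  since evaluation at \<open>t\<close> is the inner product with \<open>K t\<close>). The inner product is the limit of
  the inner products along such sequences; for a positive semidefinite kernel this limit exists
  and does not depend on the sequences, see \<open>rkhs_inner_tendsto\<close>.\<close>

definition rkhs_approx ::
  "('i \<Rightarrow> 'i \<Rightarrow> real) \<Rightarrow> (nat \<Rightarrow> 'i \<Rightarrow> real) \<Rightarrow> ('i \<Rightarrow> real) \<Rightarrow> bool" where
  "rkhs_approx K u f \<longleftrightarrow>
     (\<forall>n. u n \<in> kernel_span K) \<and>
     (\<forall>e>0. \<exists>N. \<forall>m\<ge>N. \<forall>n\<ge>N. span_norm K (\<lambda>t. u m t - u n t) < e) \<and>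
     (\<forall>t. (\<lambda>n. u n t) \<longlonglongrightarrow> f t)"

definition rkhs :: "('i \<Rightarrow> 'i \<Rightarrow> real) \<Rightarrow> ('i \<Rightarrow> real) set" where
  "rkhs K = {f. \<exists>u. rkhs_approx K u f}"

definition rkhs_inner :: "('i \<Rightarrow> 'i \<Rightarrow> real) \<Rightarrow> ('i \<Rightarrow> real) \<Rightarrow> ('i \<Rightarrow> real) \<Rightarrow> real" where
  "rkhs_inner K f g = (THE l. \<forall>u v. rkhs_approx K u f \<longrightarrow> rkhs_approx K v g \<longrightarrow>
     (\<lambda>n. span_inner K (u n) (v n)) \<longlonglongrightarrow> l)"

definition rkhs_norm :: "('i \<Rightarrow> 'i \<Rightarrow> real) \<Rightarrow> ('i \<Rightarrow> real) \<Rightarrow> real" where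
  "rkhs_norm K f = sqrt (rkhs_inner K f f)"

lemma span_inner_comb:
  assumes sym: "\<And>s t. K s t = K t s" and S: "finite S" and T: "finite T"
  shows "span_inner K (kernel_comb K S c) (kernel_comb K T d) =
    (\<Sum>s\<in>S. \<Sum>t\<in>T. c s * d t * K s t)"
proof -
  have right: "(\<Sum>s\<in>S'. \<Sum>t\<in>T'. c' s * d' t * K s t) = (\<Sum>t\<in>T'. d' t * kernel_comb K S' c' t)"
    for S' T' :: "'a set" and c' d'
    unfolding kernel_comb_def by (subst sum.swap) (simp add: sum_distrib_left mult_ac)
  have left: "(\<Sum>s\<in>S'. \<Sum>t\<in>T'. c' s * d' t * K s t) = (\<Sum>s\<in>S'. c' s * kernel_comb K T' d' s)"
    for S' T' :: "'a set" and c' d'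
    unfolding kernel_comb_def
    by (intro sum.cong refl, subst sum_distrib_left, intro sum.cong refl, subst sym) simp
  show ?thesis
    unfolding span_inner_def
  proof (rule the_equality)
    show "\<exists>S' c' T' d'. finite S' \<and> finite T' \<and> kernel_comb K S c = kernel_comb K S' c' \<and>
       kernel_comb K T d = kernel_comb K T' d' \<and>
       (\<Sum>s\<in>S. \<Sum>t\<in>T. c s * d t * K s t) = (\<Sum>s\<in>S'. \<Sum>t\<in>T'. c' s * d' t * K s t)"
      using S T by blast
  next
    fix v
    assume "\<exists>S' c' T' d'. finite S' \<and> finite T' \<and> kernel_comb K S c = kernel_comb K S' c' \<and>
       kernel_comb K T d = kernel_comb K T' d' \<and>
       v = (\<Sum>s\<in>S'. \<Sum>t\<in>T'. c' s * d' t * K s t)"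
    then obtain S' c' T' d' where eq: "kernel_comb K S c = kernel_comb K S' c'"
      "kernel_comb K T d = kernel_comb K T' d'"
      and v: "v = (\<Sum>s\<in>S'. \<Sum>t\<in>T'. c' s * d' t * K s t)" by blast
    have "v = (\<Sum>t\<in>T'. d' t * kernel_comb K S c t)"
      unfolding v eq(1) by (rule right)
    also have "\<dots> = (\<Sum>s\<in>S. \<Sum>t\<in>T'. c s * d' t * K s t)"
      by (rule right [symmetric])
    also have "\<dots> = (\<Sum>s\<in>S. c s * kernel_comb K T d s)"
      unfolding eq(2) by (rule left)
    also have "\<dots> = (\<Sum>s\<in>S. \<Sum>t\<in>T. c s * d t * K s t)"
      by (rule left [symmetric])
    finally show "v = (\<Sum>s\<in>S. \<Sum>t\<in>T. c s * d t * K s t)" .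
  qed
qed

lemma span_inner_eval:
  assumes "psd_kernel K" "f \<in> kernel_span K" "finite T"
  shows "span_inner K f (kernel_comb K T d) = (\<Sum>t\<in>T. d t * f t)"
proof -
  obtain S c where "finite S" "f = kernel_comb K S c"
    using assms(2) by (auto simp: kernel_span_def)
  moreover have "\<And>s t. K s t = K t s"
    using assms(1) unfolding psd_kernel_def by blast
  ultimately have "span_inner K f (kernel_comb K T d) = (\<Sum>s\<in>S. \<Sum>t\<in>T. c s * d t * K s t)"
    using assms(3) span_inner_comb by blast
  also have "\<dots> = (\<Sum>t\<in>T. d t * f t)"
    unfolding \<open>f = _\<close> kernel_comb_def
    by (subst sum.swap) (simp add: sum_distrib_left mult_ac)
  finally show ?thesis .
qed

lemma kernel_span_lincomb:
  assumes "f \<in> kernel_span K" "g \<in> kernel_span K"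
  shows "(\<lambda>t. a * f t + b * g t) \<in> kernel_span K"
proof -
  obtain S c T d where f: "finite S" "f = kernel_comb K S c"
    and g: "finite T" "g = kernel_comb K T d"
    using assms by (auto simp: kernel_span_def)
  define h where "h s = a * (if s \<in> S then c s else 0) + b * (if s \<in> T then d s else 0)" for s
  have 1: "(\<Sum>s\<in>S \<union> T. (if s \<in> S then c s else 0) * K s t) = f t" for t
    unfolding f kernel_comb_def using f g by (intro sum.mono_neutral_cong_right) auto
  have 2: "(\<Sum>s\<in>S \<union> T. (if s \<in> T then d s else 0) * K s t) = g t" for t
    unfolding g kernel_comb_def using f g by (intro sum.mono_neutral_cong_right) auto
  have "kernel_comb K (S \<union> T) h t = a * f t + b * g t" for t
    unfolding 1 [symmetric] 2 [symmetric] kernel_comb_def h_def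
    by (simp add: distrib_right sum.distrib sum_distrib_left mult.assoc)
  then have "(\<lambda>t. a * f t + b * g t) = kernel_comb K (S \<union> T) h" by auto
  then show ?thesis using f g by (auto simp: kernel_span_def)
qed

lemma kernel_span_diff:
  assumes "f \<in> kernel_span K" "g \<in> kernel_span K"
  shows "(\<lambda>t. f t - g t) \<in> kernel_span K"
  using kernel_span_lincomb [OF assms, of 1 "-1"] by simp

lemma span_inner_commute:
  assumes "psd_kernel K" "f \<in> kernel_span K" "g \<in> kernel_span K"
  shows "span_inner K f g = span_inner K g f"
proof -
  obtain S c T d where f: "finite S" "f = kernel_comb K S c"
    and g: "finite T" "g = kernel_comb K T d"
    using assms by (auto simp: kernel_span_def)
  have sym: "\<And>s t. K s t = K t s"
    using assms(1) unfolding psd_kernel_def by blast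
  have "(\<Sum>s\<in>S. \<Sum>t\<in>T. c s * d t * K s t) = (\<Sum>t\<in>T. \<Sum>s\<in>S. d t * c s * K t s)"
    by (subst sum.swap) (intro sum.cong refl, subst sym, simp)
  then show ?thesis
    unfolding f g by (simp add: span_inner_comb [OF sym] f g)
qed

lemma span_inner_lincomb_left:
  assumes "psd_kernel K" "f \<in> kernel_span K" "g \<in> kernel_span K" "h \<in> kernel_span K"
  shows "span_inner K (\<lambda>t. a * f t + b * g t) h = a * span_inner K f h + b * span_inner K g h"
proof -
  obtain T d where h: "finite T" "h = kernel_comb K T d"
    using assms(4) by (auto simp: kernel_span_def)
  show ?thesis
    unfolding h
    by (simp add: span_inner_eval [OF assms(1) _ h(1)] assms kernel_span_lincomb
        sum.distrib sum_distrib_left algebra_simps)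
qed

lemma span_inner_diff_left:
  assumes "psd_kernel K" "f \<in> kernel_span K" "g \<in> kernel_span K" "h \<in> kernel_span K"
  shows "span_inner K (\<lambda>t. f t - g t) h = span_inner K f h - span_inner K g h"
  using span_inner_lincomb_left [OF assms, of 1 "-1"] by simp

lemma span_inner_diff_right:
  assumes "psd_kernel K" "f \<in> kernel_span K" "g \<in> kernel_span K" "h \<in> kernel_span K"
  shows "span_inner K h (\<lambda>t. f t - g t) = span_inner K h f - span_inner K h g"
  using span_inner_diff_left [OF assms] span_inner_commute [OF assms(1)] assms kernel_span_diff
  by metis

lemma span_inner_nonneg:
  assumes "psd_kernel K" "f \<in> kernel_span K"
  shows "0 \<le> span_inner K f f"
proof -
  obtain S c where f: "finite S" "f = kernel_comb K S c"
    using assms by (auto simp: kernel_span_def)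
  have sym: "\<And>s t. K s t = K t s"
    using assms(1) unfolding psd_kernel_def by blast
  show ?thesis
    using assms(1) f(1) unfolding f(2) psd_kernel_def
    by (subst span_inner_comb [OF sym f(1) f(1)]) blast
qed

lemma span_norm_nonneg:
  assumes "psd_kernel K" "f \<in> kernel_span K"
  shows "0 \<le> span_norm K f"
  using span_inner_nonneg [OF assms] by (simp add: span_norm_def)

lemma span_norm_sq:
  assumes "psd_kernel K" "f \<in> kernel_span K"
  shows "(span_norm K f)\<^sup>2 = span_inner K f f"
  using span_inner_nonneg [OF assms] by (simp add: span_norm_def)

lemma span_inner_lincomb_self:
  assumes "psd_kernel K" "f \<in> kernel_span K" "g \<in> kernel_span K"
  shows "span_inner K (\<lambda>t. a * f t + b * g t) (\<lambda>t. a * f t + b * g t) =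
    a\<^sup>2 * span_inner K f f + 2 * a * b * span_inner K f g + b\<^sup>2 * span_inner K g g"
proof -
  let ?h = "\<lambda>t. a * f t + b * g t"
  have h: "?h \<in> kernel_span K" using assms kernel_span_lincomb by blast
  have "span_inner K ?h ?h = a * span_inner K ?h f + b * span_inner K ?h g"
    using span_inner_lincomb_left [OF assms(1,2,3) h, of a b]
      span_inner_commute [OF assms(1) assms(2) h] span_inner_commute [OF assms(1) assms(3) h]
    by simp
  then show ?thesis
    using span_inner_commute [OF assms]
    by (simp add: span_inner_lincomb_left [OF assms(1,2,3)] assms power2_eq_square algebra_simps)
qed

lemma span_inner_Cauchy_Schwarz:
  assumes "psd_kernel K" "f \<in> kernel_span K" "g \<in> kernel_span K"
  shows "\<bar>span_inner K f g\<bar> \<le> span_norm K f * span_norm K g"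
proof -
  let ?a = "span_inner K f f" and ?b = "span_inner K f g" and ?c = "span_inner K g g"
  have nn: "0 \<le> ?a" "0 \<le> ?c" using span_inner_nonneg assms by blast+
  have q: "0 \<le> x\<^sup>2 * ?a + 2 * x * y * ?b + y\<^sup>2 * ?c" for x y
    using span_inner_nonneg [OF assms(1) kernel_span_lincomb [OF assms(2,3)], of x y]
    by (simp only: span_inner_lincomb_self [OF assms])
  have "?b\<^sup>2 \<le> ?a * ?c"
  proof (cases "?c = 0")
    case True
    have "?b = 0"
    proof (rule ccontr)
      assume "?b \<noteq> 0"
      then show False
        using q [of 1 "- (?a + 1) / (2 * ?b)"] True nn by (simp add: field_simps)
    qed
    then show ?thesis using nn by simp
  next
    case False
    then have c: "?c > 0" using nn by simp
    have "?c\<^sup>2 * ?a + 2 * ?c * (- ?b) * ?b + (- ?b)\<^sup>2 * ?c = ?c * (?a * ?c - ?b\<^sup>2)"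
      by (simp add: power2_eq_square algebra_simps)
    then have "0 \<le> ?c * (?a * ?c - ?b\<^sup>2)" using q [of ?c "- ?b"] by simp
    then show ?thesis using c by (simp add: zero_le_mult_iff)
  qed
  then have "\<bar>?b\<bar> \<le> sqrt (?a * ?c)" by (metis real_sqrt_abs real_sqrt_le_mono)
  then show ?thesis by (simp add: span_norm_def real_sqrt_mult)
qed

lemma span_norm_triangle_diff:
  assumes "psd_kernel K" "f \<in> kernel_span K" "g \<in> kernel_span K"
  shows "span_norm K (\<lambda>t. f t - g t) \<le> span_norm K f + span_norm K g"
proof (rule power2_le_imp_le)
  have "(span_norm K (\<lambda>t. f t - g t))\<^sup>2 = span_inner K f f - 2 * span_inner K f g + span_inner K g g"
    using span_inner_lincomb_self [OF assms, of 1 "-1"] span_norm_sq [OF assms(1) kernel_span_diff [OF assms(2,3)]]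
    by simp
  also have "\<dots> \<le> (span_norm K f)\<^sup>2 + 2 * (span_norm K f * span_norm K g) + (span_norm K g)\<^sup>2"
    unfolding span_norm_sq [OF assms(1,2)] span_norm_sq [OF assms(1,3)]
    using span_inner_Cauchy_Schwarz [OF assms] by linarith
  finally show "(span_norm K (\<lambda>t. f t - g t))\<^sup>2 \<le> (span_norm K f + span_norm K g)\<^sup>2"
    by (simp add: power2_eq_square algebra_simps)
  show "0 \<le> span_norm K f + span_norm K g"
    by (intro add_nonneg_nonneg span_norm_nonneg assms)
qed

lemma rkhs_approx_diff:
  assumes psd: "psd_kernel K" and u: "rkhs_approx K u f" and v: "rkhs_approx K v g"
  shows "rkhs_approx K (\<lambda>n t. u n t - v n t) (\<lambda>t. f t - g t)"
  unfolding rkhs_approx_def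
proof (intro conjI allI impI)
  have us: "u n \<in> kernel_span K" and vs: "v n \<in> kernel_span K" for n
    using u v by (auto simp: rkhs_approx_def)
  fix n show "(\<lambda>t. u n t - v n t) \<in> kernel_span K" using us vs kernel_span_diff by blast
next
  have us: "u n \<in> kernel_span K" and vs: "v n \<in> kernel_span K" for n
    using u v by (auto simp: rkhs_approx_def)
  fix e :: real assume "e > 0"
  then have e2: "e / 2 > 0" by simp
  obtain N1 where N1: "\<And>m n. m \<ge> N1 \<Longrightarrow> n \<ge> N1 \<Longrightarrow> span_norm K (\<lambda>t. u m t - u n t) < e / 2"
    using u e2 unfolding rkhs_approx_def by blast
  obtain N2 where N2: "\<And>m n. m \<ge> N2 \<Longrightarrow> n \<ge> N2 \<Longrightarrow> span_norm K (\<lambda>t. v m t - v n t) < e / 2"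
    using v e2 unfolding rkhs_approx_def by blast
  show "\<exists>N. \<forall>m\<ge>N. \<forall>n\<ge>N. span_norm K (\<lambda>t. u m t - v m t - (u n t - v n t)) < e"
  proof (intro exI [of _ "max N1 N2"] allI impI)
    fix m n assume "max N1 N2 \<le> m" "max N1 N2 \<le> n"
    then have "span_norm K (\<lambda>t. (u m t - u n t) - (v m t - v n t)) < e"
      using span_norm_triangle_diff [OF psd kernel_span_diff [OF us us] kernel_span_diff [OF vs vs],
          of m n m n] N1 [of m n] N2 [of m n] by simp
    then show "span_norm K (\<lambda>t. u m t - v m t - (u n t - v n t)) < e"
      by (simp add: algebra_simps)
  qed
next
  fix t show "(\<lambda>n. u n t - v n t) \<longlonglongrightarrow> f t - g t"
    using u v by (intro tendsto_diff) (auto simp: rkhs_approx_def)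
qed

lemma rkhs_approx_bounded:
  assumes psd: "psd_kernel K" and u: "rkhs_approx K u f"
  obtains B where "B > 0" "\<And>n. span_norm K (u n) \<le> B"
proof -
  have us: "u n \<in> kernel_span K" for n
    using u by (auto simp: rkhs_approx_def)
  obtain N where N: "\<And>m n. m \<ge> N \<Longrightarrow> n \<ge> N \<Longrightarrow> span_norm K (\<lambda>t. u m t - u n t) < 1"
    using u zero_less_one unfolding rkhs_approx_def by blast
  let ?n = "\<lambda>n. span_norm K (u n)"
  have tri: "?n n \<le> span_norm K (\<lambda>t. u N t - u n t) + ?n N" for n
    using span_norm_triangle_diff [OF psd us [of N] kernel_span_diff [OF us [of N] us [of n]]] by simp
  define B where "B = 1 + ?n N + (\<Sum>i<N. ?n i)"
  have "?n n \<le> B" for n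
  proof (cases "n < N")
    case True
    then have "?n n \<le> (\<Sum>i<N. ?n i)"
      by (intro member_le_sum) (auto intro: span_norm_nonneg [OF psd us])
    then show ?thesis using span_norm_nonneg [OF psd us, of N] by (simp add: B_def)
  next
    case False
    then show ?thesis
      using tri [of n] N [of N n] sum_nonneg [of "{..<N}" ?n] span_norm_nonneg [OF psd us]
      by (fastforce simp: B_def)
  qed
  moreover have "B > 0"
    unfolding B_def using span_norm_nonneg [OF psd us]
    by (intro add_pos_nonneg sum_nonneg) auto
  ultimately show ?thesis using that by blast
qed

text \<open>A Cauchy sequence of the span that tends to zero pointwise tends to zero in norm.\<close>

lemma rkhs_approx_zero:
  assumes psd: "psd_kernel K" and w: "rkhs_approx K w (\<lambda>t. 0)"
  shows "(\<lambda>n. span_norm K (w n)) \<longlonglongrightarrow> 0"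
proof -
  have ws: "w n \<in> kernel_span K" for n
    using w by (auto simp: rkhs_approx_def)
  obtain B where B: "B > 0" "\<And>n. span_norm K (w n) \<le> B"
    using rkhs_approx_bounded [OF psd w] by blast
  have "(\<lambda>n. span_inner K (w n) (w n)) \<longlonglongrightarrow> 0"
  proof (rule LIMSEQ_I)
    fix r :: real assume r: "r > 0"
    then have "r / (2 * B) > 0" using B by simp
    then obtain N where N: "\<And>m n. m \<ge> N \<Longrightarrow> n \<ge> N \<Longrightarrow> span_norm K (\<lambda>t. w m t - w n t) < r / (2 * B)"
      using w unfolding rkhs_approx_def by blast
    obtain T d where T: "finite T" "w N = kernel_comb K T d"
      using ws [of N] by (auto simp: kernel_span_def)
    have "(\<lambda>n. \<Sum>t\<in>T. d t * w n t) \<longlonglongrightarrow> (\<Sum>t\<in>T. d t * 0)"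
      using w by (intro tendsto_intros) (auto simp: rkhs_approx_def)
    then have "(\<lambda>n. span_inner K (w n) (w N)) \<longlonglongrightarrow> 0"
      unfolding T by (simp add: span_inner_eval [OF psd ws T(1)])
    then obtain N' where N': "\<And>n. n \<ge> N' \<Longrightarrow> \<bar>span_inner K (w n) (w N)\<bar> < r / 2"
      using LIMSEQ_D [of "\<lambda>n. span_inner K (w n) (w N)" 0 "r / 2"] r by auto
    show "\<exists>no. \<forall>n\<ge>no. norm (span_inner K (w n) (w n) - 0) < r"
    proof (intro exI [of _ "max N N'"] allI impI)
      fix n assume n: "max N N' \<le> n"
      have "span_inner K (w n) (w n) =
          span_inner K (w n) (\<lambda>t. w n t - w N t) + span_inner K (w n) (w N)"
        by (simp add: span_inner_diff_right [OF psd ws ws ws])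
      moreover have "\<bar>span_inner K (w n) (\<lambda>t. w n t - w N t)\<bar> \<le> B * (r / (2 * B))"
        using n N [of n N] B
        by (intro order.trans [OF span_inner_Cauchy_Schwarz [OF psd ws kernel_span_diff [OF ws ws]]]
            mult_mono) (auto intro: span_norm_nonneg [OF psd kernel_span_diff [OF ws ws]] less_imp_le)
      ultimately show "norm (span_inner K (w n) (w n) - 0) < r"
        using N' [of n] n B by simp
    qed
  qed
  then show ?thesis
    unfolding span_norm_def using tendsto_real_sqrt by fastforce
qed

lemma span_inner_convergent:
  assumes psd: "psd_kernel K" and u: "rkhs_approx K u f" and v: "rkhs_approx K v g"
  shows "convergent (\<lambda>n. span_inner K (u n) (v n))"
proof (rule Cauchy_convergent, rule metric_CauchyI)
  have us: "u n \<in> kernel_span K" and vs: "v n \<in> kernel_span K" for n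
    using u v by (auto simp: rkhs_approx_def)
  obtain B where B: "B > 0" "\<And>n. span_norm K (u n) \<le> B"
    using rkhs_approx_bounded [OF psd u] by blast
  obtain C where C: "C > 0" "\<And>n. span_norm K (v n) \<le> C"
    using rkhs_approx_bounded [OF psd v] by blast
  fix e :: real assume e: "e > 0"
  have "e / (2 * C) > 0" "e / (2 * B) > 0" using e B C by auto
  then obtain N1 N2 where
    N1: "\<And>m n. m \<ge> N1 \<Longrightarrow> n \<ge> N1 \<Longrightarrow> span_norm K (\<lambda>t. u m t - u n t) < e / (2 * C)" and
    N2: "\<And>m n. m \<ge> N2 \<Longrightarrow> n \<ge> N2 \<Longrightarrow> span_norm K (\<lambda>t. v m t - v n t) < e / (2 * B)"
    using u v unfolding rkhs_approx_def by meson
  show "\<exists>M. \<forall>m\<ge>M. \<forall>n\<ge>M. dist (span_inner K (u m) (v m)) (span_inner K (u n) (v n)) < e"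
  proof (intro exI [of _ "max N1 N2"] allI impI)
    fix m n assume mn: "max N1 N2 \<le> m" "max N1 N2 \<le> n"
    have eq: "span_inner K (u m) (v m) - span_inner K (u n) (v n) =
        span_inner K (\<lambda>t. u m t - u n t) (v m) + span_inner K (u n) (\<lambda>t. v m t - v n t)"
      by (simp add: span_inner_diff_right [OF psd vs vs us] span_inner_diff_left [OF psd us us vs])
    have 1: "\<bar>span_inner K (\<lambda>t. u m t - u n t) (v m)\<bar> \<le> span_norm K (\<lambda>t. u m t - u n t) * C"
      using C by (intro order.trans [OF span_inner_Cauchy_Schwarz
            [OF psd kernel_span_diff [OF us us] vs]] mult_left_mono)
        (auto intro: span_norm_nonneg [OF psd kernel_span_diff [OF us us]])
    have 2: "\<bar>span_inner K (u n) (\<lambda>t. v m t - v n t)\<bar> \<le> B * span_norm K (\<lambda>t. v m t - v n t)"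
      using B by (intro order.trans [OF span_inner_Cauchy_Schwarz
            [OF psd us kernel_span_diff [OF vs vs]]] mult_right_mono)
        (auto intro: span_norm_nonneg [OF psd kernel_span_diff [OF vs vs]])
    have 3: "span_norm K (\<lambda>t. u m t - u n t) * C < e / 2"
      using N1 [of m n] mn C by (simp add: field_simps)
    have 4: "B * span_norm K (\<lambda>t. v m t - v n t) < e / 2"
      using N2 [of m n] mn B by (simp add: field_simps)
    show "dist (span_inner K (u m) (v m)) (span_inner K (u n) (v n)) < e"
      unfolding dist_real_def eq using 1 2 3 4 by linarith
  qed
qed

lemma rkhs_inner_tendsto:
  assumes psd: "psd_kernel K" and u: "rkhs_approx K u f" and v: "rkhs_approx K v g"
  shows "(\<lambda>n. span_inner K (u n) (v n)) \<longlonglongrightarrow> rkhs_inner K f g"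
proof -
  obtain l where l: "(\<lambda>n. span_inner K (u n) (v n)) \<longlonglongrightarrow> l"
    using span_inner_convergent [OF psd u v] unfolding convergent_def by blast
  have us: "u n \<in> kernel_span K" and vs: "v n \<in> kernel_span K" for n
    using u v by (auto simp: rkhs_approx_def)
  obtain B where B: "B > 0" "\<And>n. span_norm K (u n) \<le> B"
    using rkhs_approx_bounded [OF psd u] by blast
  have all: "(\<lambda>n. span_inner K (u' n) (v' n)) \<longlonglongrightarrow> l"
    if u': "rkhs_approx K u' f" and v': "rkhs_approx K v' g" for u' v'
  proof -
    have us': "u' n \<in> kernel_span K" and vs': "v' n \<in> kernel_span K" for n
      using u' v' by (auto simp: rkhs_approx_def)
    obtain C where C: "C > 0" "\<And>n. span_norm K (v' n) \<le> C"
      using rkhs_approx_bounded [OF psd v'] by blast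
    have zu: "(\<lambda>n. span_norm K (\<lambda>t. u n t - u' n t)) \<longlonglongrightarrow> 0"
      using rkhs_approx_zero [OF psd] rkhs_approx_diff [OF psd u u'] by simp
    have zv: "(\<lambda>n. span_norm K (\<lambda>t. v n t - v' n t)) \<longlonglongrightarrow> 0"
      using rkhs_approx_zero [OF psd] rkhs_approx_diff [OF psd v v'] by simp
    have "(\<lambda>n. span_inner K (u n) (v n) - span_inner K (u' n) (v' n)) \<longlonglongrightarrow> 0"
    proof (rule Lim_null_comparison)
      show "(\<lambda>n. B * span_norm K (\<lambda>t. v n t - v' n t) + span_norm K (\<lambda>t. u n t - u' n t) * C) \<longlonglongrightarrow> 0"
        using tendsto_add [OF tendsto_mult_right_zero [OF zv, of B] tendsto_mult_left_zero [OF zu, of C]]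
        by simp
      show "\<forall>\<^sub>F n in sequentially. norm (span_inner K (u n) (v n) - span_inner K (u' n) (v' n))
          \<le> B * span_norm K (\<lambda>t. v n t - v' n t) + span_norm K (\<lambda>t. u n t - u' n t) * C"
      proof (intro always_eventually allI)
        fix n
        have eq: "span_inner K (u n) (v n) - span_inner K (u' n) (v' n) =
            span_inner K (u n) (\<lambda>t. v n t - v' n t) + span_inner K (\<lambda>t. u n t - u' n t) (v' n)"
          by (simp add: span_inner_diff_right [OF psd vs vs' us] span_inner_diff_left [OF psd us us' vs'])
        have 1: "\<bar>span_inner K (u n) (\<lambda>t. v n t - v' n t)\<bar> \<le> B * span_norm K (\<lambda>t. v n t - v' n t)"
          using B by (intro order.trans [OF span_inner_Cauchy_Schwarz
                [OF psd us kernel_span_diff [OF vs vs']]] mult_right_mono)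
            (auto intro: span_norm_nonneg [OF psd kernel_span_diff [OF vs vs']])
        have 2: "\<bar>span_inner K (\<lambda>t. u n t - u' n t) (v' n)\<bar> \<le> span_norm K (\<lambda>t. u n t - u' n t) * C"
          using C by (intro order.trans [OF span_inner_Cauchy_Schwarz
                [OF psd kernel_span_diff [OF us us'] vs']] mult_left_mono)
            (auto intro: span_norm_nonneg [OF psd kernel_span_diff [OF us us']])
        show "norm (span_inner K (u n) (v n) - span_inner K (u' n) (v' n))
          \<le> B * span_norm K (\<lambda>t. v n t - v' n t) + span_norm K (\<lambda>t. u n t - u' n t) * C"
          unfolding real_norm_def eq using 1 2 by linarith
      qed
    qed
    from tendsto_diff [OF l this] show ?thesis by simp
  qed
  have "rkhs_inner K f g = l"
    unfolding rkhs_inner_def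
  proof (rule the_equality)
    show "\<forall>u v. rkhs_approx K u f \<longrightarrow> rkhs_approx K v g \<longrightarrow>
        (\<lambda>n. span_inner K (u n) (v n)) \<longlonglongrightarrow> l"
      using all by blast
  next
    fix l' assume "\<forall>u v. rkhs_approx K u f \<longrightarrow> rkhs_approx K v g \<longrightarrow>
        (\<lambda>n. span_inner K (u n) (v n)) \<longlonglongrightarrow> l'"
    then show "l' = l" using u v l LIMSEQ_unique by blast
  qed
  then show ?thesis using l by simp
qed

section \<open>Fractional Brownian motion\<close>

text \<open>A constant random variable counts as normal, with variance zero.\<close>

definition gaussian_rv :: "'w measure \<Rightarrow> ('w \<Rightarrow> real) \<Rightarrow> bool" where
  "gaussian_rv M X \<longleftrightarrow> X \<in> borel_measurable M \<and>
     ((\<exists>\<mu> \<sigma>. \<sigma> > 0 \<and> distributed M lborel X (normal_density \<mu> \<sigma>)) \<or>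
      (\<exists>\<mu>. AE \<omega> in M. X \<omega> = \<mu>))"

definition gaussian_process :: "'w measure \<Rightarrow> ('i \<Rightarrow> 'w \<Rightarrow> real) \<Rightarrow> bool" where
  "gaussian_process M X \<longleftrightarrow>
     (\<forall>J c. finite J \<longrightarrow> gaussian_rv M (\<lambda>\<omega>. \<Sum>j\<in>J. c j * X j \<omega>))"

definition stationary_increments :: "'w measure \<Rightarrow> (real \<Rightarrow> 'w \<Rightarrow> real) \<Rightarrow> bool" where
  "stationary_increments M X \<longleftrightarrow>
     (\<forall>h J. finite J \<longrightarrow>
        distr M (\<Pi>\<^sub>M j\<in>J. borel) (\<lambda>\<omega>. \<lambda>j\<in>J. X (j + h) \<omega> - X h \<omega>) =
        distr M (\<Pi>\<^sub>M j\<in>J. borel) (\<lambda>\<omega>. \<lambda>j\<in>J. X j \<omega> - X 0 \<omega>))"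

locale fractional_brownian_motion = prob_space M
  for M :: "'w measure" and A :: "real \<Rightarrow> 'w \<Rightarrow> real" and H :: real +
  assumes hurst: "0 < H" "H < 1"
    and gaussian: "gaussian_process M A"
    and centered: "\<And>s. expectation (A s) = 0"
    and stationary: "stationary_increments M A"
    and continuous_paths: "\<And>\<omega>. \<omega> \<in> space M \<Longrightarrow> continuous_on UNIV (\<lambda>s. A s \<omega>)"
    and start_zero: "\<And>\<omega>. \<omega> \<in> space M \<Longrightarrow> A 0 \<omega> = 0"
    and variance_eq: "\<And>s. variance (A s) = \<bar>s\<bar> powr (2 * H)"

definition fbm_cov :: "real \<Rightarrow> real \<Rightarrow> real \<Rightarrow> real" where
  "fbm_cov H s t = (\<bar>s\<bar> powr (2 * H) + \<bar>t\<bar> powr (2 * H) - \<bar>s - t\<bar> powr (2 * H)) / 2"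

definition rate :: "real \<Rightarrow> (real \<Rightarrow> real) \<Rightarrow> ereal" where
  "rate H f = (if f \<in> rkhs (fbm_cov H) then ereal (1/2 * (rkhs_norm (fbm_cov H) f)\<^sup>2) else \<infinity>)"

definition paths_above_id :: "real \<Rightarrow> (real \<Rightarrow> real) set" where
  "paths_above_id H = {f \<in> rkhs (fbm_cov H). \<forall>r\<in>{0..1}. r \<le> f r}"

definition theta :: "real \<Rightarrow> ereal" where
  "theta H = (INF f\<in>paths_above_id H. rate H f)"

section \<open>Running suprema and their distances\<close>

text \<open>The suprema are extended reals, because \<open>sup_all\<close> may be infinite on a null set.\<close>

definition sup_all :: "(real \<Rightarrow> 'w \<Rightarrow> real) \<Rightarrow> 'w \<Rightarrow> ereal" where
  "sup_all A \<omega> = (SUP s\<in>{0<..}. ereal (A s \<omega> - s))"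

definition sup_upto :: "(real \<Rightarrow> 'w \<Rightarrow> real) \<Rightarrow> real \<Rightarrow> 'w \<Rightarrow> ereal" where
  "sup_upto A t \<omega> = (SUP s\<in>{0..t}. ereal (A s \<omega> - s))"

definition tail_gap :: "'w measure \<Rightarrow> (real \<Rightarrow> 'w \<Rightarrow> real) \<Rightarrow> real \<Rightarrow> real \<Rightarrow> real" where
  "tail_gap M A x t =
     measure M {\<omega> \<in> space M. sup_all A \<omega> > ereal x} -
     measure M {\<omega> \<in> space M. sup_upto A t \<omega> > ereal x}"

definition KS_distance :: "'w measure \<Rightarrow> (real \<Rightarrow> 'w \<Rightarrow> real) \<Rightarrow> real \<Rightarrow> real" where
  "KS_distance M A t = (SUP x\<in>{0<..}. tail_gap M A x t)"

definition integral_distance :: "'w measure \<Rightarrow> (real \<Rightarrow> 'w \<Rightarrow> real) \<Rightarrow> real \<Rightarrow> real" where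
  "integral_distance M A t = (LINT x:{0<..}|lborel. tail_gap M A x t)"

end

theory Submission
  imports Defs "HOL-Real_Asymp.Real_Asymp"
begin

text \<open>
  The constant \<open>\<vartheta>\<close> has a dual description: it is the supremum of
  \<open>l - \<parallel>g\<parallel>\<^sup>2 / 2\<close> over the finite combinations \<open>g = \<Sum> c\<^sub>u \<Gamma>(u, \<cdot>)\<close> with
  \<open>c\<^sub>u \<ge> 0\<close> and \<open>l = \<Sum> c\<^sub>u u\<close>. By the parallelogram law a maximizing sequence is Cauchy, and its
  limit is a minimizer of the primal problem.

  Upper bound. If the level \<open>x\<close> is passed only after time \<open>t\<close>, then at the first passage time
  \<open>s\<close> one has \<open>A s - A (s - u) \<ge> u\<close> for all \<open>u \<le> s\<close>. For \<open>s\<close> on a grid of fixed size this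
  forces \<open>\<Sum> c\<^sub>u (A s - A (s - t u)) \<ge> t l\<close>, whose probability is bounded by Chernoff's inequality;
  oscillations between grid points and times \<open>s \<ge> L t\<close> are negligible by dyadic chaining.

  Lower bound. For a near-optimal \<open>g\<close>, tilting the measure by \<open>\<Sum> c\<^sub>u (A T - A (T - T u))\<close>
  moves the mean of the process to a path that passes a whole interval of levels at time \<open>T\<close>,
  slightly later than \<open>t\<close>, but not before \<open>t\<close>. Under the tilted measure the process stays close to
  its mean, again by chaining. Only the moment generating functions of linear functionals of \<open>A\<close>
  are used, both before and after tilting.
\<close>

section \<open>Duality for minimal norm problems in a reproducing kernel Hilbert space\<close>

text \<open>The primal problem has one constraint for every r in [0,1], whereas a probability
  estimate handles finitely many Gaussian variables at a time. Duality removes this mismatch: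
  through the isometry that sends the kernel at u to A(u), a finite combination \<open>g\<close>
  corresponds to one random variable, whose variance is the squared norm of \<open>g\<close>. The
  same variable serves as Chernoff functional in the upper bound and as tilting functional in the
  lower bound. By stationary increments and self-similarity, its version read backwards from any
  time and stretched by t has the same variance up to the factor \<open>t powr (2 * H)\<close>;
  weighed against a threshold of order t this yields the speed \<open>t powr (2 - 2 * H)\<close>.
  Both distances follow from the same two estimates of \<open>tail_gap\<close>. The upper one
  carries the integrable factor \<open>inverse (1 + x\<^sup>2)\<close> at the price of t squared,
  which the logarithmic scale does not see; the lower one holds on an interval of levels whose
  length does not shrink with t.\<close>

definition dual_cone :: "('i \<Rightarrow> 'i \<Rightarrow> real) \<Rightarrow> 'i set \<Rightarrow> ('i \<Rightarrow> real) \<Rightarrow> (('i \<Rightarrow> real) \<times> real) set" where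
  "dual_cone K I b = {(kernel_comb K S c, \<Sum>s\<in>S. c s * b s) | S c.
     finite S \<and> S \<subseteq> I \<and> (\<forall>s\<in>S. 0 \<le> c s)}"

text \<open>Lagrange dual function: with multipliers \<open>c s\<close>, the minimum over f of half
  the squared norm minus the sum of \<open>c s * (f s - b s)\<close> is attained at
  \<open>g = kernel_comb K S c\<close> and equals this value. The number l travels with g because
  different coefficients can give the same g.\<close>

definition dual_value :: "('i \<Rightarrow> 'i \<Rightarrow> real) \<Rightarrow> ('i \<Rightarrow> real) \<times> real \<Rightarrow> real" where
  "dual_value K y = snd y - span_inner K (fst y) (fst y) / 2"

definition dual_sup :: "('i \<Rightarrow> 'i \<Rightarrow> real) \<Rightarrow> 'i set \<Rightarrow> ('i \<Rightarrow> real) \<Rightarrow> real" where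
  "dual_sup K I b = (SUP y\<in>dual_cone K I b. dual_value K y)"

lemma dual_coneE:
  assumes "(g, l) \<in> dual_cone K I b"
  obtains S c where "finite S" "S \<subseteq> I" "\<forall>s\<in>S. 0 \<le> c s" "g = kernel_comb K S c"
    "l = (\<Sum>s\<in>S. c s * b s)"
  using assms unfolding dual_cone_def by blast

lemma dual_cone_span: "(g, l) \<in> dual_cone K I b \<Longrightarrow> g \<in> kernel_span K"
  by (auto simp: dual_cone_def kernel_span_def)

lemma dual_cone_kernel: "r \<in> I \<Longrightarrow> (K r, b r) \<in> dual_cone K I b"
  unfolding dual_cone_def
  by (rule CollectI, rule exI [of _ "{r}"], rule exI [of _ "\<lambda>_. 1"]) (simp add: kernel_comb_def)

lemma dual_cone_zero: "((\<lambda>_. 0), 0) \<in> dual_cone K I b"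
  unfolding dual_cone_def
  by (rule CollectI, rule exI [of _ "{}"], rule exI [of _ "\<lambda>_. 1"]) (simp add: kernel_comb_def)

lemma dual_cone_lincomb:
  assumes "(g, l) \<in> dual_cone K I b" "(g', l') \<in> dual_cone K I b" and nn: "0 \<le> \<alpha>" "0 \<le> \<beta>"
  shows "((\<lambda>t. \<alpha> * g t + \<beta> * g' t), \<alpha> * l + \<beta> * l') \<in> dual_cone K I b"
proof -
  obtain S c where f: "finite S" "S \<subseteq> I" "\<forall>s\<in>S. 0 \<le> c s" "g = kernel_comb K S c"
    "l = (\<Sum>s\<in>S. c s * b s)"
    using assms(1) by (rule dual_coneE)
  obtain T d where g: "finite T" "T \<subseteq> I" "\<forall>s\<in>T. 0 \<le> d s" "g' = kernel_comb K T d"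
    "l' = (\<Sum>s\<in>T. d s * b s)"
    using assms(2) by (rule dual_coneE)
  define h where "h s = \<alpha> * (if s \<in> S then c s else 0) + \<beta> * (if s \<in> T then d s else 0)" for s
  have 1: "(\<Sum>s\<in>S \<union> T. h s * x s) = \<alpha> * (\<Sum>s\<in>S. c s * x s) + \<beta> * (\<Sum>s\<in>T. d s * x s)"
    for x :: "'a \<Rightarrow> real"
  proof -
    have "(\<Sum>s\<in>S \<union> T. (if s \<in> S then c s else 0) * x s) = (\<Sum>s\<in>S. c s * x s)"
      using f g by (intro sum.mono_neutral_cong_right) auto
    moreover have "(\<Sum>s\<in>S \<union> T. (if s \<in> T then d s else 0) * x s) = (\<Sum>s\<in>T. d s * x s)"
      using f g by (intro sum.mono_neutral_cong_right) auto
    moreover have "(\<Sum>s\<in>S \<union> T. h s * x s) =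
        \<alpha> * (\<Sum>s\<in>S \<union> T. (if s \<in> S then c s else 0) * x s) +
        \<beta> * (\<Sum>s\<in>S \<union> T. (if s \<in> T then d s else 0) * x s)"
      unfolding h_def by (simp only: distrib_right sum.distrib sum_distrib_left mult.assoc)
    ultimately show ?thesis by simp
  qed
  have "\<forall>s\<in>S \<union> T. 0 \<le> h s" using f(3) g(3) nn by (auto simp: h_def)
  moreover have "(\<lambda>t. \<alpha> * g t + \<beta> * g' t) = kernel_comb K (S \<union> T) h"
    unfolding f(4) g(4) kernel_comb_def by (rule ext) (simp only: 1)
  moreover have "\<alpha> * l + \<beta> * l' = (\<Sum>s\<in>S \<union> T. h s * b s)" unfolding f(5) g(5) by (simp only: 1)
  ultimately show ?thesis
    unfolding dual_cone_def using f(1,2) g(1,2)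
    by (intro CollectI exI [of _ "S \<union> T"] exI [of _ h]) auto
qed

section \<open>Evaluation, norms and weak duality\<close>

lemma span_inner_kernel:
  assumes "psd_kernel K" "g \<in> kernel_span K"
  shows "span_inner K g (K r) = g r"
proof -
  have "K r = kernel_comb K {r} (\<lambda>_. 1)" by (simp add: kernel_comb_def)
  then show ?thesis using span_inner_eval [OF assms, of "{r}" "\<lambda>_. 1"] by simp
qed

lemma kernel_in_span: "K r \<in> kernel_span K"
  unfolding kernel_span_def
  by (rule CollectI, rule exI [of _ "{r}"], rule exI [of _ "\<lambda>_. 1"]) (simp add: kernel_comb_def)

lemma eval_le_span_norm:
  assumes "psd_kernel K" "g \<in> kernel_span K"
  shows "\<bar>g r\<bar> \<le> span_norm K g * sqrt (K r r)"
  using span_inner_Cauchy_Schwarz [OF assms kernel_in_span, of r]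
  by (simp add: span_inner_kernel [OF assms] span_norm_def [of K "K r"]
      span_inner_kernel [OF assms(1) kernel_in_span])

lemma kernel_span_subset_rkhs:
  assumes "psd_kernel K" shows "kernel_span K \<subseteq> rkhs K"
proof
  fix f assume f: "f \<in> kernel_span K"
  have "span_norm K (\<lambda>t. 0) = 0"
    using span_inner_comb [of K "{}" "{}" "\<lambda>_. 0" "\<lambda>_. 0"] assms
    by (simp add: span_norm_def kernel_comb_def psd_kernel_def)
  then have "rkhs_approx K (\<lambda>_. f) f" using f by (simp add: rkhs_approx_def)
  then show "f \<in> rkhs K" by (auto simp: rkhs_def)
qed

lemma rkhs_norm_sq:
  assumes psd: "psd_kernel K" and u: "rkhs_approx K u f"
  shows "(\<lambda>n. span_inner K (u n) (u n)) \<longlonglongrightarrow> (rkhs_norm K f)\<^sup>2"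
proof -
  have *: "(\<lambda>n. span_inner K (u n) (u n)) \<longlonglongrightarrow> rkhs_inner K f f"
    by (rule rkhs_inner_tendsto [OF psd u u])
  have "0 \<le> rkhs_inner K f f"
    using u by (intro LIMSEQ_le_const [OF *] exI [of _ 0] allI impI span_inner_nonneg [OF psd])
      (auto simp: rkhs_approx_def)
  with * show ?thesis by (simp add: rkhs_norm_def)
qed

text \<open>Pairing f with g gives the sum of \<open>c s * f s\<close>. This is at least l because
  the multipliers are nonnegative, and at most half the sum of the two squared norms; the latter is
  shown along an approximating sequence of the span and passes to the limit.\<close>

lemma weak_duality:
  assumes psd: "psd_kernel K" and f: "f \<in> rkhs K" "\<And>r. r \<in> I \<Longrightarrow> b r \<le> f r"
    and y: "y \<in> dual_cone K I b"
  shows "dual_value K y \<le> (rkhs_norm K f)\<^sup>2 / 2"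
proof -
  obtain g l where gl: "y = (g, l)" by fastforce
  obtain S c where S: "finite S" "S \<subseteq> I" "\<forall>s\<in>S. 0 \<le> c s" "g = kernel_comb K S c"
    "l = (\<Sum>s\<in>S. c s * b s)"
    using y unfolding gl by (rule dual_coneE)
  obtain u where u: "rkhs_approx K u f" using f by (auto simp: rkhs_def)
  have us: "u n \<in> kernel_span K" for n using u by (auto simp: rkhs_approx_def)
  have gs: "g \<in> kernel_span K" using y gl dual_cone_span by blast
  have "(\<lambda>n. \<Sum>s\<in>S. c s * u n s) \<longlonglongrightarrow> (\<Sum>s\<in>S. c s * f s)"
    using u by (intro tendsto_intros) (auto simp: rkhs_approx_def)
  then have lim: "(\<lambda>n. span_inner K (u n) g) \<longlonglongrightarrow> (\<Sum>s\<in>S. c s * f s)"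
    unfolding S(4) by (simp add: span_inner_eval [OF psd us S(1)])
  have lim2: "(\<lambda>n. span_inner K (u n) (u n) / 2 + span_inner K g g / 2) \<longlonglongrightarrow>
      (rkhs_norm K f)\<^sup>2 / 2 + span_inner K g g / 2"
    by (intro tendsto_intros rkhs_norm_sq psd u) simp_all
  have le: "span_inner K (u n) g \<le> span_inner K (u n) (u n) / 2 + span_inner K g g / 2" for n
    using span_inner_nonneg [OF psd kernel_span_lincomb [OF us [of n] gs, of 1 "-1"]]
    unfolding span_inner_lincomb_self [OF psd us gs] by simp
  have "l \<le> (\<Sum>s\<in>S. c s * f s)"
    unfolding S(5) using S f(2) by (intro sum_mono mult_left_mono) auto
  also have "\<dots> \<le> (rkhs_norm K f)\<^sup>2 / 2 + span_inner K g g / 2"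
    using le by (intro LIMSEQ_le [OF lim lim2]) auto
  finally show ?thesis by (simp add: gl dual_value_def)
qed

text \<open>\<open>bdd\<close> is how feasibility of the primal problem enters: by
  \<open>weak_duality\<close> any feasible path provides it.\<close>

locale dual_problem =
  fixes K :: "'i \<Rightarrow> 'i \<Rightarrow> real" and I :: "'i set" and b :: "'i \<Rightarrow> real"
  assumes psd: "psd_kernel K" and bdd: "bdd_above (dual_value K ` dual_cone K I b)"
begin

lemma dual_value_le: "(g, l) \<in> dual_cone K I b \<Longrightarrow> l - span_inner K g g / 2 \<le> dual_sup K I b"
  unfolding dual_sup_def using cSUP_upper [OF _ bdd, of "(g, l)"] by (simp add: dual_value_def)

lemma dual_sup_approx:
  assumes "0 < D"
  obtains g l where "(g, l) \<in> dual_cone K I b" "dual_sup K I b - D \<le> l - span_inner K g g / 2"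
proof -
  have "\<exists>y\<in>dual_cone K I b. dual_sup K I b - D < dual_value K y"
    unfolding dual_sup_def using assms
    by (intro less_cSUP_iff [THEN iffD1] bdd) (use dual_cone_zero in auto)
  then show ?thesis using that by (force simp: dual_value_def)
qed

lemma dual_sup_nonneg: "0 \<le> dual_sup K I b"
proof -
  have "span_inner K (\<lambda>t. 0) (\<lambda>t. 0) = 0"
    using span_inner_comb [of K "{}" "{}" "\<lambda>_. 0" "\<lambda>_. 0"] psd
    by (simp add: kernel_comb_def psd_kernel_def)
  then show ?thesis using dual_value_le [OF dual_cone_zero] by simp
qed

context
  fixes g l D
  assumes gl: "(g, l) \<in> dual_cone K I b" and D: "dual_sup K I b - D \<le> l - span_inner K g g / 2"
begin

text \<open>Adding \<mu> times the kernel at r stays in the cone, so the resulting gain in dual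
  value is at most the deficit D. After division by \<mu>, the constraint at r is violated by at
  most \<open>D / \<mu>\<close> plus a term of order \<mu>.\<close>

lemma near_optimal_feasible:
  assumes r: "r \<in> I" and \<mu>: "0 \<le> \<mu>"
  shows "\<mu> * (b r - g r) \<le> D + \<mu>\<^sup>2 * K r r / 2"
proof -
  note gs = dual_cone_span [OF gl]
  have "1 * l + \<mu> * b r - (1\<^sup>2 * span_inner K g g + 2 * 1 * \<mu> * span_inner K g (K r) +
      \<mu>\<^sup>2 * span_inner K (K r) (K r)) / 2 \<le> dual_sup K I b"
    using dual_value_le [OF dual_cone_lincomb [OF gl dual_cone_kernel [OF r], of 1 \<mu>]] \<mu>
    unfolding span_inner_lincomb_self [OF psd gs kernel_in_span] by simp
  then have "l + \<mu> * b r - (span_inner K g g + 2 * (\<mu> * g r) + \<mu>\<^sup>2 * K r r) / 2 \<le> dual_sup K I b"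
    by (simp add: span_inner_kernel psd gs kernel_in_span mult.assoc)
  with D show ?thesis by (simp add: field_simps)
qed

text \<open>Variation along the ray through \<open>(g, l)\<close>, which stays in the cone down to
  the factor \<open>\<mu> + 1 = 0\<close>. At an exact optimum it forces l to equal the squared norm
  of g.\<close>

lemma near_optimal_scale:
  assumes \<mu>: "-1 \<le> \<mu>"
  shows "\<mu> * (l - span_inner K g g) \<le> D + \<mu>\<^sup>2 * span_inner K g g / 2"
proof -
  note gs = dual_cone_span [OF gl]
  let ?G = "span_inner K g g"
  have "(\<mu> + 1) * l + 0 * l - ((\<mu> + 1)\<^sup>2 * ?G + 2 * (\<mu> + 1) * 0 * ?G + 0\<^sup>2 * ?G) / 2 \<le> dual_sup K I b"
    using dual_value_le [OF dual_cone_lincomb [OF gl gl, of "\<mu> + 1" 0]] \<mu>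
    unfolding span_inner_lincomb_self [OF psd gs gs] by simp
  then have "\<mu> * l + l - (\<mu>\<^sup>2 * ?G + 2 * (\<mu> * ?G) + ?G) / 2 \<le> dual_sup K I b"
    by (simp add: power2_eq_square algebra_simps)
  with D show ?thesis by (simp add: field_simps)
qed

text \<open>The first bound comes from halving g. The second comes from stretching and shrinking g
  by \<mu>, which makes l and the squared norm nearly equal, so that the dual value is nearly half
  the squared norm.\<close>

lemma near_optimal_norm:
  assumes "0 \<le> D"
  shows "span_inner K g g \<le> 8 * D + 4 * dual_sup K I b"
    and "\<And>\<mu>. 0 < \<mu> \<Longrightarrow> \<mu> \<le> 1 \<Longrightarrow> \<bar>span_inner K g g / 2 - dual_sup K I b\<bar> \<le>
      D + D / \<mu> + \<mu> * (4 * D + 2 * dual_sup K I b)"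
proof -
  let ?G = "span_inner K g g" and ?V = "dual_sup K I b"
  have J: "l - ?G / 2 \<le> ?V" by (rule dual_value_le [OF gl])
  show G: "?G \<le> 8 * D + 4 * ?V"
    using near_optimal_scale [of "-1/2"] J by (simp add: power2_eq_square field_simps)
  fix \<mu> :: real assume \<mu>: "0 < \<mu>" "\<mu> \<le> 1"
  have "\<mu> * (l - ?G) \<le> D + \<mu>\<^sup>2 * ?G / 2" using near_optimal_scale [of \<mu>] \<mu> by simp
  then have 1: "l - ?G \<le> D / \<mu> + \<mu> * ?G / 2"
    using \<mu> by (simp add: field_simps power2_eq_square)
  have "- \<mu> * (l - ?G) \<le> D + \<mu>\<^sup>2 * ?G / 2" using near_optimal_scale [of "- \<mu>"] \<mu> by simp
  then have 2: "?G - l \<le> D / \<mu> + \<mu> * ?G / 2"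
    using \<mu> by (simp add: field_simps power2_eq_square)
  have 3: "\<mu> * ?G / 2 \<le> \<mu> * (4 * D + 2 * ?V)" using G \<mu> by simp
  show "\<bar>?G / 2 - ?V\<bar> \<le> D + D / \<mu> + \<mu> * (4 * D + 2 * ?V)"
    using 1 2 3 J D assms by (simp only: abs_le_iff) linarith
qed

end

text \<open>The parallelogram law: the midpoint of two near-optimal elements exceeds their average
  value by an eighth of their squared distance.\<close>

lemma near_optimal_diff:
  assumes gl: "(g, l) \<in> dual_cone K I b" "dual_sup K I b - D \<le> l - span_inner K g g / 2"
    and gl': "(g', l') \<in> dual_cone K I b" "dual_sup K I b - D \<le> l' - span_inner K g' g' / 2"
  shows "span_inner K (\<lambda>t. g t - g' t) (\<lambda>t. g t - g' t) \<le> 8 * D"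
proof -
  note s = dual_cone_span [OF gl(1)] dual_cone_span [OF gl'(1)]
  let ?X = "span_inner K g g" and ?Y = "span_inner K g' g'" and ?Z = "span_inner K g g'"
  have "1/2 * l + 1/2 * l' - ((1/2)\<^sup>2 * ?X + 2 * (1/2) * (1/2) * ?Z + (1/2)\<^sup>2 * ?Y) / 2 \<le> dual_sup K I b"
    using dual_value_le [OF dual_cone_lincomb [OF gl(1) gl'(1), of "1/2" "1/2"]]
    unfolding span_inner_lincomb_self [OF psd s] by simp
  moreover have "span_inner K (\<lambda>t. g t - g' t) (\<lambda>t. g t - g' t) = ?X - 2 * ?Z + ?Y"
    using span_inner_lincomb_self [OF psd s, of 1 "-1"] by simp
  ultimately show ?thesis using gl(2) gl'(2) by (simp add: power2_eq_square add_divide_distrib)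
qed

lemma dual_optimum_attained:
  obtains f where "f \<in> rkhs K" "\<And>r. r \<in> I \<Longrightarrow> b r \<le> f r" "(rkhs_norm K f)\<^sup>2 / 2 = dual_sup K I b"
proof -
  let ?V = "dual_sup K I b"
  have "\<exists>y. y \<in> dual_cone K I b \<and> ?V - 1 / real (Suc n) \<le> snd y - span_inner K (fst y) (fst y) / 2" for n
    using dual_sup_approx [of "1 / real (Suc n)"] by (metis fst_conv of_nat_0_less_iff snd_conv
        zero_less_Suc zero_less_divide_1_iff)
  then obtain Y where Y: "\<And>n. Y n \<in> dual_cone K I b"
    "\<And>n. ?V - 1 / real (Suc n) \<le> snd (Y n) - span_inner K (fst (Y n)) (fst (Y n)) / 2"
    by metis
  define u l where "u n = fst (Y n)" and "l n = snd (Y n)" for n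
  have ul: "(u n, l n) \<in> dual_cone K I b" "?V - 1 / real (Suc n) \<le> l n - span_inner K (u n) (u n) / 2" for n
    using Y [of n] by (simp_all add: u_def l_def)
  have us: "u n \<in> kernel_span K" for n using dual_cone_span ul by blast
  have dist: "span_norm K (\<lambda>t. u m t - u n t) \<le> sqrt (8 / real (Suc N))" if "N \<le> m" "N \<le> n" for N m n
  proof -
    have *: "?V - 1 / real (Suc N) \<le> l k - span_inner K (u k) (u k) / 2" if "N \<le> k" for k
    proof -
      have "1 / real (Suc k) \<le> 1 / real (Suc N)" using that by (intro divide_left_mono) auto
      then show ?thesis using ul(2) [of k] by linarith
    qed
    show ?thesis
      using near_optimal_diff [OF ul(1) * ul(1) *] that by (simp add: span_norm_def)
  qed
  have lim0: "(\<lambda>N. sqrt (8 / real (Suc N))) \<longlonglongrightarrow> 0"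
  proof -
    have "(\<lambda>N. 8 * inverse (real (Suc N))) \<longlonglongrightarrow> 8 * 0"
      by (intro tendsto_intros LIMSEQ_inverse_real_of_nat)
    from tendsto_real_sqrt [OF this] show ?thesis by (simp add: field_simps)
  qed
  have cauchy: "\<exists>N. \<forall>m\<ge>N. \<forall>n\<ge>N. span_norm K (\<lambda>t. u m t - u n t) < e" if "e > 0" for e
  proof -
    obtain N where "sqrt (8 / real (Suc N)) < e"
      using eventually_happens [OF order_tendstoD(2) [OF lim0 \<open>e > 0\<close>]] by auto
    then show ?thesis using dist by (meson le_less_trans)
  qed
  have "convergent (\<lambda>n. u n r)" for r
  proof (rule Cauchy_convergent, rule metric_CauchyI)
    fix e :: real assume e: "e > 0"
    \<comment> \<open>The added 1 keeps the quotient defined when \<open>K r r = 0\<close>.\<close>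
    have "e / (sqrt (K r r) + 1) > 0"
      using e span_inner_nonneg [OF psd kernel_in_span, of r] span_inner_kernel [OF psd kernel_in_span, of r r]
      by (intro divide_pos_pos add_nonneg_pos) auto
    then obtain N where N: "\<And>m n. m \<ge> N \<Longrightarrow> n \<ge> N \<Longrightarrow>
        span_norm K (\<lambda>t. u m t - u n t) < e / (sqrt (K r r) + 1)"
      using cauchy by blast
    have sq: "sqrt (K r r) \<ge> 0"
      using span_inner_nonneg [OF psd kernel_in_span, of r] span_inner_kernel [OF psd kernel_in_span, of r r]
      by simp
    show "\<exists>N. \<forall>m\<ge>N. \<forall>n\<ge>N. dist (u m r) (u n r) < e"
    proof (intro exI [of _ N] allI impI)
      fix m n assume mn: "N \<le> m" "N \<le> n"
      have "\<bar>u m r - u n r\<bar> \<le> span_norm K (\<lambda>t. u m t - u n t) * sqrt (K r r)"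
        using eval_le_span_norm [OF psd kernel_span_diff [OF us us]] .
      also have "\<dots> \<le> e / (sqrt (K r r) + 1) * sqrt (K r r)"
        using N [OF mn] sq by (intro mult_right_mono) auto
      also have "\<dots> < e" using e sq by (simp add: divide_less_eq add_nonneg_pos distrib_left)
      finally show "dist (u m r) (u n r) < e" by (simp add: dist_real_def)
    qed
  qed
  then obtain f where f: "\<And>r. (\<lambda>n. u n r) \<longlonglongrightarrow> f r"
    unfolding convergent_def by metis
  have app: "rkhs_approx K u f" unfolding rkhs_approx_def using us cauchy f by blast
  then have "f \<in> rkhs K" by (auto simp: rkhs_def)
  have D0: "(\<lambda>n. 1 / real (Suc n)) \<longlonglongrightarrow> 0"
    using LIMSEQ_inverse_real_of_nat by (simp add: inverse_eq_divide)
  have "b r \<le> f r" if r: "r \<in> I" for r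
  proof -
    \<comment> \<open>First n tends to infinity at a fixed multiplier \<mu>, which removes the
      deficit; then \<mu> tends to 0, which removes the quadratic term. The norm identity below uses
      the same order of limits.\<close>
    have *: "\<mu> * (b r - f r) \<le> 0 + \<mu>\<^sup>2 * K r r / 2" if \<mu>: "0 \<le> \<mu>" for \<mu>
    proof (rule LIMSEQ_le)
      show "(\<lambda>n. \<mu> * (b r - u n r)) \<longlonglongrightarrow> \<mu> * (b r - f r)" by (intro tendsto_intros f)
      show "(\<lambda>n. 1 / real (Suc n) + \<mu>\<^sup>2 * K r r / 2) \<longlonglongrightarrow> 0 + \<mu>\<^sup>2 * K r r / 2"
        by (intro tendsto_intros D0)
    qed (use near_optimal_feasible [OF ul r \<mu>] in blast)
    have **: "b r - f r \<le> \<mu> * (K r r / 2)" if "0 < \<mu>" for \<mu>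
    proof -
      have "\<mu> * (b r - f r) \<le> \<mu> * (\<mu> * (K r r / 2))"
        using * [of \<mu>] that by (simp add: power2_eq_square mult.assoc)
      then show ?thesis using that by (simp add: mult_le_cancel_left_pos)
    qed
    have "(\<lambda>n. 1 / real (Suc n) * (K r r / 2)) \<longlonglongrightarrow> 0 * (K r r / 2)"
      by (intro tendsto_intros D0)
    then have "b r - f r \<le> 0 * (K r r / 2)"
      by (rule LIMSEQ_le_const) (intro exI allI impI **, simp)
    then show ?thesis by simp
  qed
  moreover have "(rkhs_norm K f)\<^sup>2 / 2 = ?V"
  proof -
    have lim: "(\<lambda>n. span_inner K (u n) (u n) / 2) \<longlonglongrightarrow> (rkhs_norm K f)\<^sup>2 / 2"
      by (intro tendsto_intros rkhs_norm_sq psd app) simp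
    have *: "\<bar>(rkhs_norm K f)\<^sup>2 / 2 - ?V\<bar> \<le> 0 + 0 / \<mu> + \<mu> * (4 * 0 + 2 * ?V)" if \<mu>: "0 < \<mu>" "\<mu> \<le> 1" for \<mu>
    proof (rule LIMSEQ_le)
      show "(\<lambda>n. \<bar>span_inner K (u n) (u n) / 2 - ?V\<bar>) \<longlonglongrightarrow> \<bar>(rkhs_norm K f)\<^sup>2 / 2 - ?V\<bar>"
        by (intro tendsto_intros lim)
      show "(\<lambda>n. 1 / real (Suc n) + 1 / real (Suc n) / \<mu> + \<mu> * (4 * (1 / real (Suc n)) + 2 * ?V)) \<longlonglongrightarrow>
          0 + 0 / \<mu> + \<mu> * (4 * 0 + 2 * ?V)"
        using \<mu> by (intro tendsto_intros D0) auto
    qed (use near_optimal_norm(2) [OF ul _ \<mu>] in auto)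
    have "(\<lambda>n. 1 / real (Suc n) * (2 * ?V)) \<longlonglongrightarrow> 0 * (2 * ?V)"
      by (intro tendsto_intros D0)
    moreover have "\<bar>(rkhs_norm K f)\<^sup>2 / 2 - ?V\<bar> \<le> 1 / real (Suc n) * (2 * ?V)" for n
      using * [of "1 / real (Suc n)"] by simp
    ultimately have "\<bar>(rkhs_norm K f)\<^sup>2 / 2 - ?V\<bar> \<le> 0 * (2 * ?V)"
      by (intro LIMSEQ_le_const) blast+
    then show ?thesis by simp
  qed
  ultimately show ?thesis using that \<open>f \<in> rkhs K\<close> by blast
qed

theorem strong_duality:
  "(INF f\<in>{f \<in> rkhs K. \<forall>r\<in>I. b r \<le> f r}. ereal ((rkhs_norm K f)\<^sup>2 / 2)) = ereal (dual_sup K I b)"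
proof (rule antisym)
  obtain f where "f \<in> rkhs K" "\<And>r. r \<in> I \<Longrightarrow> b r \<le> f r" "(rkhs_norm K f)\<^sup>2 / 2 = dual_sup K I b"
    using dual_optimum_attained by blast
  then show "(INF f\<in>{f \<in> rkhs K. \<forall>r\<in>I. b r \<le> f r}. ereal ((rkhs_norm K f)\<^sup>2 / 2)) \<le> ereal (dual_sup K I b)"
    by (intro INF_lower2 [of f]) auto
next
  show "ereal (dual_sup K I b) \<le> (INF f\<in>{f \<in> rkhs K. \<forall>r\<in>I. b r \<le> f r}. ereal ((rkhs_norm K f)\<^sup>2 / 2))"
  proof (rule INF_greatest)
    fix f assume "f \<in> {f \<in> rkhs K. \<forall>r\<in>I. b r \<le> f r}"
    then have f: "f \<in> rkhs K" "\<And>r. r \<in> I \<Longrightarrow> b r \<le> f r" by auto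
    have "dual_sup K I b \<le> (rkhs_norm K f)\<^sup>2 / 2"
      unfolding dual_sup_def using dual_cone_zero [of K I b] weak_duality [OF psd f] by (intro cSUP_least) blast+
    then show "ereal (dual_sup K I b) \<le> ereal ((rkhs_norm K f)\<^sup>2 / 2)" by simp
  qed
qed

end

section \<open>Linear functionals of a Gaussian process\<close>

text \<open>Completing the square: the weight \<open>exp x\<close> shifts the mean by the variance.
  The exponent one suffices, because linear functionals of the process can be rescaled
  beforehand.\<close>

lemma normal_density_times_exp:
  assumes "0 < \<sigma>"
  shows "normal_density \<mu> \<sigma> x * exp x = exp (\<mu> + \<sigma>\<^sup>2 / 2) * normal_density (\<mu> + \<sigma>\<^sup>2) \<sigma> x"
proof -
  have "- (x - \<mu>)\<^sup>2 / (2 * \<sigma>\<^sup>2) + x = \<mu> + \<sigma>\<^sup>2 / 2 + - (x - (\<mu> + \<sigma>\<^sup>2))\<^sup>2 / (2 * \<sigma>\<^sup>2)"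
    using assms by (simp add: field_simps power2_eq_square)
  then have "exp (- (x - \<mu>)\<^sup>2 / (2 * \<sigma>\<^sup>2)) * exp x =
      exp (\<mu> + \<sigma>\<^sup>2 / 2) * exp (- (x - (\<mu> + \<sigma>\<^sup>2))\<^sup>2 / (2 * \<sigma>\<^sup>2))"
    by (metis exp_add)
  then show ?thesis by (simp add: normal_density_def)
qed

context prob_space
begin

lemma normal_exp_moment:
  assumes \<sigma>: "0 < \<sigma>" and D: "distributed M lborel Y (normal_density \<mu> \<sigma>)"
  shows "integrable M (\<lambda>\<omega>. exp (Y \<omega>))" "expectation (\<lambda>\<omega>. exp (Y \<omega>)) = exp (\<mu> + \<sigma>\<^sup>2 / 2)"
proof -
  have "integrable lborel (\<lambda>x. normal_density \<mu> \<sigma> x * exp x)"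
    unfolding normal_density_times_exp [OF \<sigma>] using \<sigma> by simp
  then show "integrable M (\<lambda>\<omega>. exp (Y \<omega>))"
    using distributed_integrable [OF D, of exp] by simp
  have "expectation (\<lambda>\<omega>. exp (Y \<omega>)) = (\<integral>x. normal_density \<mu> \<sigma> x * exp x \<partial>lborel)"
    using distributed_integral [OF D, of exp] by simp
  also have "\<dots> = exp (\<mu> + \<sigma>\<^sup>2 / 2)"
    unfolding normal_density_times_exp [OF \<sigma>] using \<sigma> by simp
  finally show "expectation (\<lambda>\<omega>. exp (Y \<omega>)) = exp (\<mu> + \<sigma>\<^sup>2 / 2)" .
qed

lemma gaussian_rv_moments:
  assumes Y: "gaussian_rv M Y"
  shows gaussian_rv_integrable: "integrable M Y"
    and gaussian_rv_square_integrable: "integrable M (\<lambda>\<omega>. (Y \<omega>)\<^sup>2)"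
    and gaussian_rv_exp_integrable: "integrable M (\<lambda>\<omega>. exp (Y \<omega>))"
    and gaussian_rv_exp: "expectation Y = 0 \<Longrightarrow>
      expectation (\<lambda>\<omega>. exp (Y \<omega>)) = exp (expectation (\<lambda>\<omega>. (Y \<omega>)\<^sup>2) / 2)"
proof -
  have meas [measurable]: "Y \<in> borel_measurable M" using Y by (simp add: gaussian_rv_def)
  consider (normal) \<mu> \<sigma> where "\<sigma> > 0" "distributed M lborel Y (normal_density \<mu> \<sigma>)"
    | (const) \<mu> where "AE \<omega> in M. Y \<omega> = \<mu>"
    using Y by (auto simp: gaussian_rv_def)
  then have "integrable M Y \<and> integrable M (\<lambda>\<omega>. (Y \<omega>)\<^sup>2) \<and> integrable M (\<lambda>\<omega>. exp (Y \<omega>)) \<and>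
    (expectation Y = 0 \<longrightarrow> expectation (\<lambda>\<omega>. exp (Y \<omega>)) = exp (expectation (\<lambda>\<omega>. (Y \<omega>)\<^sup>2) / 2))"
  proof cases
    case normal
    have 1: "integrable M Y"
      using distributed_integrable [OF normal(2), of "\<lambda>x. x"] integrable_normal_moment_nz_1 [OF normal(1), of \<mu>]
      by simp
    have "integrable lborel (\<lambda>x. normal_density \<mu> \<sigma> x * (x - \<mu>)\<^sup>2)"
      using integrable_normal_moment [OF normal(1), of \<mu> 2] by simp
    then have "integrable M (\<lambda>\<omega>. (Y \<omega> - \<mu>)\<^sup>2)"
      using distributed_integrable [OF normal(2), of "\<lambda>x. (x - \<mu>)\<^sup>2"] by simp
    then have "integrable M (\<lambda>\<omega>. (Y \<omega> - \<mu>)\<^sup>2 + 2 * \<mu> * Y \<omega> - \<mu>\<^sup>2)" using 1 by simp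
    then have 2: "integrable M (\<lambda>\<omega>. (Y \<omega>)\<^sup>2)" by (simp add: power2_diff algebra_simps power2_eq_square)
    show ?thesis
      using 1 2 normal_exp_moment [OF normal] normal_distributed_variance [OF normal]
        normal_distributed_expectation [OF normal] by auto
  next
    case const
    have "integrable M (\<lambda>\<omega>. g (Y \<omega>)) \<and> expectation (\<lambda>\<omega>. g (Y \<omega>)) = g \<mu>"
      if [measurable]: "g \<in> borel_measurable borel" for g :: "real \<Rightarrow> real"
    proof -
      have "AE \<omega> in M. g (Y \<omega>) = g \<mu>" using const by auto
      then have "integrable M (\<lambda>\<omega>. g (Y \<omega>)) \<longleftrightarrow> integrable M (\<lambda>\<omega>. g \<mu>)"
        "expectation (\<lambda>\<omega>. g (Y \<omega>)) = expectation (\<lambda>\<omega>. g \<mu>)"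
        by (intro integrable_cong_AE integral_cong_AE; simp)+
      then show ?thesis by (simp add: prob_space)
    qed
    from this [of "\<lambda>x. x"] this [of "\<lambda>x. x\<^sup>2"] this [of exp] show ?thesis by simp
  qed
  then show "integrable M Y" "integrable M (\<lambda>\<omega>. (Y \<omega>)\<^sup>2)" "integrable M (\<lambda>\<omega>. exp (Y \<omega>))"
    "expectation Y = 0 \<Longrightarrow> expectation (\<lambda>\<omega>. exp (Y \<omega>)) = exp (expectation (\<lambda>\<omega>. (Y \<omega>)\<^sup>2) / 2)"
    by blast+
qed

end

locale centered_gaussian_process = prob_space M
  for M :: "'w measure" and A :: "'i \<Rightarrow> 'w \<Rightarrow> real" +
  assumes gaussian: "gaussian_process M A"
    and centered: "\<And>s. expectation (A s) = 0"
begin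

text \<open>All estimates are stated for this span: it is closed under the scalings, sums and
  differences that occur, and its members are centered and Gaussian, so that \<open>cov Y Y\<close>
  fixes their exponential moment.\<close>

definition lin :: "('w \<Rightarrow> real) set" where
  "lin = {(\<lambda>\<omega>. \<Sum>j\<in>J. c j * A j \<omega>) | J c. finite J}"

lemma lin_gaussian: "Y \<in> lin \<Longrightarrow> gaussian_rv M Y"
  using gaussian unfolding lin_def gaussian_process_def by blast

lemma lin_process [intro, simp]: "A s \<in> lin"
  unfolding lin_def
  by (rule CollectI, rule exI [of _ "{s}"], rule exI [of _ "\<lambda>_. 1"]) simp

lemma lin_zero [intro, simp]: "(\<lambda>_. 0) \<in> lin"
  unfolding lin_def
  by (rule CollectI, rule exI [of _ "{}"], rule exI [of _ "\<lambda>_. 1"]) simp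

lemma lin_lincomb:
  assumes "Y \<in> lin" "Z \<in> lin"
  shows "(\<lambda>\<omega>. a * Y \<omega> + b * Z \<omega>) \<in> lin"
proof -
  obtain S c T d where f: "finite S" "Y = (\<lambda>\<omega>. \<Sum>j\<in>S. c j * A j \<omega>)"
    and g: "finite T" "Z = (\<lambda>\<omega>. \<Sum>j\<in>T. d j * A j \<omega>)"
    using assms by (auto simp: lin_def)
  define h where "h s = a * (if s \<in> S then c s else 0) + b * (if s \<in> T then d s else 0)" for s
  have 1: "(\<Sum>s\<in>S \<union> T. (if s \<in> S then c s else 0) * A s \<omega>) = Y \<omega>" for \<omega>
    unfolding f using f g by (intro sum.mono_neutral_cong_right) auto
  have 2: "(\<Sum>s\<in>S \<union> T. (if s \<in> T then d s else 0) * A s \<omega>) = Z \<omega>" for \<omega>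
    unfolding g using f g by (intro sum.mono_neutral_cong_right) auto
  have "(\<Sum>s\<in>S \<union> T. h s * A s \<omega>) = a * Y \<omega> + b * Z \<omega>" for \<omega>
    unfolding 1 [symmetric] 2 [symmetric] h_def
    by (simp add: distrib_right sum.distrib sum_distrib_left mult.assoc)
  then have "(\<lambda>\<omega>. a * Y \<omega> + b * Z \<omega>) = (\<lambda>\<omega>. \<Sum>s\<in>S \<union> T. h s * A s \<omega>)" by auto
  then show ?thesis using f(1) g(1) by (auto simp: lin_def)
qed

lemma lin_scale [intro]: "Y \<in> lin \<Longrightarrow> (\<lambda>\<omega>. a * Y \<omega>) \<in> lin"
  using lin_lincomb [of Y Y a 0] by simp

lemma lin_add [intro]: "Y \<in> lin \<Longrightarrow> Z \<in> lin \<Longrightarrow> (\<lambda>\<omega>. Y \<omega> + Z \<omega>) \<in> lin"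
  using lin_lincomb [of Y Z 1 1] by simp

lemma lin_diff [intro]: "Y \<in> lin \<Longrightarrow> Z \<in> lin \<Longrightarrow> (\<lambda>\<omega>. Y \<omega> - Z \<omega>) \<in> lin"
  using lin_lincomb [of Y Z 1 "-1"] by simp

lemma lin_minus [intro]: "Y \<in> lin \<Longrightarrow> (\<lambda>\<omega>. - Y \<omega>) \<in> lin"
  using lin_scale [of Y "-1"] by simp

lemma lin_sum [intro]:
  "(\<And>i. i \<in> I \<Longrightarrow> Y i \<in> lin) \<Longrightarrow> (\<lambda>\<omega>. \<Sum>i\<in>I. Y i \<omega>) \<in> lin"
  by (induction I rule: infinite_finite_induct) auto

lemma lin_measurable [measurable]: "Y \<in> lin \<Longrightarrow> Y \<in> borel_measurable M"
  using lin_gaussian by (auto simp: gaussian_rv_def)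

lemma process_measurable [measurable]: "A s \<in> borel_measurable M"
  by (rule lin_measurable) simp

lemma lin_integrable: "Y \<in> lin \<Longrightarrow> integrable M Y"
  using lin_gaussian gaussian_rv_integrable by blast

lemma lin_expectation:
  assumes "Y \<in> lin" shows "expectation Y = 0"
proof -
  obtain J c where J: "finite J" "Y = (\<lambda>\<omega>. \<Sum>j\<in>J. c j * A j \<omega>)"
    using assms unfolding lin_def by blast
  have "expectation Y = (\<Sum>j\<in>J. expectation (\<lambda>\<omega>. c j * A j \<omega>))"
    unfolding J(2)
    by (rule Bochner_Integration.integral_sum) (rule integrable_mult_right, rule lin_integrable [OF lin_process])
  then show ?thesis by (simp add: centered)
qed

lemma lin_square_integrable: "Y \<in> lin \<Longrightarrow> integrable M (\<lambda>\<omega>. (Y \<omega>)\<^sup>2)"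
  using lin_gaussian gaussian_rv_square_integrable by blast

lemma lin_mult_integrable:
  assumes "Y \<in> lin" "Z \<in> lin"
  shows "integrable M (\<lambda>\<omega>. Y \<omega> * Z \<omega>)"
proof -
  have "integrable M (\<lambda>\<omega>. (Y \<omega> + Z \<omega>)\<^sup>2 - (Y \<omega>)\<^sup>2 - (Z \<omega>)\<^sup>2)"
    using lin_square_integrable [OF lin_add [OF assms]] lin_square_integrable [OF assms(1)]
      lin_square_integrable [OF assms(2)] by simp
  then have "integrable M (\<lambda>\<omega>. 2 * (Y \<omega> * Z \<omega>))" by (simp add: power2_sum mult.assoc)
  then show ?thesis by simp
qed

lemma lin_exp_integrable: "Y \<in> lin \<Longrightarrow> integrable M (\<lambda>\<omega>. exp (Y \<omega>))"
  using lin_gaussian gaussian_rv_exp_integrable by blast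

text \<open>On \<open>lin\<close> this product moment is the covariance, since the members of
  \<open>lin\<close> have mean zero.\<close>

definition cov :: "('w \<Rightarrow> real) \<Rightarrow> ('w \<Rightarrow> real) \<Rightarrow> real" where
  "cov Y Z = expectation (\<lambda>\<omega>. Y \<omega> * Z \<omega>)"

lemma cov_commute: "cov Y Z = cov Z Y"
  by (simp add: cov_def mult.commute)

lemma cov_self_nonneg: "0 \<le> cov Y Y"
  unfolding cov_def by (rule Bochner_Integration.integral_nonneg) simp

lemma cov_zero [simp]: "cov (\<lambda>_. 0) Y = 0" "cov Y (\<lambda>_. 0) = 0"
  by (simp_all add: cov_def)

lemma cov_scale [simp]: "cov (\<lambda>\<omega>. a * Y \<omega>) Z = a * cov Y Z" "cov Z (\<lambda>\<omega>. a * Y \<omega>) = a * cov Z Y"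
  by (simp_all add: cov_def mult.assoc mult.left_commute [of _ a])

lemma cov_minus [simp]: "cov (\<lambda>\<omega>. - Y \<omega>) Z = - cov Y Z" "cov Z (\<lambda>\<omega>. - Y \<omega>) = - cov Z Y"
  by (simp_all add: cov_def)

lemma cov_add_left: "Y \<in> lin \<Longrightarrow> Y' \<in> lin \<Longrightarrow> Z \<in> lin \<Longrightarrow> cov (\<lambda>\<omega>. Y \<omega> + Y' \<omega>) Z = cov Y Z + cov Y' Z"
  by (simp add: cov_def distrib_right lin_mult_integrable)

lemma cov_diff_left: "Y \<in> lin \<Longrightarrow> Y' \<in> lin \<Longrightarrow> Z \<in> lin \<Longrightarrow> cov (\<lambda>\<omega>. Y \<omega> - Y' \<omega>) Z = cov Y Z - cov Y' Z"
  by (simp add: cov_def left_diff_distrib lin_mult_integrable)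

lemma cov_add_right: "Y \<in> lin \<Longrightarrow> Y' \<in> lin \<Longrightarrow> Z \<in> lin \<Longrightarrow> cov Z (\<lambda>\<omega>. Y \<omega> + Y' \<omega>) = cov Z Y + cov Z Y'"
  unfolding cov_commute [of Z] by (rule cov_add_left)

lemma cov_diff_right: "Y \<in> lin \<Longrightarrow> Y' \<in> lin \<Longrightarrow> Z \<in> lin \<Longrightarrow> cov Z (\<lambda>\<omega>. Y \<omega> - Y' \<omega>) = cov Z Y - cov Z Y'"
  unfolding cov_commute [of Z] by (rule cov_diff_left)

lemma cov_sum_left:
  "(\<And>i. i \<in> I \<Longrightarrow> Y i \<in> lin) \<Longrightarrow> Z \<in> lin \<Longrightarrow> cov (\<lambda>\<omega>. \<Sum>i\<in>I. Y i \<omega>) Z = (\<Sum>i\<in>I. cov (Y i) Z)"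
  by (induction I rule: infinite_finite_induct) (auto simp: cov_add_left lin_sum)

lemma cov_sum_right:
  "(\<And>i. i \<in> I \<Longrightarrow> Y i \<in> lin) \<Longrightarrow> Z \<in> lin \<Longrightarrow> cov Z (\<lambda>\<omega>. \<Sum>i\<in>I. Y i \<omega>) = (\<Sum>i\<in>I. cov Z (Y i))"
  using cov_sum_left [of I Y Z] by (simp add: cov_commute [of Z])

lemma lin_exp: "Y \<in> lin \<Longrightarrow> expectation (\<lambda>\<omega>. exp (Y \<omega>)) = exp (cov Y Y / 2)"
  using gaussian_rv_exp [OF lin_gaussian lin_expectation] by (simp add: cov_def power2_eq_square)

text \<open>The exponentially tilted measure of Cameron and Martin; it shifts the mean of \<open>Y\<close> by
  \<open>cov X Y\<close>.\<close>

definition tilt :: "('w \<Rightarrow> real) \<Rightarrow> 'w measure" where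
  "tilt X = density M (\<lambda>\<omega>. ennreal (exp (X \<omega> - cov X X / 2)))"

lemma sets_tilt [simp, measurable_cong]: "sets (tilt X) = sets M"
  by (simp add: tilt_def)

lemma space_tilt [simp]: "space (tilt X) = space M"
  by (simp add: tilt_def)

lemma tilt_zero [simp]: "tilt (\<lambda>_. 0) = M"
  by (simp add: tilt_def density_1)

context
  fixes X assumes X: "X \<in> lin"
begin

text \<open>The density times the exponential of Y is a constant times the exponential of
  \<open>X + Y\<close>, which again lies in \<open>lin\<close>. The result is the moment of a normal
  variable with mean \<open>cov X Y\<close> and the old variance \<open>cov Y Y\<close>.\<close>

lemma tilt_exp:
  assumes Y: "Y \<in> lin"
  shows "integrable (tilt X) (\<lambda>\<omega>. exp (Y \<omega>))"
    and "(\<integral>\<omega>. exp (Y \<omega>) \<partial>tilt X) = exp (cov X Y + cov Y Y / 2)"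
proof -
  have m [measurable]: "X \<in> borel_measurable M" "Y \<in> borel_measurable M"
    using X Y by (auto intro: lin_measurable)
  have XY: "(\<lambda>\<omega>. X \<omega> + Y \<omega>) \<in> lin" using X Y by blast
  have eq: "exp (X \<omega> - cov X X / 2) * exp (Y \<omega>) = exp (- cov X X / 2) * exp (X \<omega> + Y \<omega>)" for \<omega>
    by (simp flip: exp_add)
  show "integrable (tilt X) (\<lambda>\<omega>. exp (Y \<omega>))"
    unfolding tilt_def
    by (subst integrable_density) (auto simp: eq lin_exp_integrable [OF XY] simp del: exp_diff)
  have "(\<integral>\<omega>. exp (Y \<omega>) \<partial>tilt X) = (\<integral>\<omega>. exp (- cov X X / 2) * exp (X \<omega> + Y \<omega>) \<partial>M)"
    unfolding tilt_def by (subst integral_density) (auto simp: eq)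
  also have "\<dots> = exp (- cov X X / 2) * exp (cov (\<lambda>\<omega>. X \<omega> + Y \<omega>) (\<lambda>\<omega>. X \<omega> + Y \<omega>) / 2)"
    by (simp add: lin_exp [OF XY])
  also have "cov (\<lambda>\<omega>. X \<omega> + Y \<omega>) (\<lambda>\<omega>. X \<omega> + Y \<omega>) = cov X X + 2 * cov X Y + cov Y Y"
    unfolding cov_add_left [OF X Y XY] cov_add_right [OF X Y X] cov_add_right [OF X Y Y]
    by (simp add: cov_commute [of Y X])
  also have "exp (- cov X X / 2) * exp ((cov X X + 2 * cov X Y + cov Y Y) / 2) =
      exp (cov X Y + cov Y Y / 2)"
    by (simp add: add_divide_distrib flip: exp_add)
  finally show "(\<integral>\<omega>. exp (Y \<omega>) \<partial>tilt X) = exp (cov X Y + cov Y Y / 2)" .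
qed

lemma prob_space_tilt: "prob_space (tilt X)"
proof
  have [measurable]: "X \<in> borel_measurable M" using X by (rule lin_measurable)
  have eq: "exp (X \<omega> - cov X X / 2) = exp (- cov X X / 2) * exp (X \<omega>)" for \<omega>
    by (simp flip: exp_add)
  have "emeasure (tilt X) (space (tilt X)) = (\<integral>\<^sup>+ \<omega>. ennreal (exp (X \<omega> - cov X X / 2)) \<partial>M)"
    unfolding space_tilt unfolding tilt_def
    by (subst emeasure_density) (auto intro!: nn_integral_cong)
  also have "\<dots> = ennreal (expectation (\<lambda>\<omega>. exp (- cov X X / 2) * exp (X \<omega>)))"
    unfolding eq using lin_exp_integrable [OF X] by (intro nn_integral_eq_integral) auto
  also have "\<dots> = ennreal (exp (- cov X X / 2) * exp (cov X X / 2))" by (simp add: lin_exp [OF X])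
  also have "\<dots> = 1" by (simp flip: exp_add)
  finally show "emeasure (tilt X) (space (tilt X)) = 1" .
qed

text \<open>Markov's inequality with exponent one; a better exponent is brought in by rescaling
  Y.\<close>

lemma tilt_Chernoff:
  assumes Y: "Y \<in> lin"
  shows "measure (tilt X) {\<omega> \<in> space M. z \<le> Y \<omega> - cov X Y} \<le> exp (cov Y Y / 2 - z)"
proof -
  interpret Q: prob_space "tilt X" by (rule prob_space_tilt)
  have [measurable]: "Y \<in> borel_measurable M" using Y by (rule lin_measurable)
  have "measure (tilt X) {\<omega> \<in> space (tilt X). exp (z + cov X Y) \<le> exp (Y \<omega>)} \<le>
      (\<integral>\<omega>. exp (Y \<omega>) \<partial>tilt X) / exp (z + cov X Y)"
    by (intro integral_Markov_inequality_measure [where A = "{}"] tilt_exp Y) auto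
  also have "\<dots> = exp (cov Y Y / 2 - z)"
    unfolding tilt_exp(2) [OF Y] by (simp flip: exp_diff)
  finally show ?thesis by (simp add: algebra_simps)
qed

lemma tilt_gaussian_tail:
  assumes Y: "Y \<in> lin" and v: "0 < v" "cov Y Y \<le> v" and z: "0 \<le> z"
  shows "measure (tilt X) {\<omega> \<in> space M. z \<le> \<bar>Y \<omega> - cov X Y\<bar>} \<le> 2 * exp (- z\<^sup>2 / (2 * v))"
proof -
  interpret Q: prob_space "tilt X" by (rule prob_space_tilt)
  have one: "measure (tilt X) {\<omega> \<in> space M. z \<le> W \<omega> - cov X W} \<le> exp (- z\<^sup>2 / (2 * v))"
    if W: "W \<in> lin" "cov W W \<le> v" for W
  \<comment> \<open>For positive z the factor \<open>z / v\<close> minimizes the Chernoff exponent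
    at variance v. For \<open>z = 0\<close> the right side is 1.\<close>
  proof (cases "z = 0")
    case False
    then have zv: "z / v > 0" using v z by simp
    have eq: "{\<omega> \<in> space M. z \<le> W \<omega> - cov X W} =
        {\<omega> \<in> space M. z / v * z \<le> z / v * W \<omega> - cov X (\<lambda>\<omega>. z / v * W \<omega>)}"
      unfolding cov_scale right_diff_distrib [symmetric] using mult_le_cancel_left_pos [OF zv] by simp
    have "measure (tilt X) {\<omega> \<in> space M. z \<le> W \<omega> - cov X W} \<le>
        exp (cov (\<lambda>\<omega>. z / v * W \<omega>) (\<lambda>\<omega>. z / v * W \<omega>) / 2 - z / v * z)"
      unfolding eq by (rule tilt_Chernoff [OF lin_scale [OF W(1)]])
    also have "\<dots> = exp ((z / v)\<^sup>2 * cov W W / 2 - z / v * z)"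
      unfolding cov_scale by (simp add: power2_eq_square mult.assoc)
    also have "\<dots> \<le> exp ((z / v)\<^sup>2 * v / 2 - z / v * z)"
      using W v by (simp add: mult_left_mono divide_right_mono)
    also have "(z / v)\<^sup>2 * v / 2 - z / v * z = - z\<^sup>2 / (2 * v)"
      using v by (simp add: field_simps power2_eq_square)
    finally show ?thesis .
  qed simp
  have [measurable]: "Y \<in> borel_measurable M" using Y by (rule lin_measurable)
  have "measure (tilt X) {\<omega> \<in> space M. z \<le> \<bar>Y \<omega> - cov X Y\<bar>} \<le>
      measure (tilt X) ({\<omega> \<in> space M. z \<le> Y \<omega> - cov X Y} \<union>
        {\<omega> \<in> space M. z \<le> - Y \<omega> - cov X (\<lambda>\<omega>. - Y \<omega>)})"
    by (intro Q.finite_measure_mono) auto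
  also have "\<dots> \<le> measure (tilt X) {\<omega> \<in> space M. z \<le> Y \<omega> - cov X Y} +
      measure (tilt X) {\<omega> \<in> space M. z \<le> - Y \<omega> - cov X (\<lambda>\<omega>. - Y \<omega>)}"
    by (intro measure_Un_le) auto
  also have "\<dots> \<le> exp (- z\<^sup>2 / (2 * v)) + exp (- z\<^sup>2 / (2 * v))"
    using Y v by (intro add_mono one) auto
  finally show ?thesis by simp
qed

text \<open>On E the density of the tilted measure is at most \<open>exp (x - cov X X / 2)\<close>;
  its reciprocal carries lower bounds back from the tilted measure to M.\<close>

lemma prob_ge_tilt:
  assumes E: "E \<in> sets M" and le: "\<And>\<omega>. \<omega> \<in> E \<Longrightarrow> X \<omega> \<le> x"
  shows "exp (cov X X / 2 - x) * measure (tilt X) E \<le> prob E"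
proof -
  interpret Q: prob_space "tilt X" by (rule prob_space_tilt)
  have [measurable]: "X \<in> borel_measurable M" using X by (rule lin_measurable)
  have [measurable]: "E \<in> sets M" by fact
  have "ennreal (exp (cov X X / 2 - x) * measure (tilt X) E) =
      ennreal (exp (cov X X / 2 - x)) * emeasure (tilt X) E"
    by (simp add: ennreal_mult' Q.emeasure_eq_measure)
  also have "\<dots> = (\<integral>\<^sup>+ \<omega>. ennreal (exp (cov X X / 2 - x)) *
      (ennreal (exp (X \<omega> - cov X X / 2)) * indicator E \<omega>) \<partial>M)"
    unfolding tilt_def by (subst emeasure_density) (auto simp: nn_integral_cmult)
  also have "\<dots> \<le> (\<integral>\<^sup>+ \<omega>. indicator E \<omega> \<partial>M)"
  proof (intro nn_integral_mono)
    fix \<omega> assume "\<omega> \<in> space M"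
    show "ennreal (exp (cov X X / 2 - x)) * (ennreal (exp (X \<omega> - cov X X / 2)) * indicator E \<omega>) \<le>
        indicator E \<omega>"
      using le [of \<omega>] by (auto split: split_indicator simp: ennreal_le_1 simp flip: ennreal_mult' exp_add)
  qed
  also have "\<dots> = ennreal (prob E)" by (simp add: emeasure_eq_measure)
  finally show ?thesis by simp
qed

end

end

section \<open>Dyadic chaining\<close>

text \<open>Level n of the chaining has \<open>2 ^ n\<close> increments. Since
  \<open>2 powr (q * n)\<close> is at least \<open>1 + q * n * ln 2\<close>, the condition
  \<open>2 \<le> b * q\<close> yields the decay \<open>(1 / 4) ^ n\<close>, which pays for their
  number and leaves a geometric series.\<close>

lemma dyadic_exp_bound:
  fixes q b :: real
  assumes q: "0 < q" and b: "2 \<le> b * q"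
  shows "2 ^ n * exp (- b * 2 powr (q * real n)) \<le> exp (- b) * (1 / 2) ^ n"
proof -
  have bpos: "0 < b" using q b by (smt (verit) mult_nonpos_nonneg)
  have "2 powr (q * real n) = exp (q * real n * ln 2)" by (simp add: powr_def)
  then have "1 + q * real n * ln 2 \<le> 2 powr (q * real n)" using exp_ge_add_one_self by simp
  then have "b * (1 + q * real n * ln 2) \<le> b * 2 powr (q * real n)"
    using bpos by (intro mult_left_mono) auto
  moreover have "2 * (real n * ln 2) \<le> (b * q) * (real n * ln 2)" using b by (intro mult_right_mono) auto
  ultimately have le: "- b * 2 powr (q * real n) \<le> - b - 2 * (real n * ln 2)"
    by (simp add: algebra_simps)
  have "2 ^ n * exp (- b * 2 powr (q * real n)) \<le> 2 ^ n * exp (- b - 2 * (real n * ln 2))"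
    using le by (intro mult_left_mono) auto
  also have "exp (- b - 2 * (real n * ln 2)) = exp (- b) * (exp (- ln 2) ^ n * exp (- ln 2) ^ n)"
    by (simp only: exp_of_nat_mult [symmetric] exp_add [symmetric]) simp
  also have "exp (- ln 2) = (1 / 2 :: real)" by (simp add: exp_minus)
  also have "2 ^ n * (exp (- b) * ((1 / 2) ^ n * (1 / 2) ^ n)) = exp (- b) * (1 / 2 :: real) ^ n"
    by (simp add: power_divide)
  finally show ?thesis .
qed

lemma (in finite_measure) measure_UN_geometric:
  assumes N: "\<And>n. N n \<in> sets M" "\<And>n. measure M (N n) \<le> c * (1 / 2) ^ n"
  shows "measure M (\<Union>n. N n) \<le> 2 * c"
proof -
  have s: "(\<lambda>n. c * (1 / 2) ^ n) sums (2 * c)"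
    using sums_mult [OF geometric_sums [of "1 / 2 :: real"], of c] by (simp add: mult.commute)
  have sm: "summable (\<lambda>n. measure M (N n))"
    by (rule summable_comparison_test' [OF sums_summable [OF s], of 0]) (simp add: N)
  have "measure M (\<Union>n. N n) \<le> (\<Sum>n. measure M (N n))"
    using N sm by (intro finite_measure_subadditive_countably) auto
  also have "\<dots> \<le> (\<Sum>n. c * (1 / 2) ^ n)"
    by (intro suminf_le N sm sums_summable [OF s])
  also have "\<dots> = 2 * c" using s by (rule sums_unique [symmetric])
  finally show ?thesis .
qed

text \<open>The steps allowed on the levels sum to z, as \<open>1 - \<rho>\<close> normalizes the
  geometric series. A point of level n + 1 with odd index is one step away from a point of level n;
  density of the dyadic points and continuity do the rest.\<close>

lemma dyadic_chaining_pathwise: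
  fixes f :: "real \<Rightarrow> real" and \<rho> z s0 T :: real
  assumes cont: "continuous_on UNIV f" and T: "0 < T" and z: "0 \<le> z" and \<rho>: "0 \<le> \<rho>" "\<rho> < 1"
    and step: "\<And>n k. k < 2 ^ n \<Longrightarrow>
      \<bar>f (s0 + real (Suc k) * T / 2 ^ n) - f (s0 + real k * T / 2 ^ n)\<bar> \<le> z * (1 - \<rho>) * \<rho> ^ n"
    and s: "s \<in> {s0..s0 + T}"
  shows "\<bar>f s - f s0\<bar> \<le> z"
proof -
  define pt where "pt n k = s0 + real k * T / 2 ^ n" for n k
  have dyadic: "\<bar>f (pt n k) - f s0\<bar> \<le> z * (1 - \<rho> ^ Suc n)" if "k \<le> 2 ^ n" for n k
    using that
  proof (induction n arbitrary: k)
    case 0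
    then consider "k = 0" | "k = 1" by (auto simp: le_Suc_eq)
    then show ?case using z \<rho> step [of 0 0] by cases (auto simp: pt_def)
  next
    case (Suc n)
    have half: "pt (Suc n) (2 * j) = pt n j" for j by (simp add: pt_def)
    have mono: "z * (1 - \<rho> ^ Suc n) + z * (1 - \<rho>) * \<rho> ^ Suc n = z * (1 - \<rho> ^ Suc (Suc n))"
      by (simp add: algebra_simps)
    have nn: "0 \<le> z * (1 - \<rho>) * \<rho> ^ Suc n" using z \<rho> by simp
    show ?case
    proof (cases "even k")
      case True
      then obtain j where j: "k = 2 * j" by (elim evenE)
      then have "j \<le> 2 ^ n" using Suc.prems by simp
      from Suc.IH [OF this] show ?thesis unfolding j half using mono nn by linarith
    next
      case False
      then obtain j where j: "k = Suc (2 * j)" by (metis oddE Suc_eq_plus1)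
      then have "j \<le> 2 ^ n" "2 * j < 2 ^ Suc n" using Suc.prems by simp_all
      with Suc.IH [OF this(1)] step [OF this(2)] show ?thesis
        unfolding j pt_def [symmetric] half using mono by linarith
    qed
  qed
  \<comment> \<open>Index of the last grid point of level n not beyond s; it lies within
    \<open>T / 2 ^ n\<close> of s.\<close>
  define k where "k n = nat \<lfloor>(s - s0) / T * 2 ^ n\<rfloor>" for n :: nat
  have nn: "0 \<le> (s - s0) / T" "(s - s0) / T \<le> 1" using s T by auto
  have k1: "real (k n) \<le> (s - s0) / T * 2 ^ n" "(s - s0) / T * 2 ^ n < real (k n) + 1" for n
  proof -
    have "real (k n) = of_int \<lfloor>(s - s0) / T * 2 ^ n\<rfloor>"
      unfolding k_def using mult_nonneg_nonneg [OF nn(1), of "2 ^ n"] by (intro of_nat_nat) simp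
    then show "real (k n) \<le> (s - s0) / T * 2 ^ n" "(s - s0) / T * 2 ^ n < real (k n) + 1"
      by linarith+
  qed
  have k2: "k n \<le> 2 ^ n" for n
  proof -
    have "real (k n) \<le> 1 * 2 ^ n"
      by (rule order_trans [OF k1(1)]) (rule mult_right_mono [OF nn(2)], simp)
    then have "real (k n) \<le> real (2 ^ n)" by simp
    then show ?thesis by (simp only: of_nat_le_iff)
  qed
  have lim: "(\<lambda>n. pt n (k n)) \<longlonglongrightarrow> s"
  proof (rule LIM_zero_cancel, rule Lim_null_comparison)
    show "(\<lambda>n. T * (1 / 2) ^ n) \<longlonglongrightarrow> 0"
      by (intro tendsto_mult_right_zero LIMSEQ_realpow_zero) auto
    show "\<forall>\<^sub>F n in sequentially. norm (pt n (k n) - s) \<le> T * (1 / 2) ^ n"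
    proof (intro always_eventually allI)
      fix n
      have eq: "pt n (k n) - s = (real (k n) - (s - s0) / T * 2 ^ n) * (T / 2 ^ n)"
        using T by (simp add: pt_def field_simps)
      have "\<bar>real (k n) - (s - s0) / T * 2 ^ n\<bar> \<le> 1" using k1 [of n] by linarith
      then have "\<bar>real (k n) - (s - s0) / T * 2 ^ n\<bar> * (T / 2 ^ n) \<le> 1 * (T / 2 ^ n)"
        using T by (intro mult_right_mono) auto
      then show "norm (pt n (k n) - s) \<le> T * (1 / 2) ^ n"
        unfolding eq real_norm_def abs_mult using T by (simp add: power_divide)
    qed
  qed
  have "(\<lambda>n. \<bar>f (pt n (k n)) - f s0\<bar>) \<longlonglongrightarrow> \<bar>f s - f s0\<bar>"
    using continuous_on_tendsto_compose [OF cont lim] by (intro tendsto_intros) auto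
  moreover have "\<bar>f (pt n (k n)) - f s0\<bar> \<le> z" for n
  proof -
    have "z * (1 - \<rho> ^ Suc n) \<le> z * 1" using z \<rho> by (intro mult_left_mono) auto
    then show ?thesis using dyadic [OF k2, of n] by linarith
  qed
  ultimately show ?thesis by (intro LIMSEQ_le_const2) auto
qed

text \<open>For \<open>\<rho> = 2 powr (- H / 2)\<close> this is the coefficient of
  \<open>z\<^sup>2 / T powr (2 * H)\<close> in the Gaussian exponent of a single step over length T
  and of size \<open>z * (1 - \<rho>)\<close>.\<close>

definition chaining_const :: "real \<Rightarrow> real" where
  "chaining_const H = (1 - 2 powr (- H / 2))\<^sup>2 / 2"

lemma chaining_const_pos: "0 < H \<Longrightarrow> 0 < chaining_const H"
  using powr_less_one [of "2::real" "- H / 2"] by (simp add: chaining_const_def)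

text \<open>Only tails of increments are assumed, so that the result applies under the original and
  under every tilted measure. In the constant 4, one factor 2 is the two-sided tail and the other
  the geometric series.\<close>

lemma (in finite_measure) subgaussian_oscillation:
  fixes Z :: "real \<Rightarrow> 'a \<Rightarrow> real"
  assumes H: "0 < H" and cont: "\<And>\<omega>. \<omega> \<in> space M \<Longrightarrow> continuous_on UNIV (\<lambda>s. Z s \<omega>)"
    and meas [measurable]: "\<And>s. Z s \<in> borel_measurable M"
    and tail: "\<And>s s' z. s \<noteq> s' \<Longrightarrow> 0 \<le> z \<Longrightarrow> measure M {\<omega> \<in> space M. z \<le> \<bar>Z s \<omega> - Z s' \<omega>\<bar>} \<le>
      2 * exp (- z\<^sup>2 / (2 * \<bar>s - s'\<bar> powr (2 * H)))"
    and T: "0 < T" and z: "0 \<le> z" and a: "a = chaining_const H * z\<^sup>2 / T powr (2 * H)" "2 \<le> a * H"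
  obtains N where "N \<in> sets M" "measure M N \<le> 4 * exp (- a)"
    "\<And>\<omega> s. \<omega> \<in> space M - N \<Longrightarrow> s \<in> {s0..s0 + T} \<Longrightarrow> \<bar>Z s \<omega> - Z s0 \<omega>\<bar> \<le> z"
proof -
  \<comment> \<open>The squared steps shrink like \<open>2 powr (- H * n)\<close>, the variances
    like \<open>2 powr (- 2 * H * n)\<close>; hence the exponent on level n grows like
    \<open>2 powr (H * n)\<close>, the form required by \<open>dyadic_exp_bound\<close>.\<close>
  define \<rho> :: real where "\<rho> = 2 powr (- H / 2)"
  have \<rho>: "0 < \<rho>" "\<rho> < 1" using H powr_less_one [of "2::real" "- H / 2"] by (auto simp: \<rho>_def)
  define B where "B n k = {\<omega> \<in> space M. z * (1 - \<rho>) * \<rho> ^ n \<le>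
    \<bar>Z (s0 + real (Suc k) * T / 2 ^ n) \<omega> - Z (s0 + real k * T / 2 ^ n) \<omega>\<bar>}" for n k :: nat
  define N where "N n = (\<Union>k<2 ^ n. B n k)" for n :: nat
  have B [measurable]: "B n k \<in> sets M" for n k unfolding B_def by measurable
  then have N: "N n \<in> sets M" for n by (auto simp: N_def)
  have Bm: "measure M (B n k) \<le> 2 * exp (- a * 2 powr (H * real n))" for n k
  proof -
    have d: "\<bar>s0 + real (Suc k) * T / 2 ^ n - (s0 + real k * T / 2 ^ n)\<bar> = T / 2 ^ n"
      using T by (simp add: field_simps)
    have "measure M (B n k) \<le> 2 * exp (- (z * (1 - \<rho>) * \<rho> ^ n)\<^sup>2 / (2 * (T / 2 ^ n) powr (2 * H)))"
      unfolding B_def d [symmetric]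
    proof (rule tail)
      show "s0 + real (Suc k) * T / 2 ^ n \<noteq> s0 + real k * T / 2 ^ n" using d T by auto
      show "0 \<le> z * (1 - \<rho>) * \<rho> ^ n" using z \<rho> by simp
    qed
    also have "(T / 2 ^ n) powr (2 * H) = T powr (2 * H) / 2 powr (2 * H * real n)"
      using T by (simp add: powr_divide powr_powr powr_realpow [symmetric] mult.commute)
    also have "(z * (1 - \<rho>) * \<rho> ^ n)\<^sup>2 = z\<^sup>2 * (1 - \<rho>)\<^sup>2 * 2 powr (- H * real n)"
      by (simp add: power_mult_distrib \<rho>_def powr_powr flip: powr_realpow power_mult)
    also have "2 powr (- H * real n) = 2 powr (H * real n) / 2 powr (2 * H * real n)"
      by (simp flip: powr_diff)
    also have "- (z\<^sup>2 * (1 - \<rho>)\<^sup>2 * (2 powr (H * real n) / 2 powr (2 * H * real n))) /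
        (2 * (T powr (2 * H) / 2 powr (2 * H * real n))) = - a * 2 powr (H * real n)"
      using T by (simp add: a(1) chaining_const_def \<rho>_def)
    finally show ?thesis .
  qed
  have Nm: "measure M (N n) \<le> 2 * exp (- a) * (1 / 2) ^ n" for n
  proof -
    have "measure M (N n) \<le> (\<Sum>k<2 ^ n. measure M (B n k))"
      unfolding N_def by (intro finite_measure_subadditive_finite) (use B in auto)
    also have "\<dots> \<le> (\<Sum>k<(2::nat) ^ n. 2 * exp (- a * 2 powr (H * real n)))"
      by (intro sum_mono Bm)
    also have "\<dots> = 2 * (2 ^ n * exp (- a * 2 powr (H * real n)))" by simp
    also have "\<dots> \<le> 2 * (exp (- a) * (1 / 2) ^ n)"
      using dyadic_exp_bound [OF H a(2)] by (intro mult_left_mono) auto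
    finally show ?thesis by simp
  qed
  show ?thesis
  proof
    show "(\<Union>n. N n) \<in> sets M" using N by auto
    show "measure M (\<Union>n. N n) \<le> 4 * exp (- a)" using measure_UN_geometric [OF N Nm] by simp
    fix \<omega> s assume \<omega>: "\<omega> \<in> space M - (\<Union>n. N n)" and s: "s \<in> {s0..s0 + T}"
    show "\<bar>Z s \<omega> - Z s0 \<omega>\<bar> \<le> z"
    proof (rule dyadic_chaining_pathwise [OF cont T z, where \<rho> = \<rho>])
      fix n k :: nat assume "k < 2 ^ n"
      then have "\<omega> \<notin> B n k" using \<omega> by (auto simp: N_def)
      then show "\<bar>Z (s0 + real (Suc k) * T / 2 ^ n) \<omega> - Z (s0 + real k * T / 2 ^ n) \<omega>\<bar> \<le>
          z * (1 - \<rho>) * \<rho> ^ n"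
        using \<omega> by (auto simp: B_def)
    qed (use \<omega> \<rho> s in auto)
  qed
qed

section \<open>Fractional Brownian motion: covariances and growth\<close>

sublocale fractional_brownian_motion \<subseteq> centered_gaussian_process M A
  by unfold_locales (rule gaussian, rule centered)

lemma fbm_cov_commute: "fbm_cov H s t = fbm_cov H t s"
  by (simp add: fbm_cov_def abs_minus_commute)

lemma continuous_fbm_cov:
  assumes "0 < H" shows "continuous_on UNIV (fbm_cov H s)"
  unfolding fbm_cov_def using assms by (intro continuous_intros continuous_on_powr') auto

lemma fbm_cov_scale:
  assumes "0 \<le> \<tau>" shows "fbm_cov H (\<tau> * u) (\<tau> * v) = \<tau> powr (2 * H) * fbm_cov H u v"
proof -
  have "\<bar>\<tau> * u - \<tau> * v\<bar> = \<tau> * \<bar>u - v\<bar>"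
    using assms by (simp only: right_diff_distrib [symmetric] abs_mult abs_of_nonneg)
  then show ?thesis
    using assms by (simp add: fbm_cov_def abs_mult powr_mult distrib_left right_diff_distrib)
qed

context fractional_brownian_motion
begin

text \<open>Stationarity is applied to the single coordinate \<open>s - t\<close>: the shifts t and
  0 give equal laws, and \<open>A 0\<close> vanishes.\<close>

lemma cov_increment: "cov (\<lambda>\<omega>. A s \<omega> - A t \<omega>) (\<lambda>\<omega>. A s \<omega> - A t \<omega>) = \<bar>s - t\<bar> powr (2 * H)"
proof -
  let ?J = "{s - t}"
  let ?P = "\<Pi>\<^sub>M j\<in>?J. (borel :: real measure)"
  let ?F = "\<lambda>h \<omega>. \<lambda>j\<in>?J. A (j + h) \<omega> - A h \<omega>"
  have F [measurable]: "?F h \<in> measurable M ?P" for h by measurable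
  have int: "(\<integral>x. (x (s - t))\<^sup>2 \<partial>distr M ?P (?F h)) = expectation (\<lambda>\<omega>. (A (s - t + h) \<omega> - A h \<omega>)\<^sup>2)" for h
    by (subst integral_distr) (auto intro!: borel_measurable_power measurable_component_singleton)
  have "distr M ?P (?F t) = distr M ?P (?F 0)"
    using stationary unfolding stationary_increments_def by auto
  then have "expectation (\<lambda>\<omega>. (A s \<omega> - A t \<omega>)\<^sup>2) = expectation (\<lambda>\<omega>. (A (s - t) \<omega> - A 0 \<omega>)\<^sup>2)"
    using int [of t] int [of 0] by simp
  also have "\<dots> = expectation (\<lambda>\<omega>. (A (s - t) \<omega>)\<^sup>2)"
    by (intro Bochner_Integration.integral_cong) (auto simp: start_zero)
  also have "\<dots> = \<bar>s - t\<bar> powr (2 * H)"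
    using variance_eq [of "s - t"] by (simp add: centered)
  finally show ?thesis by (simp add: cov_def power2_eq_square)
qed

lemma cov_fbm: "cov (A s) (A t) = fbm_cov H s t"
proof -
  have sq: "cov (A u) (A u) = \<bar>u\<bar> powr (2 * H)" for u
    using variance_eq [of u] by (simp add: centered cov_def power2_eq_square)
  have "cov (\<lambda>\<omega>. A s \<omega> - A t \<omega>) (\<lambda>\<omega>. A s \<omega> - A t \<omega>) = cov (A s) (A s) - 2 * cov (A s) (A t) + cov (A t) (A t)"
    by (simp add: cov_diff_left cov_diff_right lin_diff cov_commute [of "A t" "A s"])
  then show ?thesis unfolding cov_increment sq by (simp add: fbm_cov_def)
qed

text \<open>The quadratic form of the kernel is the variance of a linear functional of A, so
  positivity is inherited from the process.\<close>

lemma psd_fbm_cov: "psd_kernel (fbm_cov H)"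
  unfolding psd_kernel_def
proof (intro conjI allI impI)
  fix S :: "real set" and c :: "real \<Rightarrow> real" assume "finite S"
  have "(\<Sum>s\<in>S. \<Sum>t\<in>S. c s * c t * fbm_cov H s t) =
      cov (\<lambda>\<omega>. \<Sum>s\<in>S. c s * A s \<omega>) (\<lambda>\<omega>. \<Sum>s\<in>S. c s * A s \<omega>)"
    by (simp add: cov_sum_left cov_sum_right lin_sum lin_scale cov_fbm sum_distrib_left mult_ac)
  then show "0 \<le> (\<Sum>s\<in>S. \<Sum>t\<in>S. c s * c t * fbm_cov H s t)"
    using cov_self_nonneg by simp
qed (rule fbm_cov_commute)

text \<open>Reading the path backwards from T leaves the covariance unchanged, and the time scale
  \<tau> comes out by self-similarity.\<close>

lemma cov_backward_increments:
  assumes "0 \<le> \<tau>"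
  shows "cov (\<lambda>\<omega>. A T \<omega> - A (T - \<tau> * u) \<omega>) (\<lambda>\<omega>. A T \<omega> - A (T - \<tau> * v) \<omega>) =
    \<tau> powr (2 * H) * fbm_cov H u v"
  unfolding fbm_cov_scale [OF assms, symmetric]
  by (simp add: cov_diff_left cov_diff_right lin_diff cov_fbm)
     (simp add: fbm_cov_def abs_minus_commute add_divide_distrib diff_divide_distrib)

lemma cov_continuous:
  assumes "X \<in> lin" shows "continuous_on UNIV (\<lambda>s. cov X (A s))"
proof -
  obtain J c where J: "finite J" "X = (\<lambda>\<omega>. \<Sum>j\<in>J. c j * A j \<omega>)"
    using assms unfolding lin_def by blast
  have "cov X (A s) = (\<Sum>j\<in>J. c j * fbm_cov H j s)" for s
    unfolding J(2) by (simp add: cov_sum_left lin_scale cov_fbm)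
  then show ?thesis
    by (simp add: continuous_intros continuous_fbm_cov [OF hurst(1)])
qed

text \<open>Tilting changes only means: the recentered increments keep the variance bound, hence the
  tails that chaining needs.\<close>

lemma tilt_oscillation:
  assumes X: "X \<in> lin" and T: "0 < T" and z: "0 \<le> z"
    and a: "2 \<le> chaining_const H * z\<^sup>2 / T powr (2 * H) * H"
  obtains N where "N \<in> sets M"
    "measure (tilt X) N \<le> 4 * exp (- (chaining_const H * z\<^sup>2 / T powr (2 * H)))"
    "\<And>\<omega> s. \<omega> \<in> space M - N \<Longrightarrow> s \<in> {s0..s0 + T} \<Longrightarrow>
      \<bar>(A s \<omega> - cov X (A s)) - (A s0 \<omega> - cov X (A s0))\<bar> \<le> z"
proof -
  interpret Q: prob_space "tilt X" by (rule prob_space_tilt [OF X])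
  show ?thesis
  proof (rule Q.subgaussian_oscillation [where Z = "\<lambda>s \<omega>. A s \<omega> - cov X (A s)" and ?s0.0 = s0,
        OF hurst(1) _ _ _ T z refl a])
    fix \<omega> assume "\<omega> \<in> space (tilt X)"
    then show "continuous_on UNIV (\<lambda>s. A s \<omega> - cov X (A s))"
      using continuous_paths cov_continuous [OF X] by (intro continuous_on_diff) auto
  next
    fix s s' z :: real assume s: "s \<noteq> s'" and z: "0 \<le> z"
    have "measure (tilt X) {\<omega> \<in> space M. z \<le> \<bar>(A s \<omega> - A s' \<omega>) - cov X (\<lambda>\<omega>. A s \<omega> - A s' \<omega>)\<bar>}
        \<le> 2 * exp (- z\<^sup>2 / (2 * \<bar>s - s'\<bar> powr (2 * H)))"
      using s z by (intro tilt_gaussian_tail X lin_diff lin_process) (auto simp: cov_increment)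
    then show "measure (tilt X) {\<omega> \<in> space (tilt X). z \<le> \<bar>A s \<omega> - cov X (A s) - (A s' \<omega> - cov X (A s'))\<bar>}
        \<le> 2 * exp (- z\<^sup>2 / (2 * \<bar>s - s'\<bar> powr (2 * H)))"
      by (simp add: cov_diff_right X algebra_simps)
  qed (use that in auto)
qed

lemma oscillation:
  assumes T: "0 < T" and z: "0 \<le> z" and a: "2 \<le> chaining_const H * z\<^sup>2 / T powr (2 * H) * H"
  obtains N where "N \<in> events" "prob N \<le> 4 * exp (- (chaining_const H * z\<^sup>2 / T powr (2 * H)))"
    "\<And>\<omega> s. \<omega> \<in> space M - N \<Longrightarrow> s \<in> {s0..s0 + T} \<Longrightarrow> \<bar>A s \<omega> - A s0 \<omega>\<bar> \<le> z"
  using tilt_oscillation [OF lin_zero T z a, of s0] by auto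

text \<open>One exceptional event serves all times: chaining on the blocks
  \<open>{0..2 ^ j * S}\<close> bounds A by a quarter of the block length, and the smallest block
  containing \<open>s > S\<close> has length at most \<open>2 * s\<close>.\<close>

lemma linear_growth:
  obtains c S0 where "0 < c" "0 < S0"
    "\<forall>S\<ge>S0. \<exists>N\<in>events. prob N \<le> 8 * exp (- c * S powr (2 - 2 * H)) \<and>
      (\<forall>\<omega>\<in>space M - N. \<forall>s\<ge>0. \<bar>A s \<omega>\<bar> \<le> max S s / 2)"
proof -
  define p where "p = 2 - 2 * H"
  have p: "0 < p" using hurst by (simp add: p_def)
  \<comment> \<open>The 16 is the square of the 4 in the bound on each block.\<close>
  define c where "c = chaining_const H / 16"
  have c: "0 < c" using chaining_const_pos [OF hurst(1)] by (simp add: c_def)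
  \<comment> \<open>This threshold makes \<open>c * S powr p * min H p\<close> at least 2, as needed
    both for the chaining within a block (H) and for the sum over the blocks (p).\<close>
  define S0 where "S0 = max 1 ((2 / (c * min H p)) powr (1 / p))"
  have *: "\<exists>N\<in>events. prob N \<le> 8 * exp (- c * S powr p) \<and>
      (\<forall>\<omega>\<in>space M - N. \<forall>s\<ge>0. \<bar>A s \<omega>\<bar> \<le> max S s / 2)" if S: "S0 \<le> S" for S
  proof -
    have S1: "1 \<le> S" using S by (simp add: S0_def)
    define b where "b = c * S powr p"
    have "2 / (c * min H p) = ((2 / (c * min H p)) powr (1 / p)) powr p"
      using p c hurst by (simp add: powr_powr)
    also have "\<dots> \<le> S powr p" using S p by (intro powr_mono2) (auto simp: S0_def)
    finally have "2 \<le> b * min H p"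
      using c hurst p by (simp add: b_def field_simps)
    moreover have "b * min H p \<le> b * H" "b * min H p \<le> b * p"
      using c by (auto simp: b_def intro!: mult_left_mono)
    ultimately have b: "2 \<le> b * H" "2 \<le> b * p" by linarith+
    have b0: "0 \<le> b" using c by (simp add: b_def)
    have a_eq: "chaining_const H * (2 ^ j * S / 4)\<^sup>2 / (2 ^ j * S) powr (2 * H) = b * 2 powr (p * real j)" for j :: nat
    proof -
      have "(2 ^ j * S)\<^sup>2 = (2 ^ j * S) powr 2" using S1 by (simp add: powr_numeral)
      then have "(2 ^ j * S)\<^sup>2 / (2 ^ j * S) powr (2 * H) = (2 ^ j * S) powr p"
        by (simp add: p_def powr_diff)
      also have "\<dots> = 2 powr (p * real j) * S powr p"
        using S1 by (simp add: powr_mult powr_powr mult.commute flip: powr_realpow)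
      finally have "chaining_const H / 16 * ((2 ^ j * S)\<^sup>2 / (2 ^ j * S) powr (2 * H)) =
          c * (2 powr (p * real j) * S powr p)"
        by (simp only: c_def)
      then show ?thesis by (simp add: b_def power_divide mult_ac)
    qed
    have "\<exists>N\<in>events. prob N \<le> 4 * exp (- (b * 2 powr (p * real j))) \<and>
        (\<forall>\<omega>\<in>space M - N. \<forall>s\<in>{0..2 ^ j * S}. \<bar>A s \<omega>\<bar> \<le> 2 ^ j * S / 4)" for j :: nat
    proof -
      have "b * H * 1 \<le> b * H * 2 powr (p * real j)"
        using b0 hurst p by (intro mult_left_mono) (auto intro: ge_one_powr_ge_zero)
      then have "2 \<le> chaining_const H * (2 ^ j * S / 4)\<^sup>2 / (2 ^ j * S) powr (2 * H) * H"
        unfolding a_eq using b by (simp add: mult_ac)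
      then obtain N where "N \<in> events"
        "prob N \<le> 4 * exp (- (chaining_const H * (2 ^ j * S / 4)\<^sup>2 / (2 ^ j * S) powr (2 * H)))"
        "\<And>\<omega> s. \<omega> \<in> space M - N \<Longrightarrow> s \<in> {0..0 + 2 ^ j * S} \<Longrightarrow> \<bar>A s \<omega> - A 0 \<omega>\<bar> \<le> 2 ^ j * S / 4"
        using oscillation [of "2 ^ j * S" "2 ^ j * S / 4" 0] S1 by (auto simp del: atLeastAtMost_iff)
      then show ?thesis unfolding a_eq using start_zero by (intro bexI [of _ N]) auto
    qed
    then obtain N where N: "\<And>j. N j \<in> events" "\<And>j. prob (N j) \<le> 4 * exp (- (b * 2 powr (p * real j)))"
      "\<And>j \<omega> s. \<omega> \<in> space M - N j \<Longrightarrow> s \<in> {0..2 ^ j * S} \<Longrightarrow> \<bar>A s \<omega>\<bar> \<le> 2 ^ j * S / 4"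
      by metis
    have Nm: "prob (N j) \<le> 4 * exp (- b) * (1 / 2) ^ j" for j
    proof -
      have "exp (- b * 2 powr (p * real j)) \<le> 2 ^ j * exp (- b * 2 powr (p * real j))" by simp
      also have "\<dots> \<le> exp (- b) * (1 / 2) ^ j" by (rule dyadic_exp_bound [OF p b(2)])
      finally show ?thesis using N(2) [of j] by simp
    qed
    show ?thesis
    proof (intro bexI [of _ "\<Union>j. N j"] conjI ballI allI impI)
      show "prob (\<Union>j. N j) \<le> 8 * exp (- c * S powr p)"
        using measure_UN_geometric [OF N(1) Nm] by (simp add: b_def)
      fix \<omega> and s :: real assume \<omega>: "\<omega> \<in> space M - (\<Union>j. N j)" and s: "0 \<le> s"
      show "\<bar>A s \<omega>\<bar> \<le> max S s / 2"
      proof (cases "s \<le> S")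
        case True
        then show ?thesis using N(3) [of \<omega> 0 s] \<omega> s S1 by auto
      next
        case False
        obtain n where "s / S < 2 ^ n" using real_arch_pow [of 2 "s / S"] by auto
        then have ex: "s \<le> 2 ^ n * S" using S1 by (simp add: field_simps)
        define j where "j = (LEAST n. s \<le> 2 ^ n * S)"
        have j: "s \<le> 2 ^ j * S" unfolding j_def by (rule LeastI [of _ n]) (rule ex)
        then have "j \<noteq> 0" using False by (intro notI) simp
        then obtain i where i: "j = Suc i" using not0_implies_Suc by blast
        have "\<not> s \<le> 2 ^ i * S" using i not_less_Least [of i "\<lambda>n. s \<le> 2 ^ n * S"] by (simp add: j_def)
        then have "2 ^ j * S \<le> 2 * s" by (simp add: i)
        moreover have "\<bar>A s \<omega>\<bar> \<le> 2 ^ j * S / 4" using N(3) [of \<omega> j s] \<omega> s j by auto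
        ultimately show ?thesis by simp
      qed
    qed (use N in auto)
  qed
  show ?thesis
  proof (rule that [of c S0])
    show "0 < S0" by (simp add: S0_def)
  qed (use c * in \<open>simp_all add: p_def\<close>)
qed

end

section \<open>First passage events\<close>

lemma open_rational_witness:
  fixes U :: "real set"
  assumes "open U" "s \<in> U"
  obtains q where "q \<in> \<rat>" "q \<in> U"
proof -
  obtain e where e: "e > 0" "\<And>y. dist y s < e \<Longrightarrow> y \<in> U"
    using assms unfolding open_dist by blast
  obtain q where "q \<in> \<rat>" "s < q" "q < s + e" using Rats_dense_in_real [of s "s + e"] e(1) by auto
  then show ?thesis using that [of q] e(2) [of q] by (simp add: dist_real_def)
qed

text \<open>At the first time \<open>s \<ge> t\<close> at which \<open>f s - s\<close> reaches the level \<open>x\<close>, the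
  path \<open>f\<close> lies above the line of slope one when seen backwards from \<open>s\<close>.\<close>

lemma first_passage_backward:
  fixes f :: "real \<Rightarrow> real"
  assumes cont: "continuous_on UNIV f" and s1: "0 < s1" "x < f s1 - s1"
    and le: "\<And>r. r \<in> {0..t} \<Longrightarrow> f r - r \<le> x"
  obtains s where "t \<le> s" "\<And>u. u \<in> {0..s} \<Longrightarrow> u \<le> f s - f (s - u)"
proof -
  have t: "t < s1" using le [of s1] s1 by force
  \<comment> \<open>At the least element of this compact set the level x is reached, and before it
    the level is not exceeded: up to t by hypothesis, later by minimality. Subtracting the two
    inequalities gives the slope.\<close>
  define C where "C = {s \<in> {t..s1}. x \<le> f s - s}"
  have "C = {t..s1} \<inter> {s. x \<le> f s - s}" by (auto simp: C_def)
  moreover have "closed {s. x \<le> f s - s}" by (intro closed_Collect_le continuous_intros cont)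
  ultimately have "compact C" using compact_Int_closed [OF compact_Icc] by metis
  moreover have "s1 \<in> C" using s1 t by (simp add: C_def)
  ultimately have "\<exists>s\<in>C. \<forall>y\<in>C. s \<le> y" by (intro compact_attains_inf) auto
  then obtain s where s: "s \<in> C" "\<And>y. y \<in> C \<Longrightarrow> s \<le> y" by blast
  have below: "f r - r \<le> x" if r: "0 \<le> r" "r < s" for r
  proof (rule ccontr)
    assume "\<not> f r - r \<le> x"
    then have "r \<in> C" using le [of r] s(1) r by (cases "r \<le> t") (auto simp: C_def)
    then show False using s(2) [of r] r by simp
  qed
  show ?thesis
  proof
    show "t \<le> s" using s by (simp add: C_def)
    fix u assume u: "u \<in> {0..s}"
    show "u \<le> f s - f (s - u)"
      using s(1) below [of "s - u"] u by (cases "u = 0") (auto simp: C_def)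
  qed
qed

context fractional_brownian_motion
begin

lemma sup_all_gt: "ereal x < sup_all A \<omega> \<longleftrightarrow> (\<exists>s>0. x < A s \<omega> - s)"
  unfolding sup_all_def less_SUP_iff by auto

lemma sup_upto_gt: "ereal x < sup_upto A t \<omega> \<longleftrightarrow> (\<exists>s\<in>{0..t}. x < A s \<omega> - s)"
  unfolding sup_upto_def less_SUP_iff by auto

lemma level_set_open:
  assumes "\<omega> \<in> space M" shows "open {s. x < A s \<omega> - s}"
  by (intro open_Collect_less continuous_intros continuous_paths assms)

text \<open>Level sets are open by continuity, so one that meets the closure of W meets W itself,
  and then at a rational time; the union becomes countable. The closure makes room for the closed
  interval \<open>{0..t}\<close>.\<close>

lemma exceedance_event:
  assumes W: "open W"
  shows "{\<omega> \<in> space M. \<exists>s\<in>closure W. x < A s \<omega> - s} \<in> events"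
proof -
  have "(\<exists>s\<in>closure W. x < A s \<omega> - s) \<longleftrightarrow> (\<exists>q\<in>\<rat> \<inter> W. x < A q \<omega> - q)" if \<omega>: "\<omega> \<in> space M" for \<omega>
  proof
    let ?U = "{s. x < A s \<omega> - s}"
    assume "\<exists>s\<in>closure W. x < A s \<omega> - s"
    then have "?U \<inter> closure W \<noteq> {}" by auto
    then have "?U \<inter> W \<noteq> {}"
      using open_Int_closure_eq_empty [OF level_set_open [OF \<omega>]] by simp
    then obtain s where "s \<in> ?U \<inter> W" by blast
    then obtain q where "q \<in> \<rat>" "q \<in> ?U \<inter> W"
      by (rule open_rational_witness [OF open_Int [OF level_set_open [OF \<omega>] W]])
    then show "\<exists>q\<in>\<rat> \<inter> W. x < A q \<omega> - q" by auto
  qed (use closure_subset in blast)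
  then have "{\<omega> \<in> space M. \<exists>s\<in>closure W. x < A s \<omega> - s} =
      (\<Union>q\<in>\<rat> \<inter> W. {\<omega> \<in> space M. x < A q \<omega> - q})" by auto
  moreover have "\<dots> \<in> events"
  proof (rule sets.countable_UN')
    show "countable (\<rat> \<inter> W)" by (intro countable_Int1 countable_rat)
    have "{\<omega> \<in> space M. x < A q \<omega> - q} \<in> events" for q by measurable
    then show "(\<lambda>q. {\<omega> \<in> space M. x < A q \<omega> - q}) ` (\<rat> \<inter> W) \<subseteq> events" by blast
  qed
  ultimately show ?thesis by simp
qed

lemma sup_upto_event: "0 < t \<Longrightarrow> {\<omega> \<in> space M. ereal x < sup_upto A t \<omega>} \<in> events"
  using exceedance_event [of "{0<..<t}" x] by (simp add: sup_upto_gt)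

lemma sup_all_event: "{\<omega> \<in> space M. ereal x < sup_all A \<omega>} \<in> events"
proof -
  have "(\<exists>s>0. x < A s \<omega> - s) \<longleftrightarrow> (\<exists>q\<in>\<rat> \<inter> {0<..}. x < A q \<omega> - q)" if \<omega>: "\<omega> \<in> space M" for \<omega>
  proof
    assume "\<exists>s>0. x < A s \<omega> - s"
    then obtain s where "s \<in> {s. x < A s \<omega> - s} \<inter> {0<..}" by auto
    then obtain q where "q \<in> \<rat>" "q \<in> {s. x < A s \<omega> - s} \<inter> {0<..}"
      by (rule open_rational_witness [OF open_Int [OF level_set_open [OF \<omega>] open_greaterThan]])
    then show "\<exists>q\<in>\<rat> \<inter> {0<..}. x < A q \<omega> - q" by auto
  qed auto
  then have "{\<omega> \<in> space M. ereal x < sup_all A \<omega>} =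
      (\<Union>q\<in>\<rat> \<inter> {0<..}. {\<omega> \<in> space M. x < A q \<omega> - q})"
    by (auto simp: sup_all_gt)
  moreover have "\<dots> \<in> events"
  proof (rule sets.countable_UN')
    show "countable (\<rat> \<inter> {0<..} :: real set)" by (intro countable_Int1 countable_rat)
    have "{\<omega> \<in> space M. x < A q \<omega> - q} \<in> events" for q by measurable
    then show "(\<lambda>q. {\<omega> \<in> space M. x < A q \<omega> - q}) ` (\<rat> \<inter> {0<..}) \<subseteq> events" by blast
  qed
  ultimately show ?thesis by simp
qed

section \<open>Late passages and the tail gap\<close>

definition late_passage :: "real \<Rightarrow> real \<Rightarrow> 'w set" where
  "late_passage x t = {\<omega> \<in> space M. (\<exists>s>0. x < A s \<omega> - s) \<and> (\<forall>s\<in>{0..t}. A s \<omega> - s \<le> x)}"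

lemma late_passage_eq:
  "late_passage x t = {\<omega> \<in> space M. ereal x < sup_all A \<omega>} - {\<omega> \<in> space M. ereal x < sup_upto A t \<omega>}"
  unfolding late_passage_def sup_all_gt sup_upto_gt bex_simps not_less [symmetric] by blast

lemma late_passage_event: "0 < t \<Longrightarrow> late_passage x t \<in> events"
  unfolding late_passage_eq using sup_all_event sup_upto_event by blast

lemma tail_gap_eq:
  assumes "0 < x" "0 < t" shows "tail_gap M A x t = prob (late_passage x t)"
proof -
  have "{\<omega> \<in> space M. ereal x < sup_upto A t \<omega>} \<subseteq> {\<omega> \<in> space M. ereal x < sup_all A \<omega>}"
  proof (clarify, unfold sup_upto_gt sup_all_gt)
    fix \<omega> assume \<omega>: "\<omega> \<in> space M" and "\<exists>s\<in>{0..t}. x < A s \<omega> - s"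
    then obtain s where s: "s \<in> {0..t}" "x < A s \<omega> - s" by blast
    \<comment> \<open>Time 0 counts in \<open>sup_upto\<close> but not in \<open>sup_all\<close>; a
      positive level excludes it.\<close>
    then have "s \<noteq> 0" using start_zero [OF \<omega>] assms(1) by auto
    then show "\<exists>s>0. x < A s \<omega> - s" using s by (intro exI [of _ s]) auto
  qed
  then show ?thesis
    unfolding tail_gap_def late_passage_eq
    using finite_measure_Diff [OF sup_all_event sup_upto_event [OF assms(2)]] by simp
qed

lemma late_passage_backward:
  assumes "\<omega> \<in> late_passage x t"
  obtains s where "t \<le> s" "\<And>u. u \<in> {0..s} \<Longrightarrow> u \<le> A s \<omega> - A (s - u) \<omega>"
proof -
  have \<omega>: "\<omega> \<in> space M" using assms by (simp add: late_passage_def)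
  obtain s1 where "0 < s1" "x < A s1 \<omega> - s1" using assms by (auto simp: late_passage_def)
  then show ?thesis
    using first_passage_backward [OF continuous_paths [OF \<omega>], of s1 x t] assms that
    by (auto simp: late_passage_def)
qed

lemma tail_gap_measurable:
  assumes "0 < t" shows "(\<lambda>x. tail_gap M A x t) \<in> borel_measurable borel"
proof -
  have "mono (\<lambda>x. - prob {\<omega> \<in> space M. ereal x < sup_all A \<omega>})"
    by (intro monoI le_imp_neg_le finite_measure_mono sup_all_event) (auto elim!: le_less_trans [rotated])
  moreover have "mono (\<lambda>x. - prob {\<omega> \<in> space M. ereal x < sup_upto A t \<omega>})"
    by (intro monoI le_imp_neg_le finite_measure_mono sup_upto_event assms) (auto elim!: le_less_trans [rotated])
  ultimately have "(\<lambda>x. - prob {\<omega> \<in> space M. ereal x < sup_all A \<omega>}) \<in> borel_measurable borel"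
    "(\<lambda>x. - prob {\<omega> \<in> space M. ereal x < sup_upto A t \<omega>}) \<in> borel_measurable borel"
    by (blast intro: borel_measurable_mono)+
  from borel_measurable_diff [OF this(2,1)] show ?thesis by (simp add: tail_gap_def)
qed

section \<open>The variational problem\<close>

text \<open>The path \<open>2 * fbm_cov H 1 r\<close>, which is
  \<open>1 + r powr (2 * H) - (1 - r) powr (2 * H)\<close> on [0,1], is feasible and so bounds the
  dual problem. For \<open>2 * H \<le> 1\<close> the middle term alone dominates r, otherwise the
  other two together do.\<close>

sublocale dual: dual_problem "fbm_cov H" "{0..1}" "\<lambda>r. r"
proof
  show psd: "psd_kernel (fbm_cov H)" by (rule psd_fbm_cov)
  let ?f = "\<lambda>r. 2 * fbm_cov H 1 r + 0 * fbm_cov H 1 r"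
  have f: "?f \<in> rkhs (fbm_cov H)"
    by (intro subsetD [OF kernel_span_subset_rkhs [OF psd]] kernel_span_lincomb kernel_in_span)
  have feasible: "r \<le> ?f r" if r: "r \<in> {0..1}" for r
  proof (cases "2 * H \<le> 1")
    case True
    have "r powr 1 \<le> r powr (2 * H)"
      using r True by (intro powr_mono') auto
    moreover have "(1 - r) powr (2 * H) \<le> 1 powr (2 * H)"
      using r hurst by (intro powr_mono2) auto
    ultimately show ?thesis using r by (simp add: fbm_cov_def)
  next
    case False
    have "(1 - r) powr (2 * H) \<le> (1 - r) powr 1"
      using r False by (intro powr_mono') auto
    then have "(1 - r) powr (2 * H) \<le> 1 - r" using r by simp
    moreover have "0 \<le> r powr (2 * H)" by (rule powr_ge_zero)
    ultimately have "r \<le> 1 + r powr (2 * H) - (1 - r) powr (2 * H)" by linarith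
    then show ?thesis using r by (simp add: fbm_cov_def)
  qed
  show "bdd_above (dual_value (fbm_cov H) ` dual_cone (fbm_cov H) {0..1} (\<lambda>r. r))"
    by (rule bdd_aboveI2) (rule weak_duality [OF psd f feasible])
qed

text \<open>The real number behind the extended real \<open>theta H\<close>; strong duality
  identifies them in \<open>theta_eq\<close>.\<close>

definition opt :: real where "opt = dual_sup (fbm_cov H) {0..1} (\<lambda>r. r)"

lemma opt_nonneg: "0 \<le> opt"
  unfolding opt_def by (rule dual.dual_sup_nonneg)

lemma theta_eq: "theta H = ereal opt"
  unfolding opt_def dual.strong_duality [symmetric] theta_def paths_above_id_def rate_def
  by (intro INF_cong) auto

text \<open>The random variable that corresponds to \<open>kernel_comb (fbm_cov H) S c\<close> when
  the path is read backwards from T in units of \<tau>.\<close>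

definition backward :: "(real \<Rightarrow> real) \<Rightarrow> real set \<Rightarrow> real \<Rightarrow> real \<Rightarrow> 'w \<Rightarrow> real" where
  "backward c S \<tau> T = (\<lambda>\<omega>. \<Sum>u\<in>S. c u * (A T \<omega> - A (T - \<tau> * u) \<omega>))"

lemma backward_lin: "backward c S \<tau> T \<in> lin"
  unfolding backward_def by (intro lin_sum lin_scale lin_diff lin_process)

lemma cov_backward_increment:
  assumes "0 \<le> \<tau>"
  shows "cov (backward c S \<tau> T) (\<lambda>\<omega>. A T \<omega> - A (T - \<tau> * v) \<omega>) =
    \<tau> powr (2 * H) * kernel_comb (fbm_cov H) S c v"
  unfolding backward_def kernel_comb_def
  by (simp add: cov_sum_left lin_scale lin_diff cov_backward_increments [OF assms])
     (simp add: sum_distrib_left mult.left_commute)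

lemma cov_backward:
  assumes "0 \<le> \<tau>" "finite S"
  shows "cov (backward c S \<tau> T) (backward c S \<tau> T) = \<tau> powr (2 * H) *
    span_inner (fbm_cov H) (kernel_comb (fbm_cov H) S c) (kernel_comb (fbm_cov H) S c)"
proof -
  have "kernel_comb (fbm_cov H) S c \<in> kernel_span (fbm_cov H)"
    using assms by (auto simp: kernel_span_def)
  note eval = span_inner_eval [OF psd_fbm_cov this assms(2), of c]
  have "cov (backward c S \<tau> T) (backward c S \<tau> T) =
      (\<Sum>v\<in>S. c v * cov (backward c S \<tau> T) (\<lambda>\<omega>. A T \<omega> - A (T - \<tau> * v) \<omega>))"
    by (subst (2) backward_def) (simp add: cov_sum_right lin_scale lin_diff backward_lin)
  then show ?thesis
    by (simp add: eval cov_backward_increment [OF assms(1)])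
       (simp add: sum_distrib_left mult.left_commute)
qed

end

section \<open>The upper bound\<close>

context fractional_brownian_motion
begin

text \<open>The factor \<open>t powr (1 - 2 * H)\<close> brings threshold and variance to the common
  order \<open>t powr (2 - 2 * H)\<close>. The exponent one is then the right choice, because at the
  dual optimum l equals the squared norm.\<close>

lemma backward_tail:
  assumes "0 < t" "finite S"
  shows "prob {\<omega> \<in> space M. t * y \<le> backward c S t T \<omega>} \<le>
    exp (- (y - span_inner (fbm_cov H) (kernel_comb (fbm_cov H) S c) (kernel_comb (fbm_cov H) S c) / 2) *
      t powr (2 - 2 * H))"
proof -
  let ?G = "span_inner (fbm_cov H) (kernel_comb (fbm_cov H) S c) (kernel_comb (fbm_cov H) S c)"
  let ?Y = "\<lambda>\<omega>. t powr (1 - 2 * H) * backward c S t T \<omega>"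
  have Y: "?Y \<in> lin" by (intro lin_scale backward_lin)
  have pw: "t powr (1 - 2 * H) * t = t powr (2 - 2 * H)"
    "t powr (1 - 2 * H) * (t powr (1 - 2 * H) * t powr (2 * H)) = t powr (2 - 2 * H)"
    using assms by (simp_all add: powr_mult_base mult.commute flip: powr_add)
  have "cov ?Y ?Y = t powr (1 - 2 * H) * (t powr (1 - 2 * H) * t powr (2 * H)) * ?G"
    using assms by (simp add: cov_backward mult.assoc)
  then have cov: "cov ?Y ?Y = t powr (2 - 2 * H) * ?G" unfolding pw .
  have eq: "{\<omega> \<in> space M. t * y \<le> backward c S t T \<omega>} =
      {\<omega> \<in> space M. t powr (2 - 2 * H) * y \<le> ?Y \<omega>}"
    unfolding pw(1) [symmetric] using assms by (simp add: mult.assoc)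
  have "prob {\<omega> \<in> space M. t powr (2 - 2 * H) * y \<le> ?Y \<omega>} \<le>
      exp (t powr (2 - 2 * H) * ?G / 2 - t powr (2 - 2 * H) * y)"
    using tilt_Chernoff [OF lin_zero Y, of "t powr (2 - 2 * H) * y"] unfolding cov by simp
  moreover have "P * G / 2 - P * y = - (y - G / 2) * P" for P G :: real by (simp add: algebra_simps)
  ultimately show ?thesis unfolding eq by metis
qed

text \<open>The exceptional event does not depend on a level x, which makes the later bound uniform
  in x. Half of the margin \<open>opt - \<theta>\<close> is spent on the choice of g, the other half
  on oscillations between grid points.\<close>

lemma no_long_busy_period:
  assumes "\<theta> < opt"
  obtains C t0 where "0 \<le> C" "0 < t0" "\<forall>t\<ge>t0.
    \<exists>N\<in>events. prob N \<le> C * exp (- \<theta> * t powr (2 - 2 * H)) \<and>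
      (\<forall>\<omega>\<in>space M - N. \<forall>s\<ge>t. \<exists>u\<in>{0..s}. A s \<omega> - A (s - u) \<omega> < u)"
proof -
  define p where "p = 2 - 2 * H"
  have p: "0 < p" using hurst by (simp add: p_def)
  let ?K = "fbm_cov H" and ?b = "\<lambda>r::real. r"
  obtain g l where gl: "(g, l) \<in> dual_cone ?K {0..1} ?b"
    and J: "opt - (opt - \<theta>) / 2 \<le> l - span_inner ?K g g / 2"
    using dual.dual_sup_approx [of "(opt - \<theta>) / 2"] assms unfolding opt_def by auto
  obtain S c where S: "finite S" "S \<subseteq> {0..1}" "\<forall>s\<in>S. 0 \<le> c s" "g = kernel_comb ?K S c"
    "l = (\<Sum>s\<in>S. c s * s)"
    using gl by (rule dual_coneE)
  define G where "G = span_inner ?K g g"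
  define W where "W = (\<Sum>u\<in>S. c u)"
  have W: "0 \<le> W" unfolding W_def using S by (intro sum_nonneg) auto
  \<comment> \<open>The total oscillation error \<open>2 * \<eta> * W\<close> then uses at most half
    of the margin; the added 1 covers \<open>W = 0\<close>.\<close>
  define \<eta> where "\<eta> = (opt - \<theta>) / (4 * (W + 1))"
  have \<eta>: "0 < \<eta>" using assms W by (simp add: \<eta>_def)
  have "2 * \<eta> * W \<le> (opt - \<theta>) / 2"
    using assms W by (simp add: \<eta>_def divide_le_eq) (simp add: algebra_simps)
  then have gap: "\<theta> \<le> (l - 2 * \<eta> * W) - G / 2" using J by (simp add: G_def field_simps)
  \<comment> \<open>\<theta> may be nonpositive, while the mesh and the horizon below need a
    positive rate.\<close>
  define \<theta>' where "\<theta>' = max \<theta> 1"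
  have \<theta>': "0 < \<theta>'" "\<theta> \<le> \<theta>'" by (auto simp: \<theta>'_def)
  define \<kappa> where "\<kappa> = chaining_const H"
  have \<kappa>: "0 < \<kappa>" using chaining_const_pos [OF hurst(1)] by (simp add: \<kappa>_def)
  \<comment> \<open>The mesh in units of t, solved from the chaining exponent so that an oscillation
    beyond \<open>\<eta> * t\<close> within one cell has rate \<theta>'.\<close>
  define \<delta> where "\<delta> = (\<kappa> * \<eta>\<^sup>2 / \<theta>') powr (1 / (2 * H))"
  have \<delta>: "0 < \<delta>" using \<kappa> \<eta> \<theta>' by (simp add: \<delta>_def)
  have \<delta>H: "\<kappa> * \<eta>\<^sup>2 / \<delta> powr (2 * H) = \<theta>'"
    using \<kappa> \<eta> \<theta>' hurst by (simp add: \<delta>_def powr_powr)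
  obtain c0 S0 where c0: "0 < c0" "0 < S0" and growth: "\<forall>S\<ge>S0.
      \<exists>N\<in>events. prob N \<le> 8 * exp (- c0 * S powr p) \<and>
      (\<forall>\<omega>\<in>space M - N. \<forall>s\<ge>0. \<bar>A s \<omega>\<bar> \<le> max S s / 2)"
    by (rule linear_growth [folded p_def])
  \<comment> \<open>The horizon in units of t beyond which the growth bound alone has rate
    \<theta>'.\<close>
  define L where "L = max 1 ((\<theta>' / c0) powr (1 / p))"
  have L: "1 \<le> L" by (simp add: L_def)
  have "((\<theta>' / c0) powr (1 / p)) powr p \<le> L powr p" using p by (intro powr_mono2) (auto simp: L_def)
  then have cL: "\<theta>' \<le> c0 * L powr p" using p \<theta>' c0 by (simp add: powr_powr field_simps)
  define n where "n = nat \<lceil>L / \<delta>\<rceil>"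
  define m where "m = card (insert 0 S)"
  \<comment> \<open>The growth bound contributes 8; each of the \<open>Suc n\<close> grid points
    contributes one Chernoff event and m oscillation events of weight 4.\<close>
  define C where "C = 8 + real (Suc n) * (1 + real m * 4)"
  define t0 where "t0 = max S0 ((2 / (\<theta>' * H)) powr (1 / p))"
  have main: "\<exists>N\<in>events. prob N \<le> C * exp (- \<theta> * t powr p) \<and>
      (\<forall>\<omega>\<in>space M - N. \<forall>s\<ge>t. \<exists>u\<in>{0..s}. A s \<omega> - A (s - u) \<omega> < u)" if t: "t0 \<le> t" for t
  proof -
    have t_pos: "0 < t" and tS: "S0 \<le> t" using t c0 by (auto simp: t0_def)
    let ?E = "exp (- \<theta> * t powr p)"
    have E_mono: "exp (- \<theta>' * t powr p) \<le> ?E" using \<theta>' by (simp add: mult_right_mono)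
    have "((2 / (\<theta>' * H)) powr (1 / p)) powr p \<le> t powr p" using t p by (intro powr_mono2) (auto simp: t0_def)
    then have th: "2 \<le> \<theta>' * t powr p * H" using p \<theta>' hurst by (simp add: powr_powr field_simps)
    have "S0 \<le> L * t" using tS t_pos mult_right_mono [OF L, of t] by linarith
    then obtain N0 where N0: "N0 \<in> events" "prob N0 \<le> 8 * exp (- c0 * (L * t) powr p)"
      "\<And>\<omega> s. \<omega> \<in> space M - N0 \<Longrightarrow> 0 \<le> s \<Longrightarrow> \<bar>A s \<omega>\<bar> \<le> max (L * t) s / 2"
      using growth by meson
    have "\<theta>' * t powr p \<le> c0 * L powr p * t powr p" using cL by (intro mult_right_mono) auto
    then have "8 * exp (- c0 * (L * t) powr p) \<le> 8 * exp (- \<theta>' * t powr p)"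
      using L t_pos by (simp add: powr_mult mult.assoc)
    then have N0m: "prob N0 \<le> 8 * ?E" using N0(2) E_mono by linarith
    define s where "s k = real k * (\<delta> * t)" for k :: nat
    have a_eq: "chaining_const H * (\<eta> * t)\<^sup>2 / (\<delta> * t) powr (2 * H) = \<theta>' * t powr p"
    proof -
      have "t\<^sup>2 / t powr (2 * H) = t powr p"
        using t_pos by (simp add: p_def powr_diff powr_numeral)
      moreover have "chaining_const H * (\<eta> * t)\<^sup>2 / (\<delta> * t) powr (2 * H) =
          \<kappa> * \<eta>\<^sup>2 / \<delta> powr (2 * H) * (t\<^sup>2 / t powr (2 * H))"
        using \<delta> t_pos by (simp add: \<kappa>_def powr_mult power_mult_distrib)
      ultimately show ?thesis unfolding \<delta>H by simp
    qed
    have "\<exists>N\<in>events. prob N \<le> 4 * ?E \<and>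
        (\<forall>\<omega>\<in>space M - N. \<forall>r\<in>{x..x + \<delta> * t}. \<bar>A r \<omega> - A x \<omega>\<bar> \<le> \<eta> * t)" for x
    proof -
      obtain N where N: "N \<in> events" "prob N \<le> 4 * exp (- \<theta>' * t powr p)"
          "\<And>\<omega> r. \<omega> \<in> space M - N \<Longrightarrow> r \<in> {x..x + \<delta> * t} \<Longrightarrow> \<bar>A r \<omega> - A x \<omega>\<bar> \<le> \<eta> * t"
        using oscillation [of "\<delta> * t" "\<eta> * t" x, unfolded a_eq] \<delta> \<eta> t_pos th by auto
      have "prob N \<le> 4 * ?E" using N(2) E_mono by linarith
      with N show ?thesis by blast
    qed
    then obtain N1 where N1: "\<And>x. N1 x \<in> events" "\<And>x. prob (N1 x) \<le> 4 * ?E"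
      "\<And>x \<omega> r. \<omega> \<in> space M - N1 x \<Longrightarrow> r \<in> {x..x + \<delta> * t} \<Longrightarrow> \<bar>A r \<omega> - A x \<omega>\<bar> \<le> \<eta> * t"
      by metis
    define N2 where "N2 k = {\<omega> \<in> space M. t * (l - 2 * \<eta> * W) \<le> backward c S t (s k) \<omega>}" for k
    have N2: "N2 k \<in> events" for k
      unfolding N2_def using lin_measurable [OF backward_lin [of c S t "s k"]] by measurable
    have N2m: "prob (N2 k) \<le> ?E" for k
    proof -
      have "prob (N2 k) \<le> exp (- (l - 2 * \<eta> * W - G / 2) * t powr p)"
        unfolding N2_def p_def G_def S(4) by (rule backward_tail [OF t_pos S(1)])
      also have "\<dots> \<le> ?E"
        unfolding exp_le_cancel_iff mult_minus_left neg_le_iff_le using gap by (intro mult_right_mono) auto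
      finally show ?thesis .
    qed
    define B where "B k = N2 k \<union> (\<Union>u\<in>insert 0 S. N1 (s k - t * u))" for k
    have B: "B k \<in> events" for k unfolding B_def using N1 N2 S(1) by (intro sets.Un sets.finite_UN) auto
    have Bm: "prob (B k) \<le> (1 + real m * 4) * ?E" for k
    proof -
      have "prob (B k) \<le> prob (N2 k) + prob (\<Union>u\<in>insert 0 S. N1 (s k - t * u))"
        unfolding B_def using N1 N2 S(1) by (intro measure_Un_le sets.finite_UN) auto
      also have "prob (\<Union>u\<in>insert 0 S. N1 (s k - t * u)) \<le> (\<Sum>u\<in>insert 0 S. prob (N1 (s k - t * u)))"
        using N1 S(1) by (intro finite_measure_subadditive_finite) auto
      also have "\<dots> \<le> (\<Sum>u\<in>insert 0 S. 4 * ?E)" by (intro sum_mono N1)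
      also have "\<dots> = real m * 4 * ?E" unfolding m_def by (simp only: sum_constant mult.assoc)
      finally show ?thesis using N2m [of k] by (simp add: algebra_simps)
    qed
    define N where "N = N0 \<union> (\<Union>k\<le>n. B k)"
    have N: "N \<in> events" unfolding N_def using N0 B by (intro sets.Un sets.finite_UN) auto
    have Nm: "prob N \<le> C * ?E"
    proof -
      have "prob N \<le> prob N0 + prob (\<Union>k\<le>n. B k)"
        unfolding N_def using N0 B by (intro measure_Un_le sets.finite_UN) auto
      also have "prob (\<Union>k\<le>n. B k) \<le> (\<Sum>k\<le>n. prob (B k))"
        using B by (intro finite_measure_subadditive_finite) auto
      also have "\<dots> \<le> (\<Sum>k\<le>n. (1 + real m * 4) * ?E)" by (intro sum_mono Bm)
      also have "\<dots> = real (Suc n) * (1 + real m * 4) * ?E" by (simp only: sum_constant card_atMost mult.assoc)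
      finally show ?thesis using N0m unfolding C_def distrib_right by linarith
    qed
    have "\<exists>u\<in>{0..s'}. A s' \<omega> - A (s' - u) \<omega> < u" if \<omega>: "\<omega> \<in> space M - N" and s': "t \<le> s'" for \<omega> s'
    proof (cases "L * t \<le> s'")
      case True
      \<comment> \<open>Far times fail already at \<open>u = s'\<close>, because \<open>A s'\<close>
        is at most \<open>s' / 2\<close> and \<open>A 0\<close> vanishes.\<close>
      have "\<bar>A s' \<omega>\<bar> \<le> max (L * t) s' / 2" using \<omega> s' t_pos by (intro N0) (auto simp: N_def)
      then have "\<bar>A s' \<omega>\<bar> \<le> s' / 2" using True by simp
      then show ?thesis using s' t_pos start_zero \<omega> by (intro bexI [of _ s']) auto
    next
      case False
      show ?thesis
      proof (rule ccontr)
        assume "\<not> ?thesis"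
        then have ge: "u \<le> A s' \<omega> - A (s' - u) \<omega>" if "0 \<le> u" "u \<le> s'" for u
          using that by force
        have dt: "0 < \<delta> * t" using \<delta> t_pos by simp
        define k where "k = nat \<lfloor>s' / (\<delta> * t)\<rfloor>"
        have "0 \<le> s' / (\<delta> * t)" using s' t_pos dt by simp
        then have "real k = of_int \<lfloor>s' / (\<delta> * t)\<rfloor>" unfolding k_def by (intro of_nat_nat) simp
        then have k: "real k \<le> s' / (\<delta> * t)" "s' / (\<delta> * t) \<le> real k + 1" by linarith+
        have sk: "s k \<le> s'" "s' \<le> s k + \<delta> * t"
          using k dt by (simp_all add: s_def field_simps)
        have "s' / (\<delta> * t) \<le> L / \<delta>" using False \<delta> t_pos by (simp add: field_simps)
        then have "real k \<le> L / \<delta>" using k(1) by linarith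
        then have "k \<le> n" unfolding n_def by linarith
        then have \<omega>k: "\<omega> \<in> space M - B k" using \<omega> by (auto simp: N_def)
        \<comment> \<open>The index 0 moves s' itself to the grid point, the index u moves
          \<open>s' - t * u\<close>; together they cost \<open>2 * \<eta> * t\<close>.\<close>
        have osc: "\<bar>A (s' - t * u) \<omega> - A (s k - t * u) \<omega>\<bar> \<le> \<eta> * t" if "u \<in> insert 0 S" for u
          using \<omega>k that sk by (intro N1(3)) (auto simp: B_def)
        have "(\<Sum>u\<in>S. c u * (t * u - 2 * \<eta> * t)) = (\<Sum>u\<in>S. t * (c u * u) - 2 * \<eta> * t * c u)"
          by (intro sum.cong) (auto simp: algebra_simps)
        also have "\<dots> = t * (l - 2 * \<eta> * W)"
          unfolding S(5) W_def sum_subtractf sum_distrib_left [symmetric] by (simp add: algebra_simps)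
        finally have "t * (l - 2 * \<eta> * W) = (\<Sum>u\<in>S. c u * (t * u - 2 * \<eta> * t))" by simp
        also have "\<dots> \<le> backward c S t (s k) \<omega>"
          unfolding backward_def
        proof (intro sum_mono mult_left_mono)
          fix u assume u: "u \<in> S"
          then have u1: "0 \<le> u" "u \<le> 1" using S(2) by auto
          have "t * u \<le> t * 1" "0 \<le> t * u" using u1 t_pos by (intro mult_left_mono mult_nonneg_nonneg; simp)+
          then have "t * u \<le> A s' \<omega> - A (s' - t * u) \<omega>" using s' by (intro ge) linarith+
          then show "t * u - 2 * \<eta> * t \<le> A (s k) \<omega> - A (s k - t * u) \<omega>"
            using osc [of 0] osc [of u] u by (simp add: abs_le_iff)
          show "0 \<le> c u" using S(3) u by blast
        qed
        finally have "\<omega> \<in> N2 k" using \<omega> by (simp add: N2_def)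
        then show False using \<omega>k by (simp add: B_def)
      qed
    qed
    then show ?thesis using N Nm by (intro bexI [of _ N]) auto
  qed
  show ?thesis
  proof (rule that [of C t0])
    show "0 \<le> C" by (simp add: C_def)
    show "0 < t0" using c0 by (simp add: t0_def)
  qed (use main in \<open>simp add: p_def\<close>)
qed

text \<open>Two regimes. Up to \<open>x = L * t\<close> the bound uniform in x is multiplied by
  \<open>1 + x\<^sup>2\<close>, which is at most a multiple of t squared. Above, exceeding x at any
  time violates linear growth, and the probability of that absorbs
  \<open>1 + x\<^sup>2\<close>.\<close>

lemma tail_gap_upper:
  assumes "\<theta> < opt"
  obtains C t0 where "0 \<le> C" "0 < t0"
    "\<And>t x. t0 \<le> t \<Longrightarrow> 0 < x \<Longrightarrow> tail_gap M A x t \<le> C * t\<^sup>2 * exp (- \<theta> * t powr (2 - 2 * H)) * inverse (1 + x\<^sup>2)"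
proof -
  define p where "p = 2 - 2 * H"
  have p: "0 < p" using hurst by (simp add: p_def)
  obtain C t1 where C: "0 \<le> C" "0 < t1" "\<forall>t\<ge>t1.
    \<exists>N\<in>events. prob N \<le> C * exp (- \<theta> * t powr p) \<and>
      (\<forall>\<omega>\<in>space M - N. \<forall>s\<ge>t. \<exists>u\<in>{0..s}. A s \<omega> - A (s - u) \<omega> < u)"
    by (rule no_long_busy_period [OF assms, folded p_def])
  obtain c0 S0 where c0: "0 < c0" "0 < S0" and growth: "\<forall>S\<ge>S0.
      \<exists>N\<in>events. prob N \<le> 8 * exp (- c0 * S powr p) \<and>
      (\<forall>\<omega>\<in>space M - N. \<forall>s\<ge>0. \<bar>A s \<omega>\<bar> \<le> max S s / 2)"
    by (rule linear_growth [folded p_def])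
  define \<theta>' where "\<theta>' = max \<theta> 1"
  have \<theta>': "0 < \<theta>'" "\<theta> \<le> \<theta>'" by (auto simp: \<theta>'_def)
  \<comment> \<open>The 2 splits the exponent \<open>c0 * x powr p\<close>: one half pays for
    \<open>1 + x\<^sup>2\<close>, the other for \<open>exp (- \<theta> * t powr p)\<close>.\<close>
  define L where "L = max 1 ((2 * \<theta>' / c0) powr (1 / p))"
  have L: "1 \<le> L" by (simp add: L_def)
  have "((2 * \<theta>' / c0) powr (1 / p)) powr p \<le> L powr p" using p by (intro powr_mono2) (auto simp: L_def)
  then have cL: "2 * \<theta>' \<le> c0 * L powr p" using p \<theta>' c0 by (simp add: powr_powr field_simps)
  have "\<forall>\<^sub>F x in at_top. exp (- (c0 / 2) * x powr p) * (1 + x\<^sup>2) \<le> 1"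
    using p c0 by real_asymp
  then obtain x1 where x1: "\<And>x. x1 \<le> x \<Longrightarrow> exp (- (c0 / 2) * x powr p) * (1 + x\<^sup>2) \<le> 1"
    unfolding eventually_at_top_linorder by blast
  define t0 where "t0 = Max {1, t1, S0, x1}"
  have t0: "1 \<le> t0" "t1 \<le> t0" "S0 \<le> t0" "x1 \<le> t0" by (simp_all add: t0_def)
  define D where "D = 2 * L\<^sup>2 * C + 8"
  show ?thesis
  proof (rule that [of D t0])
    show "0 \<le> D" using C by (simp add: D_def)
    show "0 < t0" using t0 by simp
    fix t x :: real assume t: "t0 \<le> t" and x: "0 < x"
    have t1: "1 \<le> t" "1 \<le> t\<^sup>2" using t t0 by simp_all
    let ?E = "exp (- \<theta> * t powr p)"
    have x2: "0 < 1 + x\<^sup>2" by (simp add: add_pos_nonneg)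
    have gap: "tail_gap M A x t = prob (late_passage x t)" using x t1 by (intro tail_gap_eq) auto
    have "prob (late_passage x t) * (1 + x\<^sup>2) \<le> D * t\<^sup>2 * ?E"
    proof (cases "x \<le> L * t")
      case True
      obtain N where N: "N \<in> events" "prob N \<le> C * ?E"
        "\<forall>\<omega>\<in>space M - N. \<forall>s\<ge>t. \<exists>u\<in>{0..s}. A s \<omega> - A (s - u) \<omega> < u"
        using C(3) t t0 by (meson order_trans)
      have "late_passage x t \<subseteq> N"
      proof
        fix \<omega> assume \<omega>: "\<omega> \<in> late_passage x t"
        then obtain s where s: "t \<le> s" "\<And>u. u \<in> {0..s} \<Longrightarrow> u \<le> A s \<omega> - A (s - u) \<omega>"
          using late_passage_backward by blast
        show "\<omega> \<in> N"
        proof (rule ccontr)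
          assume "\<omega> \<notin> N"
          then have "\<omega> \<in> space M - N" using \<omega> by (simp add: late_passage_def)
          then obtain u where "u \<in> {0..s}" "A s \<omega> - A (s - u) \<omega> < u"
            using N(3) s(1) by blast
          then show False using s(2) [of u] by simp
        qed
      qed
      then have "prob (late_passage x t) \<le> C * ?E"
        using finite_measure_mono [OF _ N(1)] N(2) by (meson order_trans)
      moreover have "1 + x\<^sup>2 \<le> 2 * L\<^sup>2 * t\<^sup>2"
      proof -
        have "x\<^sup>2 \<le> (L * t)\<^sup>2" using True x by (intro power_mono) auto
        moreover have "1 \<le> (L * t)\<^sup>2" using L t1 mult_mono [of 1 L 1 t] by (intro one_le_power) auto
        ultimately show ?thesis by (simp add: power_mult_distrib)
      qed
      ultimately have "prob (late_passage x t) * (1 + x\<^sup>2) \<le> (C * ?E) * (2 * L\<^sup>2 * t\<^sup>2)"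
        using C(1) x2 by (intro mult_mono) auto
      also have "\<dots> \<le> D * t\<^sup>2 * ?E" by (simp add: D_def algebra_simps)
      finally show ?thesis .
    next
      case False
      have Lt: "t \<le> L * t" using mult_right_mono [OF L, of t] t1 by simp
      have xx: "S0 \<le> x" "x1 \<le> x" using False Lt t t0 by linarith+
      obtain N where N: "N \<in> events" "prob N \<le> 8 * exp (- c0 * x powr p)"
        "\<forall>\<omega>\<in>space M - N. \<forall>s\<ge>0. \<bar>A s \<omega>\<bar> \<le> max x s / 2"
        using growth xx(1) by blast
      have "late_passage x t \<subseteq> N"
      proof
        fix \<omega> assume \<omega>: "\<omega> \<in> late_passage x t"
        then obtain s where s: "0 < s" "x < A s \<omega> - s" by (auto simp: late_passage_def)
        show "\<omega> \<in> N"
        proof (rule ccontr)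
          assume "\<omega> \<notin> N"
          then have "\<bar>A s \<omega>\<bar> \<le> max x s / 2" using N(3) s(1) \<omega> by (auto simp: late_passage_def)
          then show False using s x by (simp add: max_def split: if_splits)
        qed
      qed
      then have "prob (late_passage x t) \<le> 8 * exp (- c0 * x powr p)"
        using finite_measure_mono [OF _ N(1)] N(2) by (meson order_trans)
      also have "exp (- c0 * x powr p) = exp (- (c0 / 2) * x powr p) * exp (- (c0 / 2) * x powr p)"
        by (simp flip: exp_add)
      finally have "prob (late_passage x t) * (1 + x\<^sup>2) \<le>
          8 * (exp (- (c0 / 2) * x powr p) * exp (- (c0 / 2) * x powr p)) * (1 + x\<^sup>2)"
        by (rule mult_right_mono) (use x2 in simp)
      also have "\<dots> = 8 * exp (- (c0 / 2) * x powr p) * (exp (- (c0 / 2) * x powr p) * (1 + x\<^sup>2))"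
        by (simp only: mult.assoc)
      also have "\<dots> \<le> 8 * exp (- (c0 / 2) * x powr p) * 1"
        using x1 [OF xx(2)] by (intro mult_left_mono) auto
      also have "\<dots> \<le> 8 * ?E"
      proof -
        have "\<theta>' * t powr p \<le> c0 / 2 * L powr p * t powr p" using cL by (intro mult_right_mono) auto
        also have "\<dots> = c0 / 2 * (L * t) powr p" using L t1 by (simp add: powr_mult)
        also have "\<dots> \<le> c0 / 2 * x powr p"
          using False c0 p L t1 by (intro mult_left_mono powr_mono2) auto
        finally have "\<theta> * t powr p \<le> c0 / 2 * x powr p"
          using mult_right_mono [OF \<theta>'(2), of "t powr p"] by simp
        then show ?thesis by simp
      qed
      also have "\<dots> \<le> D * t\<^sup>2 * ?E"
      proof -
        have "8 * 1 \<le> D * t\<^sup>2" using C(1) t1 by (intro mult_mono) (auto simp: D_def)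
        then show ?thesis by (intro mult_right_mono) auto
      qed
      finally show ?thesis .
    qed
    then show "tail_gap M A x t \<le> D * t\<^sup>2 * exp (- \<theta> * t powr (2 - 2 * H)) * inverse (1 + x\<^sup>2)"
      unfolding gap p_def [symmetric] divide_inverse [symmetric] pos_le_divide_eq [OF x2] .
  qed
qed

end

section \<open>The lower bound\<close>

context fractional_brownian_motion
begin

text \<open>A near-maximizer of the dual problem almost satisfies the primal constraints with almost
  minimal energy. Unlike the minimizer itself it is a finite combination by construction, so that
  tilting by it stays within \<open>lin\<close>.\<close>

lemma near_optimal_path:
  assumes \<epsilon>: "0 < \<epsilon>" "\<epsilon> \<le> 1"
  obtains S c where "finite S" "\<forall>r\<in>{0..1}. r - \<epsilon> \<le> kernel_comb (fbm_cov H) S c r"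
    "span_inner (fbm_cov H) (kernel_comb (fbm_cov H) S c) (kernel_comb (fbm_cov H) S c) / 2 \<le> opt + \<epsilon>"
proof -
  let ?K = "fbm_cov H"
  \<comment> \<open>Chosen so that the last error term of \<open>near_optimal_norm\<close> is at
    most \<open>\<epsilon> / 4\<close> once \<open>4 * D \<le> 2\<close>.\<close>
  define \<mu> where "\<mu> = \<epsilon> / (4 * (2 + 2 * opt))"
  have \<mu>: "0 < \<mu>" "\<mu> * (2 + 2 * opt) = \<epsilon> / 4" "\<mu> \<le> 1"
    using \<epsilon> opt_nonneg by (simp_all add: \<mu>_def field_simps)
  \<comment> \<open>The first entry serves feasibility, tested with the multiplier \<epsilon>; the
    second bounds both D and \<open>D / \<mu>\<close> by \<open>\<epsilon> / 4\<close>.\<close>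
  define D where "D = min (\<epsilon>\<^sup>2 / 2) (\<epsilon> * \<mu> / 4)"
  have D: "0 < D" "D \<le> \<epsilon>\<^sup>2 / 2" "D \<le> \<epsilon> * \<mu> / 4" using \<epsilon> \<mu> by (auto simp: D_def)
  obtain g l where gl: "(g, l) \<in> dual_cone ?K {0..1} (\<lambda>r. r)" and J: "opt - D \<le> l - span_inner ?K g g / 2"
    using dual.dual_sup_approx [OF D(1)] unfolding opt_def by blast
  obtain S c where S: "finite S" "S \<subseteq> {0..1}" "\<forall>s\<in>S. 0 \<le> c s" "g = kernel_comb ?K S c"
    "l = (\<Sum>s\<in>S. c s * s)"
    using gl by (rule dual_coneE)
  show ?thesis
  proof (rule that [of S c, folded S(4)])
    show "finite S" by fact
    show "\<forall>r\<in>{0..1}. r - \<epsilon> \<le> g r"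
    proof
      fix r :: real assume r: "r \<in> {0..1}"
      have "?K r r \<le> 1"
        using r hurst powr_mono2 [of "2 * H" r 1] by (simp add: fbm_cov_def)
      then have K1: "\<epsilon>\<^sup>2 * ?K r r \<le> \<epsilon>\<^sup>2 * 1" by (intro mult_left_mono) auto
      have "\<epsilon> * (r - g r) \<le> D + \<epsilon>\<^sup>2 * ?K r r / 2"
        using dual.near_optimal_feasible [OF gl J [unfolded opt_def] r] \<epsilon> by simp
      then have "\<epsilon> * (r - g r) \<le> \<epsilon> * \<epsilon>" using D(2) K1 unfolding power2_eq_square by linarith
      then have "r - g r \<le> \<epsilon>" using \<epsilon>(1) mult_le_cancel_left_pos by blast
      then show "r - \<epsilon> \<le> g r" by linarith
    qed
    have "\<bar>span_inner ?K g g / 2 - opt\<bar> \<le> D + D / \<mu> + \<mu> * (4 * D + 2 * opt)"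
      unfolding opt_def
      using dual.near_optimal_norm(2) [OF gl J [unfolded opt_def] less_imp_le [OF D(1)] \<mu>(1,3)] .
    moreover have "\<mu> * (4 * D + 2 * opt) \<le> \<mu> * (2 + 2 * opt)"
    proof -
      have "\<epsilon>\<^sup>2 \<le> 1" using \<epsilon> by (simp add: power_le_one)
      then show ?thesis using D(2) \<mu>(1) by (intro mult_left_mono) auto
    qed
    moreover have "D / \<mu> \<le> \<epsilon> / 4" using D(3) \<mu>(1) by (simp add: field_simps)
    moreover have "D \<le> \<epsilon> / 4"
    proof -
      have "\<epsilon> * \<mu> \<le> \<epsilon> * 1" using \<epsilon> \<mu> by (intro mult_left_mono) auto
      then show ?thesis using D(3) by linarith
    qed
    ultimately show "span_inner ?K g g / 2 \<le> opt + \<epsilon>" using \<mu>(2) \<epsilon> by linarith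
  qed
qed

text \<open>Seen backwards from \<open>T = (1 + \<delta>) t\<close>, the mean path of the tilted process dominates the
  line of slope \<open>1 + \<delta>\<close> up to \<open>\<kappa> = \<delta>\<^sup>2/16\<close>. This leaves a window of levels that are
  passed at time \<open>T\<close>, but not before time \<open>t = T - \<delta> t\<close>.\<close>

lemma late_passage_of_close_path:
  assumes \<omega>: "\<omega> \<in> space M" and \<delta>: "0 < \<delta>" "\<delta> \<le> 1" and t: "0 < t"
    and T: "T = (1 + \<delta>) * t" and \<kappa>: "\<kappa> = \<delta>\<^sup>2 / 16"
    and g: "\<And>v. v \<in> {0..1} \<Longrightarrow> v - \<kappa> \<le> g v" and g0: "g 0 = 0"
    and close: "\<And>v. v \<in> {0..1} \<Longrightarrow>
      \<bar>A (T - T * v) \<omega> - ((1 + \<delta>) * T * g 1 - (1 + \<delta>) * T * g v)\<bar> \<le> \<kappa> * T"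
    and x: "(1 + \<delta>) * T * g 1 - T - 4 * \<kappa> * T \<le> x" "x \<le> (1 + \<delta>) * T * g 1 - T - 2 * \<kappa> * T"
  shows "\<omega> \<in> late_passage x t"
proof -
  have T0: "0 < T" using \<delta> t T by simp
  have \<kappa>0: "0 < \<kappa>" "\<delta> * (\<delta> / 2) = 8 * \<kappa>" using \<delta> by (simp_all add: \<kappa> power2_eq_square)
  have \<kappa>T: "0 < \<kappa> * T" using \<kappa>0 T0 by simp
  let ?m = "\<lambda>v. (1 + \<delta>) * T * g v"
  have "x < A T \<omega> - T" using close [of 0] g0 x(2) \<kappa>T by (simp add: abs_le_iff)
  moreover have "A r \<omega> - r \<le> x" if r: "r \<in> {0..t}" for r
  proof -
    define v where "v = 1 - r / T"
    have rv: "r = T - T * v" using T0 by (simp add: v_def field_simps)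
    \<comment> \<open>Times up to t lie at least \<open>T * (\<delta> / 2)\<close> before T, because
      \<open>(1 + \<delta>) * (1 - \<delta> / 2)\<close> is at least 1.\<close>
    have tT: "t \<le> T * (1 - \<delta> / 2)"
    proof -
      have "0 \<le> t * (\<delta> * (1 - \<delta>)) / 2" using \<delta> t by simp
      then show ?thesis unfolding T by (simp add: field_simps power2_eq_square)
    qed
    then have "T * (\<delta> / 2) \<le> T * v" using r rv by (simp add: algebra_simps)
    then have v1: "\<delta> / 2 \<le> v" using T0 by (simp only: mult_le_cancel_left_pos)
    have v2: "v \<le> 1" using r T0 by (simp add: v_def)
    have v: "v \<in> {0..1}" using v1 v2 \<delta> by simp
    have "(1 + \<delta>) * T * (v - \<kappa>) \<le> ?m v" using g [OF v] \<delta> T0 by (intro mult_left_mono) auto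
    moreover have "\<delta> * (\<delta> / 2) * T \<le> \<delta> * v * T" using v1 \<delta> T0 by (intro mult_right_mono mult_left_mono) auto
    moreover have "\<delta> * (\<kappa> * T) \<le> 1 * (\<kappa> * T)" using \<delta> \<kappa>T by (intro mult_right_mono) auto
    \<comment> \<open>The extra slope gains at least \<open>8 * \<kappa> * T\<close> from backward
      distance \<delta> / 2 on, and the tolerance in g costs at most
      \<open>2 * \<kappa> * T\<close>. With one more \<open>\<kappa> * T\<close> of fluctuation, up
      to time t the path stays below the window for x; at T it is still above.\<close>
    ultimately have "T * v - ?m v \<le> - 6 * (\<kappa> * T)" unfolding \<kappa>0(2) by (simp add: algebra_simps)
    moreover have "A r \<omega> \<le> ?m 1 - ?m v + \<kappa> * T" using close [OF v] unfolding rv by linarith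
    ultimately show ?thesis using x(1) \<kappa>T rv by linarith
  qed
  ultimately show ?thesis using \<omega> T0 unfolding late_passage_def by blast
qed

lemma tail_gap_lower:
  assumes "opt < \<theta>"
  obtains b t0 where "0 < b" "0 < t0" "\<forall>t\<ge>t0. \<exists>x0>0. \<forall>x\<in>{x0..x0 + b}.
    exp (- \<theta> * t powr (2 - 2 * H)) / 2 \<le> tail_gap M A x t"
proof -
  define p where "p = 2 - 2 * H"
  have p: "0 < p" using hurst by (simp add: p_def)
  \<comment> \<open>Three losses: the energy of a path of slope \<open>1 + \<delta>\<close>, the
    fluctuation of the tilting variable, and the later time \<open>T = (1 + \<delta>) * t\<close>.
    Together they tend to \<open>opt\<close> as \<delta> tends to 0.\<close>
  have "((\<lambda>\<delta>. ((1 + \<delta>)\<^sup>2 * (opt + \<delta>) + (1 + \<delta>) * \<delta>) * (1 + \<delta>) powr p) \<longlongrightarrow>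
      ((1 + 0)\<^sup>2 * (opt + 0) + (1 + 0) * 0) * (1 + 0) powr p) (at_right 0)"
    by (intro tendsto_intros) auto
  then have "\<forall>\<^sub>F \<delta> in at_right 0. ((1 + \<delta>)\<^sup>2 * (opt + \<delta>) + (1 + \<delta>) * \<delta>) * (1 + \<delta>) powr p < \<theta>"
    using assms by (intro order_tendstoD(2)) auto
  moreover have "\<forall>\<^sub>F \<delta> in at_right (0::real). \<delta> \<in> {0<..<1}"
    by (rule eventually_at_right_real) simp
  ultimately have "\<forall>\<^sub>F \<delta> in at_right 0. ((1 + \<delta>)\<^sup>2 * (opt + \<delta>) + (1 + \<delta>) * \<delta>) * (1 + \<delta>) powr p < \<theta> \<and>
      \<delta> \<in> {0<..<1}" by (rule eventually_conj)
  then obtain \<delta> where \<delta>\<theta>: "((1 + \<delta>)\<^sup>2 * (opt + \<delta>) + (1 + \<delta>) * \<delta>) * (1 + \<delta>) powr p < \<theta>"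
    and \<delta>: "0 < \<delta>" "\<delta> \<le> 1"
    using eventually_happens [of _ "at_right (0::real)"] by force
  define \<kappa> where "\<kappa> = \<delta>\<^sup>2 / 16"
  have d2: "\<delta>\<^sup>2 \<le> \<delta>" using \<delta> by (simp add: power2_eq_square)
  have \<kappa>: "0 < \<kappa>" "\<kappa> \<le> 1" "\<kappa> \<le> \<delta> / 16" using \<delta> d2 by (simp_all add: \<kappa>_def)
  obtain S c where S: "finite S" and feas: "\<forall>r\<in>{0..1}. r - \<kappa> \<le> kernel_comb (fbm_cov H) S c r"
    and Gle: "span_inner (fbm_cov H) (kernel_comb (fbm_cov H) S c) (kernel_comb (fbm_cov H) S c) / 2 \<le> opt + \<kappa>"
    using near_optimal_path [OF \<kappa>(1,2)] by blast
  define g where "g = kernel_comb (fbm_cov H) S c"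
  define G where "G = span_inner (fbm_cov H) g g"
  have G: "0 \<le> G" "G / 2 \<le> opt + \<delta>"
    using span_inner_nonneg [OF psd_fbm_cov, of g] S Gle \<kappa> \<delta> by (auto simp: G_def g_def kernel_span_def)
  have g0: "g 0 = 0" by (simp add: g_def kernel_comb_def fbm_cov_def)
  define a where "a = chaining_const H * \<kappa>\<^sup>2"
  have a: "0 < a" using chaining_const_pos [OF hurst(1)] \<kappa> by (simp add: a_def)
  \<comment> \<open>Exponent, in units of \<open>T powr p\<close>, of the deviation z chosen below;
    \<open>G + 1\<close> keeps the variance bound positive when \<open>G = 0\<close>.\<close>
  define d where "d = \<delta>\<^sup>2 / (2 * (G + 1))"
  have d: "0 < d" using \<delta> G by (simp add: d_def)
  \<comment> \<open>Via \<open>exp (- y) \<le> 1 / (1 + y)\<close>, the 15 and the 7 make each of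
    the two exceptional events have tilted probability at most 1/4, after the factors 4 and
    2.\<close>
  have "\<forall>\<^sub>F t in at_top. 2 \<le> a * t powr p * H \<and> 15 \<le> a * t powr p \<and> 7 \<le> d * t powr p \<and> 1 \<le> t"
    using a d p hurst by (intro eventually_conj; real_asymp)
  then obtain t1 where t1: "\<And>t. t1 \<le> t \<Longrightarrow> 2 \<le> a * t powr p * H \<and> 15 \<le> a * t powr p \<and> 7 \<le> d * t powr p \<and> 1 \<le> t"
    unfolding eventually_at_top_linorder by blast
  have main: "\<exists>x0>0. \<forall>x\<in>{x0..x0 + 2 * \<kappa>}. exp (- \<theta> * t powr p) / 2 \<le> tail_gap M A x t" if t: "max 1 t1 \<le> t" for t
  proof -
    have t_pos: "0 < t" using t by simp
    define T where "T = (1 + \<delta>) * t"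
    have tT: "t \<le> T" using \<delta> t_pos by (simp add: T_def)
    have T: "0 < T" "1 \<le> T" using t tT by simp_all
    have big: "2 \<le> a * T powr p * H" "15 \<le> a * T powr p" "7 \<le> d * T powr p"
      using t1 [of T] t tT by auto
    \<comment> \<open>Normalized so that the tilt moves the mean of
      \<open>A T - A (T - T * v)\<close> to \<open>(1 + \<delta>) * T * g v\<close>.\<close>
    define X where "X = (\<lambda>\<omega>. (1 + \<delta>) * T powr (1 - 2 * H) * backward c S T T \<omega>)"
    have X: "X \<in> lin" unfolding X_def by (intro lin_scale backward_lin)
    interpret Q: prob_space "tilt X" by (rule prob_space_tilt [OF X])
    have pw: "T powr (1 - 2 * H) * T powr (2 * H) = T"
      "T powr (1 - 2 * H) * T = T powr p"
      using T by (simp_all add: p_def powr_mult_base mult.commute flip: powr_add)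
    have covX: "cov X X = (1 + \<delta>)\<^sup>2 * G * T powr p"
    proof -
      have "cov X X = (1 + \<delta>) * (1 + \<delta>) * G * (T powr (1 - 2 * H) * (T powr (1 - 2 * H) * T powr (2 * H)))"
        using T S by (simp add: X_def cov_backward G_def g_def)
      then show ?thesis unfolding pw by (simp add: power2_eq_square)
    qed
    have covA: "cov X (\<lambda>\<omega>. A T \<omega> - A (T - T * v) \<omega>) = (1 + \<delta>) * T * g v" for v
    proof -
      have "cov X (\<lambda>\<omega>. A T \<omega> - A (T - T * v) \<omega>) = (1 + \<delta>) * (T powr (1 - 2 * H) * T powr (2 * H)) * g v"
        using T by (simp add: X_def cov_backward_increment g_def)
      then show ?thesis unfolding pw .
    qed
    have mean: "cov X (A (T - T * v)) - cov X (A 0) = (1 + \<delta>) * T * g 1 - (1 + \<delta>) * T * g v" for v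
      using covA [of v] covA [of 1] by (simp add: cov_diff_right X)
    have a_eq: "chaining_const H * (\<kappa> * T)\<^sup>2 / T powr (2 * H) = a * T powr p"
      using T by (simp add: a_def p_def powr_diff powr_numeral power_mult_distrib)
    obtain N where N: "N \<in> events" "measure (tilt X) N \<le> 4 * exp (- (a * T powr p))"
      "\<And>\<omega> s. \<omega> \<in> space M - N \<Longrightarrow> s \<in> {0..0 + T} \<Longrightarrow>
        \<bar>(A s \<omega> - cov X (A s)) - (A 0 \<omega> - cov X (A 0))\<bar> \<le> \<kappa> * T"
      using tilt_oscillation [OF X T(1), of "\<kappa> * T" 0, unfolded a_eq] \<kappa> T big by auto
    \<comment> \<open>Under the tilt X has mean \<open>cov X X\<close> and a standard deviation of
      order at most \<open>T powr (p / 2)\<close>, so a deviation of order \<open>T powr p\<close>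
      is unlikely. Excluding it caps the density of the tilted measure.\<close>
    define z where "z = (1 + \<delta>) * \<delta> * T powr p"
    define N' where "N' = {\<omega> \<in> space M. z \<le> \<bar>X \<omega> - cov X X\<bar>}"
    have [measurable]: "X \<in> borel_measurable M" using X by (rule lin_measurable)
    have N': "N' \<in> events" unfolding N'_def by measurable
    have small: "exp (- y) \<le> 1 / (1 + y)" if "0 \<le> y" for y :: real
      using exp_ge_add_one_self [of y] that by (simp add: exp_minus field_simps)
    have "measure (tilt X) N \<le> 1 / 4"
    proof -
      have "exp (- (a * T powr p)) \<le> 1 / (1 + a * T powr p)" using big by (intro small) simp
      also have "\<dots> \<le> 1 / 16" using big by (intro divide_left_mono) auto
      finally show ?thesis using N(2) by simp
    qed
    moreover have "measure (tilt X) N' \<le> 1 / 4"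
    proof -
      let ?v = "(1 + \<delta>)\<^sup>2 * (G + 1) * T powr p"
      have v: "0 < ?v" using \<delta> G T by simp
      have "measure (tilt X) N' \<le> 2 * exp (- z\<^sup>2 / (2 * ?v))"
        unfolding N'_def
      proof (rule tilt_gaussian_tail [OF X X v])
        show "cov X X \<le> ?v" unfolding covX by (intro mult_right_mono mult_left_mono) auto
        show "0 \<le> z" using \<delta> by (simp add: z_def)
      qed
      also have "z\<^sup>2 / (2 * ?v) = d * T powr p"
        using \<delta> G T by (simp add: z_def d_def power_mult_distrib power2_eq_square)
      then have "- z\<^sup>2 / (2 * ?v) = - (d * T powr p)" by simp
      also have "exp (- (d * T powr p)) \<le> 1 / (1 + d * T powr p)" using big by (intro small) simp
      also have "\<dots> \<le> 1 / 8" using big by (intro divide_left_mono) auto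
      finally show ?thesis by simp
    qed
    moreover have "measure (tilt X) (N \<union> N') \<le> measure (tilt X) N + measure (tilt X) N'"
      using N N' by (intro measure_Un_le) auto
    moreover have "measure (tilt X) (space M - (N \<union> N')) = 1 - measure (tilt X) (N \<union> N')"
      using Q.prob_compl [of "N \<union> N'"] N N' by simp
    ultimately have half: "1 / 2 \<le> measure (tilt X) (space M - (N \<union> N'))" by linarith
    have "exp (- \<theta> * t powr p) * (1 / 2) \<le>
        exp (cov X X / 2 - (cov X X + z)) * measure (tilt X) (space M - (N \<union> N'))"
    proof (intro mult_mono half)
      have Tp: "T powr p = (1 + \<delta>) powr p * t powr p" using \<delta> t_pos by (simp add: T_def powr_mult)
      have "cov X X / 2 + z = ((1 + \<delta>)\<^sup>2 * (G / 2) + (1 + \<delta>) * \<delta>) * (1 + \<delta>) powr p * t powr p"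
        unfolding covX z_def Tp by (simp add: algebra_simps)
      also have "\<dots> \<le> ((1 + \<delta>)\<^sup>2 * (opt + \<delta>) + (1 + \<delta>) * \<delta>) * (1 + \<delta>) powr p * t powr p"
        using G by (intro mult_right_mono add_right_mono mult_left_mono) auto
      also have "\<dots> \<le> \<theta> * t powr p" using \<delta>\<theta> by (intro mult_right_mono) auto
      finally show "exp (- \<theta> * t powr p) \<le> exp (cov X X / 2 - (cov X X + z))" by simp
    qed auto
    also have "\<dots> \<le> prob (space M - (N \<union> N'))"
      using N N' by (intro prob_ge_tilt X) (auto simp: N'_def)
    finally have low: "exp (- \<theta> * t powr p) / 2 \<le> prob (space M - (N \<union> N'))" by simp
    define x0 where "x0 = (1 + \<delta>) * T * g 1 - T - 4 * \<kappa> * T"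
    \<comment> \<open>The surplus \<open>\<delta> * T\<close>, at least
      \<open>16 * \<kappa> * T\<close>, outweighs the losses of at most
      \<open>6 * \<kappa> * T\<close>.\<close>
    have "0 < x0"
    proof -
      have "1 - \<kappa> \<le> g 1" using feas by (simp add: g_def)
      then have "(1 + \<delta>) * T * (1 - \<kappa>) \<le> (1 + \<delta>) * T * g 1" using \<delta> T by (intro mult_left_mono) auto
      moreover have "\<delta> * (\<kappa> * T) \<le> 1 * (\<kappa> * T)" using \<delta> \<kappa> T by (intro mult_right_mono) auto
      moreover have "16 * \<kappa> * T \<le> \<delta> * T" using \<kappa> T by (intro mult_right_mono) auto
      moreover have "0 < \<kappa> * T" using \<kappa> T by simp
      ultimately show ?thesis unfolding x0_def by (simp add: algebra_simps)
    qed
    moreover have "exp (- \<theta> * t powr p) / 2 \<le> tail_gap M A x t" if x: "x \<in> {x0..x0 + 2 * \<kappa>}" for x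
    proof -
      have "space M - (N \<union> N') \<subseteq> late_passage x t"
      proof
        fix \<omega> assume \<omega>: "\<omega> \<in> space M - (N \<union> N')"
        show "\<omega> \<in> late_passage x t"
        proof (rule late_passage_of_close_path [where g = g, OF _ \<delta> t_pos T_def \<kappa>_def _ g0])
          fix v :: real assume v: "v \<in> {0..1}"
          show "v - \<kappa> \<le> g v" using feas v by (simp add: g_def)
          have "T * v \<le> T * 1" using v T by (intro mult_left_mono) auto
          then have "T - T * v \<in> {0..0 + T}" using v T by simp
          then have "\<bar>(A (T - T * v) \<omega> - cov X (A (T - T * v))) - (A 0 \<omega> - cov X (A 0))\<bar> \<le> \<kappa> * T"
            using \<omega> by (intro N(3)) auto
          moreover have "A 0 \<omega> = 0" using start_zero \<omega> by blast
          ultimately show "\<bar>A (T - T * v) \<omega> - ((1 + \<delta>) * T * g 1 - (1 + \<delta>) * T * g v)\<bar> \<le> \<kappa> * T"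
            unfolding mean [symmetric] by (simp add: algebra_simps)
        next
          \<comment> \<open>The window has length \<open>2 * \<kappa> * T\<close>; since
            \<open>T \<ge> 1\<close>, it contains one of the length \<open>2 * \<kappa>\<close>,
            independent of t.\<close>
          have "\<kappa> * 1 \<le> \<kappa> * T" using \<kappa> T by (intro mult_left_mono) auto
          then show "x \<le> (1 + \<delta>) * T * g 1 - T - 2 * \<kappa> * T" using x by (simp add: x0_def)
        qed (use \<omega> x in \<open>auto simp: x0_def\<close>)
      qed
      then have "prob (space M - (N \<union> N')) \<le> prob (late_passage x t)"
        by (intro finite_measure_mono late_passage_event t_pos)
      moreover have "tail_gap M A x t = prob (late_passage x t)"
        using x \<open>0 < x0\<close> t_pos by (intro tail_gap_eq) auto
      ultimately show ?thesis using low by simp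
    qed
    ultimately show ?thesis by blast
  qed
  show ?thesis
  proof (rule that [of "2 * \<kappa>" "max 1 t1"])
    show "\<forall>t\<ge>max 1 t1. \<exists>x0>0. \<forall>x\<in>{x0..x0 + 2 * \<kappa>}. exp (- \<theta> * t powr (2 - 2 * H)) / 2 \<le> tail_gap M A x t"
      using main unfolding p_def by blast
  qed (use \<kappa> in auto)
qed

end

section \<open>The logarithmic limits\<close>

text \<open>The prefactors b and \<open>C * t\<^sup>2\<close> vanish after taking the logarithm and
  dividing by \<open>t powr p\<close>.\<close>

lemma ln_rate_limit:
  fixes f :: "real \<Rightarrow> real" and p V :: real
  assumes p: "0 < p"
    and upper: "\<And>\<theta>. \<theta> < V \<Longrightarrow> \<exists>C. \<forall>\<^sub>F t in at_top. f t \<le> C * t\<^sup>2 * exp (- \<theta> * t powr p)"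
    and lower: "\<And>\<theta>. V < \<theta> \<Longrightarrow> \<exists>b>0. \<forall>\<^sub>F t in at_top. b * exp (- \<theta> * t powr p) \<le> f t"
  shows "((\<lambda>t. 1 / t powr p * ln (f t)) \<longlongrightarrow> - V) at_top"
proof (rule order_tendstoI)
  fix a assume "a < - V"
  define \<theta> where "\<theta> = (V - a) / 2"
  have \<theta>: "V < \<theta>" "\<theta> < - a" using \<open>a < - V\<close> by (auto simp: \<theta>_def)
  obtain b where b: "0 < b" "\<forall>\<^sub>F t in at_top. b * exp (- \<theta> * t powr p) \<le> f t" using lower [OF \<theta>(1)] by blast
  have "\<forall>\<^sub>F t in at_top. a < 1 / t powr p * (ln b - \<theta> * t powr p)"
  proof (rule order_tendstoD(1))
    show "((\<lambda>t. 1 / t powr p * (ln b - \<theta> * t powr p)) \<longlongrightarrow> - \<theta>) at_top" using p by real_asymp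
  qed (use \<theta> in simp)
  with b(2) show "\<forall>\<^sub>F t in at_top. a < 1 / t powr p * ln (f t)"
  proof eventually_elim
    case (elim t)
    have "ln b - \<theta> * t powr p = ln (b * exp (- \<theta> * t powr p))" using b(1) by (simp add: ln_mult)
    also have "\<dots> \<le> ln (f t)" using elim(1) b(1) by (intro ln_mono) auto
    finally have "1 / t powr p * (ln b - \<theta> * t powr p) \<le> 1 / t powr p * ln (f t)"
      by (intro mult_left_mono) auto
    then show ?case using elim(2) by linarith
  qed
next
  fix a assume "- V < a"
  define \<theta> where "\<theta> = (V - a) / 2"
  have \<theta>: "\<theta> < V" "- \<theta> < a" using \<open>- V < a\<close> by (auto simp: \<theta>_def field_simps)
  obtain C where C: "\<forall>\<^sub>F t in at_top. f t \<le> C * t\<^sup>2 * exp (- \<theta> * t powr p)" using upper [OF \<theta>(1)] by blast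
  \<comment> \<open>Here the lower bound supplies \<open>0 < f t\<close>, which the monotonicity of
    \<open>ln\<close> requires; V + 1 is an arbitrary rate above V.\<close>
  obtain b where b: "0 < b" "\<forall>\<^sub>F t in at_top. b * exp (- (V + 1) * t powr p) \<le> f t" using lower [of "V + 1"] by auto
  have "\<forall>\<^sub>F t in at_top. 1 / t powr p * (ln (max C 1) + 2 * ln t - \<theta> * t powr p) < a"
  proof (rule order_tendstoD(2))
    show "((\<lambda>t. 1 / t powr p * (ln (max C 1) + 2 * ln t - \<theta> * t powr p)) \<longlongrightarrow> - \<theta>) at_top"
      using p by real_asymp
  qed (use \<theta> in simp)
  with b(2) C eventually_gt_at_top [of 0] show "\<forall>\<^sub>F t in at_top. 1 / t powr p * ln (f t) < a"
  proof eventually_elim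
    case (elim t)
    have "0 < b * exp (- (V + 1) * t powr p)" using b(1) by simp
    then have pos: "0 < f t" using elim(1) by linarith
    have "C * (t\<^sup>2 * exp (- \<theta> * t powr p)) \<le> max C 1 * (t\<^sup>2 * exp (- \<theta> * t powr p))"
      by (intro mult_right_mono) auto
    then have "f t \<le> max C 1 * t\<^sup>2 * exp (- \<theta> * t powr p)" using elim(2) by (simp only: mult.assoc)
    then have "ln (f t) \<le> ln (max C 1 * t\<^sup>2 * exp (- \<theta> * t powr p))" using pos by (intro ln_mono) auto
    moreover have mx: "max C 1 \<noteq> 0" by (simp add: max_def)
    have "ln (max C 1 * t\<^sup>2 * exp (- \<theta> * t powr p)) = ln (max C 1) + 2 * ln t - \<theta> * t powr p"
      using elim(3) mx by (simp add: ln_mult ln_realpow)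
    ultimately have "1 / t powr p * ln (f t) \<le> 1 / t powr p * (ln (max C 1) + 2 * ln t - \<theta> * t powr p)"
      by (intro mult_left_mono) auto
    then show ?case using elim(4) by linarith
  qed
qed

lemma set_integrable_inverse_1_plus_square: "set_integrable lborel {0<..} (\<lambda>x::real. inverse (1 + x\<^sup>2))"
proof (rule set_integrable_subset)
  show "set_integrable lborel (einterval (-\<infinity>) \<infinity>) (\<lambda>x::real. inverse (1 + x\<^sup>2))"
    by (rule integrable_inverse_1_plus_square)
qed (auto simp: einterval_def)

context fractional_brownian_motion
begin

section \<open>From the tail gap to the two distances\<close>

lemma tail_gap_le_1: "0 < x \<Longrightarrow> 0 < t \<Longrightarrow> tail_gap M A x t \<le> 1"
  by (simp add: tail_gap_eq)

lemma tail_gap_nonneg: "0 < x \<Longrightarrow> 0 < t \<Longrightarrow> 0 \<le> tail_gap M A x t"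
  by (simp add: tail_gap_eq)

text \<open>A real \<open>SUP\<close> is informative only for a set bounded above; the bound 1
  provides this.\<close>

lemma tail_gap_le_KS: "0 < x \<Longrightarrow> 0 < t \<Longrightarrow> tail_gap M A x t \<le> KS_distance M A t"
  unfolding KS_distance_def using tail_gap_le_1 by (intro cSUP_upper bdd_aboveI2 [where M = 1]) auto

lemma KS_distance_upper:
  assumes "\<theta> < opt"
  shows "\<exists>C. \<forall>\<^sub>F t in at_top. KS_distance M A t \<le> C * t\<^sup>2 * exp (- \<theta> * t powr (2 - 2 * H))"
proof -
  obtain C t0 where C: "0 \<le> C" "0 < t0" "\<And>t x. t0 \<le> t \<Longrightarrow> 0 < x \<Longrightarrow>
      tail_gap M A x t \<le> C * t\<^sup>2 * exp (- \<theta> * t powr (2 - 2 * H)) * inverse (1 + x\<^sup>2)"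
    using tail_gap_upper [OF assms] by metis
  have "KS_distance M A t \<le> C * t\<^sup>2 * exp (- \<theta> * t powr (2 - 2 * H))" if t: "t0 \<le> t" for t
    unfolding KS_distance_def
  proof (rule cSUP_least)
    fix x :: real assume x: "x \<in> {0<..}"
    have "inverse (1 + x\<^sup>2) \<le> 1" by (rule inverse_le_1_iff [THEN iffD2]) simp
    then have "C * t\<^sup>2 * exp (- \<theta> * t powr (2 - 2 * H)) * inverse (1 + x\<^sup>2) \<le>
        C * t\<^sup>2 * exp (- \<theta> * t powr (2 - 2 * H)) * 1" using C(1) by (intro mult_left_mono) auto
    then show "tail_gap M A x t \<le> C * t\<^sup>2 * exp (- \<theta> * t powr (2 - 2 * H))"
      using C(3) [OF t, of x] x by simp
  qed simp
  then show ?thesis unfolding eventually_at_top_linorder by blast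
qed

lemma KS_distance_lower:
  assumes "opt < \<theta>"
  shows "\<exists>b>0. \<forall>\<^sub>F t in at_top. b * exp (- \<theta> * t powr (2 - 2 * H)) \<le> KS_distance M A t"
proof -
  obtain b t0 where b: "0 < b" "0 < t0" "\<forall>t\<ge>t0. \<exists>x0>0. \<forall>x\<in>{x0..x0 + b}.
    exp (- \<theta> * t powr (2 - 2 * H)) / 2 \<le> tail_gap M A x t"
    using assms by (rule tail_gap_lower)
  have "1 / 2 * exp (- \<theta> * t powr (2 - 2 * H)) \<le> KS_distance M A t" if t: "t0 \<le> t" for t
  proof -
    obtain x0 where x0: "0 < x0" "\<forall>x\<in>{x0..x0 + b}. exp (- \<theta> * t powr (2 - 2 * H)) / 2 \<le> tail_gap M A x t"
      using b(3) t by blast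
    then have "exp (- \<theta> * t powr (2 - 2 * H)) / 2 \<le> tail_gap M A x0 t" using b(1) by simp
    also have "\<dots> \<le> KS_distance M A t" using t b x0 by (intro tail_gap_le_KS) auto
    finally show ?thesis by simp
  qed
  then have "\<forall>\<^sub>F t in at_top. 1 / 2 * exp (- \<theta> * t powr (2 - 2 * H)) \<le> KS_distance M A t"
    unfolding eventually_at_top_linorder by blast
  then show ?thesis by (intro exI [of _ "1 / 2"] conjI) simp_all
qed

text \<open>The Bochner integral of a nonintegrable function is 0 by convention, so a lower bound on
  the integral, too, depends on integrability.\<close>

lemma tail_gap_integrable:
  assumes t: "0 < t" and C: "\<And>x. 0 < x \<Longrightarrow> tail_gap M A x t \<le> C * inverse (1 + x\<^sup>2)"
  shows "set_integrable lborel {0<..} (\<lambda>x. tail_gap M A x t)"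
proof -
  have [measurable]: "(\<lambda>x. tail_gap M A x t) \<in> borel_measurable borel" by (rule tail_gap_measurable [OF t])
  have "set_integrable lborel {0<..} (\<lambda>x. C * inverse (1 + x\<^sup>2))"
    by (intro set_integrable_mult_right set_integrable_inverse_1_plus_square)
  then show ?thesis
    unfolding set_integrable_def
  proof (rule Bochner_Integration.integrable_bound)
    show "AE x in lborel. norm (indicat_real {0<..} x *\<^sub>R tail_gap M A x t)
        \<le> norm (indicat_real {0<..} x *\<^sub>R (C * inverse (1 + x\<^sup>2)))"
      using C tail_gap_nonneg [OF _ t] by (intro AE_I2) (force simp: indicator_def)
  qed measurable
qed

lemma integral_distance_upper:
  assumes "\<theta> < opt"
  shows "\<exists>C. \<forall>\<^sub>F t in at_top. integral_distance M A t \<le> C * t\<^sup>2 * exp (- \<theta> * t powr (2 - 2 * H))"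
proof -
  obtain C t0 where C: "0 \<le> C" "0 < t0" "\<And>t x. t0 \<le> t \<Longrightarrow> 0 < x \<Longrightarrow>
      tail_gap M A x t \<le> C * t\<^sup>2 * exp (- \<theta> * t powr (2 - 2 * H)) * inverse (1 + x\<^sup>2)"
    using tail_gap_upper [OF assms] by metis
  define I where "I = (LINT x:{0<..}|lborel. inverse (1 + x\<^sup>2 :: real))"
  have "integral_distance M A t \<le> C * I * t\<^sup>2 * exp (- \<theta> * t powr (2 - 2 * H))" if t: "t0 \<le> t" for t
  proof -
    have t_pos: "0 < t" using t C by simp
    let ?c = "C * t\<^sup>2 * exp (- \<theta> * t powr (2 - 2 * H))"
    have "integral_distance M A t \<le> (LINT x:{0<..}|lborel. ?c * inverse (1 + x\<^sup>2))"
      unfolding integral_distance_def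
    proof (rule set_integral_mono)
      show "set_integrable lborel {0<..} (\<lambda>x. tail_gap M A x t)"
        using C(3) [OF t] by (rule tail_gap_integrable [OF t_pos])
      show "set_integrable lborel {0<..} (\<lambda>x. ?c * inverse (1 + x\<^sup>2))"
        by (intro set_integrable_mult_right set_integrable_inverse_1_plus_square)
      show "tail_gap M A x t \<le> ?c * inverse (1 + x\<^sup>2)" if "x \<in> {0<..}" for x
        using C(3) [OF t] that by simp
    qed
    also have "\<dots> = ?c * I" unfolding I_def by (rule set_integral_mult_right)
    finally show ?thesis by (simp only: mult_ac)
  qed
  then show ?thesis unfolding eventually_at_top_linorder by blast
qed

lemma integral_distance_lower:
  assumes "opt < \<theta>"
  shows "\<exists>b>0. \<forall>\<^sub>F t in at_top. b * exp (- \<theta> * t powr (2 - 2 * H)) \<le> integral_distance M A t"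
proof -
  obtain b t0 where b: "0 < b" "0 < t0" "\<forall>t\<ge>t0. \<exists>x0>0. \<forall>x\<in>{x0..x0 + b}.
    exp (- \<theta> * t powr (2 - 2 * H)) / 2 \<le> tail_gap M A x t"
    using assms by (rule tail_gap_lower)
  \<comment> \<open>The upper estimate serves here as an integrable majorant; \<open>opt - 1\<close>
    is an arbitrary rate below \<open>opt\<close>.\<close>
  obtain C t1 where C: "0 \<le> C" "0 < t1" "\<And>t x. t1 \<le> t \<Longrightarrow> 0 < x \<Longrightarrow>
      tail_gap M A x t \<le> C * t\<^sup>2 * exp (- (opt - 1) * t powr (2 - 2 * H)) * inverse (1 + x\<^sup>2)"
    using tail_gap_upper [of "opt - 1"] by auto
  have "b / 2 * exp (- \<theta> * t powr (2 - 2 * H)) \<le> integral_distance M A t" if t: "max t0 t1 \<le> t" for t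
  proof -
    have t_pos: "0 < t" using t b by simp
    let ?E = "exp (- \<theta> * t powr (2 - 2 * H)) / 2"
    obtain x0 where x0: "0 < x0" "\<forall>x\<in>{x0..x0 + b}. ?E \<le> tail_gap M A x t"
      using b(3) t by auto
    have "b * ?E = (LINT x|lborel. indicat_real {x0..x0 + b} x *\<^sub>R ?E)"
      using b(1) by simp
    also have "\<dots> \<le> (LINT x|lborel. indicat_real {0<..} x *\<^sub>R tail_gap M A x t)"
    proof (rule integral_mono)
      show "integrable lborel (\<lambda>x. indicat_real {x0..x0 + b} x *\<^sub>R ?E)"
        by (intro integrable_scaleR_left integrable_real_indicator) (auto simp: emeasure_lborel_Icc_eq)
      show "integrable lborel (\<lambda>x. indicat_real {0<..} x *\<^sub>R tail_gap M A x t)"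
        using tail_gap_integrable [OF t_pos C(3)] t unfolding set_integrable_def by simp
      show "indicat_real {x0..x0 + b} x *\<^sub>R ?E \<le> indicat_real {0<..} x *\<^sub>R tail_gap M A x t" for x
        using x0 tail_gap_nonneg [OF _ t_pos, of x] by (auto simp: indicator_def)
    qed
    finally show ?thesis unfolding integral_distance_def set_lebesgue_integral_def by simp
  qed
  then have "\<forall>\<^sub>F t in at_top. b / 2 * exp (- \<theta> * t powr (2 - 2 * H)) \<le> integral_distance M A t"
    unfolding eventually_at_top_linorder by blast
  then show ?thesis using b(1) by (intro exI [of _ "b / 2"] conjI) simp_all
qed

end

theorem theorem2p1:
  fixes M :: "'w measure" and A :: "real \<Rightarrow> 'w \<Rightarrow> real" and H :: real
  assumes "0 < H" and "H < 1"
    and "fractional_brownian_motion M A H"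
  shows "((\<lambda>t. ereal (1 / t powr (2 - 2 * H) * ln (KS_distance M A t))) \<longlongrightarrow> - theta H) at_top \<and>
    ((\<lambda>t. ereal (1 / t powr (2 - 2 * H) * ln (integral_distance M A t))) \<longlongrightarrow> - theta H) at_top"
proof -
  interpret fractional_brownian_motion M A H by fact
  have p: "0 < 2 - 2 * H" using assms(2) by simp
  show ?thesis
    unfolding theta_eq uminus_ereal.simps
    by (intro conjI tendsto_ereal ln_rate_limit p KS_distance_upper KS_distance_lower
        integral_distance_upper integral_distance_lower)
qed

end
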